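(* Let $N\in\mathbb{N}$. The map $\iota_{mar}:\mathfrak{g}_N^*\to\mathfrak{G}_N^*$ defined by $$\iota_{mar}(\gamma)^{(k)}:=\int_{(\mathbb{R}^{2d})^{N-k}}d\underline{z}_{k+1;N}\,\gamma,\qquad\gamma\in\mathfrak{g}_N^*,\ 1\le k\le N$$ (the $k$-particle marginal of $\gamma$) is a morphism of Poisson vector spaces from $(\mathfrak{g}_N^*,\{\cdot,\cdot\}_{\mathfrak{g}_N^*})$ to $(\mathfrak{G}_N^*,\{\cdot,\cdot\}_{\mathfrak{G}_N^*})$; that is, $\iota_{mar}$ is $\mathcal{C}^\infty$ and $\{\mathcal{F}\circ\iota_{mar},\mathcal{G}\circ\iota_{mar}\}_{\mathfrak{g}_N^*}=\{\mathcal{F},\mathcal{G}\}_{\mathfrak{G}_N^*}\circ\iota_{mar}$ for all $\mathcal{F},\mathcal{G}\in\mathcal{C}^\infty(\mathfrak{G}_N^* )$.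
   Context: Fix $d\in\mathbb{N}$. Points of $\mathbb{R}^{2d}$ are $z=(x,v)$. For $k\in\mathbb{N}$, $\mathfrak{g}_k$ is the real vector space of smooth functions $f:(\mathbb{R}^{2d})^k\to\mathbb{R}$ invariant under permutations of $z_1,\dots,z_k\in\mathbb{R}^{2d}$, with the topology generated by the seminorms $\sup_{|\alpha|\le n}\|\partial^\alpha f\|_{L^\infty(K)}$ ($K$ compact, $n\in\mathbb{N}$), and $[f,g]_{\mathfrak{g}_k}:=k\sum_{i=1}^k(\nabla_{x_i}f\cdot\nabla_{v_i}g-\nabla_{v_i}f\cdot\nabla_{x_i}g)$. $\mathfrak{g}_k^*$ is the strong dual. $\mathfrak{g}_k$ is reflexive and $\{\mathcal{F},\mathcal{G}\}_{\mathfrak{g}_k^*}(\gamma):=\langle[\mathrm{d}\mathcal{F}[\gamma],\mathrm{d}\mathcal{G}[\gamma]]_{\mathfrak{g}_k},\gamma\rangle$, Gâteaux derivatives being identified with elements of $\mathfrak{g}_k\cong\mathfrak{g}_k^{**}$. $\mathfrak{G}_N:=\bigoplus_{k=1}^N\mathfrak{g}_k$ with the product topology. $P_k^N$ is the set of $k$-tuples of distinct elements of $\{1,\dots,N\}$; $\epsilon_{k,N}:\mathfrak{g}_k\to\mathfrak{g}_N$, $\epsilon_{k,N}(f)(z_1,\dots,z_N)=\frac1{|P_k^N|}\sum_{(j_1,\dots,j_k)\in P_k^N}f(z_{j_1},\dots,z_{j_k})$, is injective, and $$[F,G]_{\mathfrak{G}_N}^{(k)}:=\epsilon_{k,N}^{-1}\Big(\sum_{\substack{1\le\ell,j\le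 N\\\min(\ell+j-1,N)=k}}[\epsilon_{\ell,N}(f^{(\ell)}),\epsilon_{j,N}(g^{(j)})]_{\mathfrak{g}_N}\Big),\quad1\le k\le N$$ (the sum lies in the image of $\epsilon_{k,N}$). $\mathfrak{G}_N^*\cong\prod_{k=1}^N\mathfrak{g}_k^*$ is the strong dual, $\mathfrak{G}_N^{**}\cong\mathfrak{G}_N$, and $\{\mathcal{F},\mathcal{G}\}_{\mathfrak{G}_N^*}(\Gamma):=\langle[\mathrm{d}\mathcal{F}[\Gamma],\mathrm{d}\mathcal{G}[\Gamma]]_{\mathfrak{G}_N},\Gamma\rangle$. For $\gamma\in\mathfrak{g}_N^*$ and $1\le k<N$, the $k$-particle marginal is the element of $\mathfrak{g}_k^*$ with $\langle\phi,\int d\underline{z}_{k+1;N}\gamma\rangle=\langle\mathrm{Sym}_N(\phi\otimes1^{\otimes(N-k)}),\gamma\rangle$ for $\phi\in\mathfrak{g}_k$, where $\mathrm{Sym}_N(h)(z_1,\dots,z_N)=\frac1{N!}\sum_{\pi\in\mathbb{S}_N}h(z_{\pi(1)},\dots,z_{\pi(N)})$; for $k=N$ it is $\gamma$ itself. Smoothness is in the Gâteaux sense (all iterated directional derivatives exist and are jointly continuous). *)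

theory Defs
  imports "HOL-Analysis.Analysis" "HOL-Library.Function_Algebras"
begin

section \<open>Function spaces as real vector spaces\<close>

instantiation "fun" :: (type, scaleR) scaleR
begin

definition scaleR_fun_def: "c *\<^sub>R f = (\<lambda>x. c *\<^sub>R f x)"

instance ..

end

lemma scaleR_fun_apply [simp]: "(c *\<^sub>R f) x = c *\<^sub>R f x"
  by (simp add: scaleR_fun_def)

instance "fun" :: (type, real_vector) real_vector
  by standard (simp_all add: fun_eq_iff scaleR_add_right scaleR_add_left)


section \<open>Locally convex spaces, strong duals, Gateaux calculus\<close>

text \<open>
  A topological vector space is given by a topology \<open>X\<close> on a type of class \<open>real_vector\<close>; its
  underlying vector space is the linear subspace \<open>topspace X\<close>.
\<close>

definition seminorm_topology :: "'a::real_vector set \<Rightarrow> ('a \<Rightarrow> real) set \<Rightarrow> 'a topology" where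
  "seminorm_topology V P =
     topology_generated_by {{y \<in> V. p (y - x) < e} | p x e. p \<in> P \<and> x \<in> V \<and> 0 < e}"

text \<open>Functionals are extended by \<open>0\<close> outside the space, so that distinct elements of the dual are
  distinct functions and the vector space operations are pointwise.\<close>

definition dual_space :: "'a::real_vector topology \<Rightarrow> ('a \<Rightarrow> real) set" where
  "dual_space X = {\<gamma>.
     (\<forall>x\<in>topspace X. \<forall>y\<in>topspace X. \<gamma> (x + y) = \<gamma> x + \<gamma> y) \<and>
     (\<forall>c. \<forall>x\<in>topspace X. \<gamma> (c *\<^sub>R x) = c * \<gamma> x) \<and>
     continuous_map X euclideanreal \<gamma> \<and>
     (\<forall>x. x \<notin> topspace X \<longrightarrow> \<gamma> x = 0)}"

definition tvs_bounded :: "'a::real_vector topology \<Rightarrow> 'a set \<Rightarrow> bool" where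
  "tvs_bounded X B \<longleftrightarrow> B \<subseteq> topspace X \<and>
     (\<forall>U. openin X U \<and> 0 \<in> U \<longrightarrow> (\<exists>s>0. \<forall>t\<ge>s. B \<subseteq> (\<lambda>x. t *\<^sub>R x) ` U))"

definition strong_dual :: "'a::real_vector topology \<Rightarrow> ('a \<Rightarrow> real) topology" where
  "strong_dual X = seminorm_topology (dual_space X)
     {\<lambda>\<gamma>. (SUP f\<in>B. \<bar>\<gamma> f\<bar>) | B. B \<noteq> {} \<and> tvs_bounded X B}"

definition dir_deriv ::
    "'b::real_vector topology \<Rightarrow> ('a::real_vector \<Rightarrow> 'b) \<Rightarrow> 'a \<Rightarrow> 'a \<Rightarrow> 'b" where
  "dir_deriv Y F x v = (THE L. limitin Y (\<lambda>t::real. (F (x + t *\<^sub>R v) - F x) /\<^sub>R t) L (at 0))"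

definition has_dir_deriv ::
    "'b::real_vector topology \<Rightarrow> ('a::real_vector \<Rightarrow> 'b) \<Rightarrow> 'a \<Rightarrow> 'a \<Rightarrow> bool" where
  "has_dir_deriv Y F x v \<longleftrightarrow> (\<exists>L. limitin Y (\<lambda>t::real. (F (x + t *\<^sub>R v) - F x) /\<^sub>R t) L (at 0))"

text \<open>
  \<open>iter_deriv Y F m w\<close> is the \<open>m\<close>-th directional derivative of \<open>F\<close> at the point \<open>w 0\<close> in the
  directions \<open>w 1, \<dots>, w m\<close>; each new derivative is taken in the base point only.
\<close>

primrec iter_deriv ::
    "'b::real_vector topology \<Rightarrow> ('a::real_vector \<Rightarrow> 'b) \<Rightarrow> nat \<Rightarrow> (nat \<Rightarrow> 'a) \<Rightarrow> 'b" where
  "iter_deriv Y F 0 w = F (w 0)"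
| "iter_deriv Y F (Suc m) w = dir_deriv Y (\<lambda>x. iter_deriv Y F m (w(0 := x))) (w 0) (w (Suc m))"

definition gateaux_smooth ::
    "'a::real_vector topology \<Rightarrow> 'b::real_vector topology \<Rightarrow> ('a \<Rightarrow> 'b) \<Rightarrow> bool" where
  "gateaux_smooth X Y F \<longleftrightarrow>
     (\<forall>m. continuous_map (product_topology (\<lambda>_. X) {..m}) Y (iter_deriv Y F m)) \<and>
     (\<forall>m. \<forall>w. (\<forall>i\<le>Suc m. w i \<in> topspace X) \<longrightarrow>
        has_dir_deriv Y (\<lambda>x. iter_deriv Y F m (w(0 := x))) (w 0) (w (Suc m)))"

text \<open>
  The Gateaux derivative of a functional \<open>F\<close> on the strong dual of \<open>X\<close> at \<open>\<Gamma>\<close> is an element of the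
  bidual of \<open>X\<close>; \<open>diff_elem X F \<Gamma>\<close> is the element of the reflexive space \<open>X\<close> representing it.
\<close>

definition diff_elem :: "'a::real_vector topology \<Rightarrow> (('a \<Rightarrow> real) \<Rightarrow> real) \<Rightarrow> ('a \<Rightarrow> real) \<Rightarrow> 'a" where
  "diff_elem X F \<Gamma> =
     (THE f. f \<in> topspace X \<and> (\<forall>\<Delta>\<in>dual_space X. dir_deriv euclideanreal F \<Gamma> \<Delta> = \<Delta> f))"

definition lie_poisson ::
    "'a::real_vector topology \<Rightarrow> ('a \<Rightarrow> 'a \<Rightarrow> 'a) \<Rightarrow>
     (('a \<Rightarrow> real) \<Rightarrow> real) \<Rightarrow> (('a \<Rightarrow> real) \<Rightarrow> real) \<Rightarrow> ('a \<Rightarrow> real) \<Rightarrow> real" where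
  "lie_poisson X br F G \<Gamma> = \<Gamma> (br (diff_elem X F \<Gamma>) (diff_elem X G \<Gamma>))"


section \<open>Observables: the Lie algebras of \<open>k\<close>-particle functions\<close>

type_synonym 'd phase = "(real^'d) \<times> (real^'d)"

text \<open>
  A function of \<open>k\<close> variables \<open>z\<^sub>1, \<dots>, z\<^sub>k\<close> in phase space is represented by a function
  of a sequence \<open>z :: nat \<Rightarrow> 'd phase\<close> that depends only on \<open>z 1, \<dots>, z k\<close>. This is a bijection, and
  since the topology of the type \<open>nat \<Rightarrow> 'd phase\<close> is the product topology, continuity agrees
  and compact sets of sequences project onto exactly the compact sets of \<open>k\<close>-tuples.
\<close>

type_synonym 'd obs = "(nat \<Rightarrow> 'd phase) \<Rightarrow> real"

definition partial :: "nat \<Rightarrow> 'd phase \<Rightarrow> ('d::finite) obs \<Rightarrow> 'd obs" where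
  "partial i b f = (\<lambda>z. deriv (\<lambda>t::real. f (z(i := z i + t *\<^sub>R b))) 0)"

text \<open>A list of coordinate directions plays the role of a multi-index, its length that of the order.\<close>

definition iter_partial :: "(nat \<times> 'd phase) list \<Rightarrow> ('d::finite) obs \<Rightarrow> 'd obs" where
  "iter_partial l f = foldr (\<lambda>(i, b). partial i b) l f"

definition coord_dirs :: "nat \<Rightarrow> (nat \<times> ('d::finite) phase) set" where
  "coord_dirs k = {1..k} \<times> Basis"

definition smooth_obs :: "nat \<Rightarrow> ('d::finite) obs \<Rightarrow> bool" where
  "smooth_obs k f \<longleftrightarrow> (\<forall>l\<in>lists (coord_dirs k).
     continuous_on UNIV (iter_partial l f) \<and>
     (\<forall>(i, b)\<in>coord_dirs k. \<forall>z.
        (\<lambda>t::real. iter_partial l f (z(i := z i + t *\<^sub>R b))) differentiable (at 0)))"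

definition g_space :: "nat \<Rightarrow> ('d::finite) obs set" where
  "g_space k = {f.
     (\<forall>z z'. (\<forall>i\<in>{1..k}. z i = z' i) \<longrightarrow> f z = f z') \<and>
     smooth_obs k f \<and>
     (\<forall>\<pi> z. \<pi> permutes {1..k} \<longrightarrow> f (z \<circ> \<pi>) = f z)}"

definition g_seminorm :: "nat \<Rightarrow> (nat \<Rightarrow> ('d::finite) phase) set \<Rightarrow> nat \<Rightarrow> 'd obs \<Rightarrow> real" where
  "g_seminorm k K n f =
     Sup {\<bar>iter_partial l f z\<bar> | l z. l \<in> lists (coord_dirs k) \<and> length l \<le> n \<and> z \<in> K}"

definition g_top :: "nat \<Rightarrow> ('d::finite) obs topology" where
  "g_top k = seminorm_topology (g_space k) {g_seminorm k K n | K n. compact K \<and> K \<noteq> {}}"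

definition grad_x :: "nat \<Rightarrow> ('d::finite) obs \<Rightarrow> (nat \<Rightarrow> 'd phase) \<Rightarrow> real^'d" where
  "grad_x i f z = (\<chi> c. partial i (axis c 1, 0) f z)"

definition grad_v :: "nat \<Rightarrow> ('d::finite) obs \<Rightarrow> (nat \<Rightarrow> 'd phase) \<Rightarrow> real^'d" where
  "grad_v i f z = (\<chi> c. partial i (0, axis c 1) f z)"

definition g_bracket :: "nat \<Rightarrow> ('d::finite) obs \<Rightarrow> 'd obs \<Rightarrow> 'd obs" where
  "g_bracket k f g = (\<lambda>z. real k *
     (\<Sum>i=1..k. grad_x i f z \<bullet> grad_v i g z - grad_v i f z \<bullet> grad_x i g z))"


section \<open>Hierarchies of observables\<close>

text \<open>Hierarchies \<open>(f\<^sup>(\<^sup>k\<^sup>))\<close>, \<open>1 \<le> k \<le> N\<close>, are sequences that vanish at all other indices.\<close>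

type_synonym 'd hier = "nat \<Rightarrow> 'd obs"

definition G_top :: "nat \<Rightarrow> ('d::finite) hier topology" where
  "G_top N = product_topology (\<lambda>k. if k \<in> {1..N} then g_top k else discrete_topology {0}) UNIV"

definition distinct_tuples :: "nat \<Rightarrow> nat \<Rightarrow> (nat \<Rightarrow> nat) set" where
  "distinct_tuples k N = {j \<in> {1..k} \<rightarrow>\<^sub>E {1..N}. inj_on j {1..k}}"

definition eps :: "nat \<Rightarrow> nat \<Rightarrow> ('d::finite) obs \<Rightarrow> 'd obs" where
  "eps k N f = (\<lambda>z. 1 / real (card (distinct_tuples k N)) * (\<Sum>j\<in>distinct_tuples k N. f (z \<circ> j)))"

definition G_bracket :: "nat \<Rightarrow> ('d::finite) hier \<Rightarrow> 'd hier \<Rightarrow> 'd hier" where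
  "G_bracket N F G = (\<lambda>k. if k \<in> {1..N} then
     inv_into (g_space k) (eps k N)
       (\<Sum>(l, j) \<in> {(l, j). l \<in> {1..N} \<and> j \<in> {1..N} \<and> min (l + j - 1) N = k}.
          g_bracket N (eps l N (F l)) (eps j N (G j)))
     else 0)"


section \<open>Marginals\<close>

definition Sym :: "nat \<Rightarrow> ('d::finite) obs \<Rightarrow> 'd obs" where
  "Sym N h = (\<lambda>z. 1 / fact N * (\<Sum>\<pi> | \<pi> permutes {1..N}. h (z \<circ> \<pi>)))"

text \<open>
  In the representation of observables used here, the function
  \<open>\<phi> \<otimes> 1\<^sup>\<otimes>\<^sup>(\<^sup>N\<^sup>-\<^sup>k\<^sup>)\<close> of \<open>N\<close> variables is the same object as the function \<open>\<phi>\<close> of \<open>k\<close> variables.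
\<close>

definition marginal :: "nat \<Rightarrow> nat \<Rightarrow> (('d::finite) obs \<Rightarrow> real) \<Rightarrow> ('d obs \<Rightarrow> real)" where
  "marginal N k \<gamma> = (if k = N then \<gamma> else (\<lambda>\<phi>. if \<phi> \<in> g_space k then \<gamma> (Sym N \<phi>) else 0))"

text \<open>
  The component \<open>\<Gamma>\<^sup>(\<^sup>k\<^sup>)\<close> of a functional on hierarchies, and the functional with given
  components \<open>\<gamma>\<^sub>k\<close>; these are the two directions of the identification of the dual of the direct
  sum with the product of the duals.
\<close>

definition component :: "nat \<Rightarrow> (('d::finite) hier \<Rightarrow> real) \<Rightarrow> ('d obs \<Rightarrow> real)" where
  "component k \<Gamma> = (\<lambda>f. if f \<in> g_space k then \<Gamma> (\<lambda>j. if j = k then f else 0) else 0)"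

definition of_components :: "nat \<Rightarrow> (nat \<Rightarrow> (('d::finite) obs \<Rightarrow> real)) \<Rightarrow> ('d hier \<Rightarrow> real)" where
  "of_components N \<gamma> = (\<lambda>F. if F \<in> topspace (G_top N) then (\<Sum>k=1..N. \<gamma> k (F k)) else 0)"

definition iota_mar :: "nat \<Rightarrow> (('d::finite) obs \<Rightarrow> real) \<Rightarrow> ('d hier \<Rightarrow> real)" where
  "iota_mar N \<gamma> = of_components N (\<lambda>k. marginal N k \<gamma>)"


section \<open>Consistency of the encodings\<close>

lemma topspace_seminorm_topology:
  assumes "p \<in> P" "\<And>p. p \<in> P \<Longrightarrow> p 0 = 0"
  shows "topspace (seminorm_topology V P) = V"
proof -
  have "x \<in> \<Union>{{y \<in> V. p (y - x) < e} | p x e. p \<in> P \<and> x \<in> V \<and> 0 < e}" if "x \<in> V" for x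
  proof (rule UnionI)
    show "{y \<in> V. p (y - x) < 1} \<in> {{y \<in> V. p (y - x) < e} | p x e. p \<in> P \<and> x \<in> V \<and> 0 < e}"
      using assms(1) that by (intro CollectI exI[of _ p] exI[of _ x] exI[of _ 1]) auto
    show "x \<in> {y \<in> V. p (y - x) < 1}"
      using that assms(1) assms(2)[OF assms(1)] by simp
  qed
  then have "\<Union>{{y \<in> V. p (y - x) < e} | p x e. p \<in> P \<and> x \<in> V \<and> 0 < e} = V"
    by blast
  then show ?thesis
    by (simp add: seminorm_topology_def)
qed

lemma iter_partial_zero [simp]: "iter_partial l 0 = 0"
  by (induction l) (auto simp: iter_partial_def partial_def fun_eq_iff)

lemma zero_in_g_space [simp]: "0 \<in> g_space k"
proof -
  have "continuous_on UNIV (0::'a obs)"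
    by (simp add: zero_fun_def)
  then show ?thesis
    by (auto simp: g_space_def smooth_obs_def)
qed

lemma topspace_g_top [simp]: "topspace (g_top k) = g_space k"
  unfolding g_top_def
proof (rule topspace_seminorm_topology)
  show "g_seminorm k {\<lambda>_. 0} k \<in> {g_seminorm k K n | K n. compact K \<and> K \<noteq> {}}"
    by (intro CollectI exI[of _ "{\<lambda>_. 0}"] exI[of _ k]) simp
next
  fix p :: "'a obs \<Rightarrow> real"
  assume "p \<in> {g_seminorm k K n | K n. compact K \<and> K \<noteq> {}}"
  then obtain K n where p: "p = g_seminorm k K n" and K: "K \<noteq> {}"
    by blast
  have "{\<bar>iter_partial l (0::'a obs) z\<bar> | l z. l \<in> lists (coord_dirs k) \<and> length l \<le> n \<and> z \<in> K} = {0}"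
    using K by (auto intro!: exI[of _ "[]"])
  then show "p 0 = 0"
    by (simp add: p g_seminorm_def)
qed

lemma topspace_G_top:
  "topspace (G_top N) = {F. \<forall>k. F k \<in> (if k \<in> {1..N} then g_space k else {0})}"
  by (auto simp: G_top_def PiE_def Pi_def split: if_splits)

lemma topspace_strong_dual [simp]:
  assumes "0 \<in> topspace X"
  shows "topspace (strong_dual X) = dual_space X"
  unfolding strong_dual_def
proof (rule topspace_seminorm_topology)
  have "tvs_bounded X {0}"
    using assms by (auto simp: tvs_bounded_def intro!: exI[of _ 1] image_eqI[of _ _ 0])
  then show "(\<lambda>\<gamma>. (SUP f\<in>{0}. \<bar>\<gamma> f\<bar>)) \<in> {\<lambda>\<gamma>. (SUP f\<in>B. \<bar>\<gamma> f\<bar>) | B. B \<noteq> {} \<and> tvs_bounded X B}"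
    by blast
next
  fix p :: "('a \<Rightarrow> real) \<Rightarrow> real"
  assume "p \<in> {\<lambda>\<gamma>. (SUP f\<in>B. \<bar>\<gamma> f\<bar>) | B. B \<noteq> {} \<and> tvs_bounded X B}"
  then obtain B where "p = (\<lambda>\<gamma>. (SUP f\<in>B. \<bar>\<gamma> f\<bar>))" "B \<noteq> {}"
    by blast
  then show "p 0 = 0"
    by (simp add: cSUP_const)
qed

lemma component_iota_mar:
  assumes "\<gamma> \<in> dual_space (g_top N)" "k \<in> {1..N}"
  shows "component k (iota_mar N \<gamma>) = marginal N k \<gamma>"
proof
  fix f :: "'a obs"
  have lin: "\<gamma> (c *\<^sub>R x) = c * \<gamma> x" if "x \<in> g_space N" for c x
    using assms(1) that by (simp add: dual_space_def)
  have z: "\<gamma> 0 = 0"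
    using lin[of 0 0] by simp
  have "Sym N (0::'a obs) = 0"
    by (auto simp: Sym_def)
  then have m0: "marginal N j \<gamma> 0 = 0" for j
    using z by (simp add: marginal_def)
  show "component k (iota_mar N \<gamma>) f = marginal N k \<gamma> f"
  proof (cases "f \<in> g_space k")
    case True
    have "(\<lambda>j. if j = k then f else 0) \<in> topspace (G_top N)"
      using True assms(2) by (auto simp: topspace_G_top)
    then have "component k (iota_mar N \<gamma>) f
        = (\<Sum>j=1..N. marginal N j \<gamma> (if j = k then f else 0))"
      using True by (simp add: component_def iota_mar_def of_components_def)
    also have "\<dots> = (\<Sum>j=1..N. if j = k then marginal N k \<gamma> f else 0)"
      by (intro sum.cong) (auto simp: m0)
    also have "\<dots> = marginal N k \<gamma> f"
      using assms(2) by simp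
    finally show ?thesis .
  next
    case False
    then show ?thesis
      using assms(1) by (auto simp: component_def marginal_def dual_space_def)
  qed
qed

end

theory Submission
  imports Defs
begin

text \<open>
  The map \<open>\<iota>\<close> is the transpose of the linear map \<open>F \<mapsto> \<Sum>\<^sub>k Sym\<^sub>N (F\<^sup>(\<^sup>k\<^sup>))\<close> from hierarchies to \<open>N\<close>-particle
  observables, and this map is a Lie algebra homomorphism; the transpose of a continuous Lie algebra
  homomorphism is a Poisson map, because the chain rule turns \<open>d(\<F> \<circ> \<iota>)[\<gamma>]\<close> into the image of
  \<open>d\<F>[\<iota> \<gamma>]\<close>. The homomorphism property rests on the invariance of the bracket under permutations,
  by which one of the two symmetrisations in a bracket can be pulled out, and on a count of variables.

  That the Gateaux derivative of a functional is represented by an element of the space itself is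
  reflexivity of the spaces of observables. Given \<open>L\<close> in the bidual, the candidate is the function
  \<open>z \<mapsto> L \<delta>\<^sub>z\<close>. On a bounded set of observables all derivatives are equicontinuous, so this function is
  smooth, with derivatives given by \<open>L\<close> on derivatives of Dirac functionals; by a finite version of
  Goldstine's theorem it is approximated, in the topology of the space, by elements of a fixed bounded
  set on which a prescribed \<open>\<Delta>\<close> is close to \<open>L \<Delta>\<close>.
\<close>

section \<open>Seminorm topologies\<close>

text \<open>Derivatives enter the brackets through \<open>diff_elem\<close>, a definite description,
  which is informative only once a representing element is known to exist and to be unique.
  Existence is the obstacle. \<open>gateaux_smooth\<close> does not demand that the derivative be
  linear in the direction, so additivity has to be extracted from joint continuity before the
  derivative is an element of the bidual; then that element has to be represented. This is carried
  out for hierarchies, where the functionals are arbitrary, by reduction to the finitely many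
  components. On \<open>g_top N\<close> the chain rule exhibits the representing element, and
  uniqueness holds because Dirac functionals separate observables. The number
  \<open>l + j - 1\<close> in \<open>G_bracket\<close> is the size of the union of two sets of
  variables of sizes \<open>l\<close> and \<open>j\<close> with one common element. A larger overlap
  gives fewer variables, so those terms live at the same level; terms without overlap
  vanish.\<close>

definition seminorm_on :: "'a::real_vector set \<Rightarrow> ('a \<Rightarrow> real) \<Rightarrow> bool" where
  "seminorm_on V p \<longleftrightarrow>
     (\<forall>x\<in>V. \<forall>y\<in>V. p (x + y) \<le> p x + p y) \<and> (\<forall>c. \<forall>x\<in>V. p (c *\<^sub>R x) = \<bar>c\<bar> * p x)"

text \<open>\<open>seminorm_topology\<close> takes the balls only as a subbase. The condition
  \<open>directed\<close> makes them a neighbourhood base at each point, so that one seminorm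
  suffices for each neighbourhood.\<close>

locale seminormed_space =
  fixes V :: "'a::real_vector set" and P :: "('a \<Rightarrow> real) set"
  assumes subspace: "subspace V"
    and nonempty: "P \<noteq> {}"
    and seminorm: "p \<in> P \<Longrightarrow> seminorm_on V p"
    and directed: "p \<in> P \<Longrightarrow> q \<in> P \<Longrightarrow> \<exists>r\<in>P. \<forall>x\<in>V. p x \<le> r x \<and> q x \<le> r x"
begin

lemma seminorm_add: "p \<in> P \<Longrightarrow> x \<in> V \<Longrightarrow> y \<in> V \<Longrightarrow> p (x + y) \<le> p x + p y"
  using seminorm by (auto simp: seminorm_on_def)

lemma seminorm_scale: "p \<in> P \<Longrightarrow> x \<in> V \<Longrightarrow> p (c *\<^sub>R x) = \<bar>c\<bar> * p x"
  using seminorm by (auto simp: seminorm_on_def)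

lemma seminorm_zero: "p \<in> P \<Longrightarrow> p 0 = 0"
  using seminorm_scale[of p 0 0] subspace_0[OF subspace] by simp

lemma seminorm_minus: "p \<in> P \<Longrightarrow> x \<in> V \<Longrightarrow> p (- x) = p x"
  using seminorm_scale[of p x "-1"] by simp

lemma seminorm_nonneg:
  assumes "p \<in> P" "x \<in> V"
  shows "0 \<le> p x"
proof -
  have "p (x + - x) \<le> p x + p (- x)"
    using assms subspace_neg[OF subspace] by (intro seminorm_add) auto
  then show ?thesis
    using assms by (simp add: seminorm_minus seminorm_zero)
qed

lemma seminorm_triangle:
  assumes "p \<in> P" "x \<in> V" "y \<in> V" "z \<in> V"
  shows "p (x - z) \<le> p (x - y) + p (y - z)"
  using seminorm_add[of p "x - y" "y - z"] assms subspace_diff[OF subspace] by simp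

abbreviation Top :: "'a topology" where
  "Top \<equiv> seminorm_topology V P"

lemma topspace_Top: "topspace Top = V"
  using nonempty seminorm_zero by (meson ex_in_conv topspace_seminorm_topology)

lemma openin_ball: "p \<in> P \<Longrightarrow> x \<in> V \<Longrightarrow> 0 < e \<Longrightarrow> openin Top {y \<in> V. p (y - x) < e}"
  unfolding seminorm_topology_def by (rule topology_generated_by_Basis) blast

text \<open>Induction over the generation of the topology. Intersections are where
  \<open>directed\<close> enters; a subbasic ball with another centre \<open>x0\<close> contains the
  ball around \<open>x\<close> of radius \<open>e - p (x - x0)\<close>.\<close>

lemma openin_contains_ball:
  assumes "openin Top U" "x \<in> U"
  shows "\<exists>p\<in>P. \<exists>e>0. {y \<in> V. p (y - x) < e} \<subseteq> U"
proof -
  have "generate_topology_on {{y \<in> V. p (y - x) < e} | p x e. p \<in> P \<and> x \<in> V \<and> 0 < e} U"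
    using assms(1) by (simp add: seminorm_topology_def openin_topology_generated_by_iff)
  then show ?thesis
    using assms(2)
  proof (induction U rule: generate_topology_on.induct)
    case Empty
    then show ?case by simp
  next
    case (Int A B)
    obtain p e where p: "p \<in> P" "e > 0" "{y \<in> V. p (y - x) < e} \<subseteq> A"
      using Int by blast
    obtain q d where q: "q \<in> P" "d > 0" "{y \<in> V. q (y - x) < d} \<subseteq> B"
      using Int by blast
    obtain r where r: "r \<in> P" "\<And>x. x \<in> V \<Longrightarrow> p x \<le> r x \<and> q x \<le> r x"
      using directed p(1) q(1) by blast
    have "x \<in> V"
      using Int(1) Int.prems topspace_Top openin_subset[of Top A]
      by (auto simp: seminorm_topology_def openin_topology_generated_by_iff)
    then have "{y \<in> V. r (y - x) < min e d} \<subseteq> A \<inter> B"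
    proof (intro subsetI)
      fix y assume "y \<in> {y \<in> V. r (y - x) < min e d}"
      then have y: "y \<in> V" "r (y - x) < e" "r (y - x) < d"
        by auto
      with r(2)[of "y - x"] subspace_diff[OF subspace y(1) \<open>x \<in> V\<close>]
      have "p (y - x) < e" "q (y - x) < d"
        by auto
      then show "y \<in> A \<inter> B"
        using p(3) q(3) y(1) by blast
    qed
    then show ?case
      using r(1) p(2) q(2) by (intro bexI[of _ r] exI[of _ "min e d"]) auto
  next
    case (UN K)
    then show ?case by (meson Union_upper UnionE order_trans)
  next
    case (Basis S)
    then obtain p x0 e where p: "p \<in> P" "x0 \<in> V" "0 < e" "S = {y \<in> V. p (y - x0) < e}"
      by blast
    then have x: "x \<in> V" "p (x - x0) < e"
      using Basis by auto
    have "{y \<in> V. p (y - x) < e - p (x - x0)} \<subseteq> S"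
      using p x seminorm_triangle[of p _ x x0] by fastforce
    then show ?case
      using p x by (intro bexI[of _ p] exI[of _ "e - p (x - x0)"]) auto
  qed
qed

lemma continuous_map_TopI:
  assumes "\<And>x. x \<in> topspace X \<Longrightarrow> f x \<in> V"
    and "\<And>p x e. p \<in> P \<Longrightarrow> x \<in> topspace X \<Longrightarrow> 0 < e \<Longrightarrow>
      \<exists>U. openin X U \<and> x \<in> U \<and> (\<forall>y\<in>U. p (f y - f x) < e)"
  shows "continuous_map X Top f"
  unfolding seminorm_topology_def
proof (rule continuous_on_generated_topo)
  fix S assume "S \<in> {{y \<in> V. p (y - x) < e} | p x e. p \<in> P \<and> x \<in> V \<and> 0 < e}"
  then obtain p x0 e where p: "p \<in> P" "x0 \<in> V" "0 < e" "S = {y \<in> V. p (y - x0) < e}"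
    by blast
  have "\<exists>U. openin X U \<and> x \<in> U \<and> U \<subseteq> f -` S \<inter> topspace X"
    if x: "x \<in> f -` S \<inter> topspace X" for x
  proof -
    have fx: "f x \<in> V" "p (f x - x0) < e"
      using x p by auto
    then obtain U where U: "openin X U" "x \<in> U" "\<forall>y\<in>U. p (f y - f x) < e - p (f x - x0)"
      using assms(2)[of p x "e - p (f x - x0)"] p x by auto
    have "U \<subseteq> f -` S \<inter> topspace X"
    proof
      fix y assume y: "y \<in> U"
      then have "y \<in> topspace X"
        using U(1) openin_subset by blast
      moreover have "p (f y - x0) < e"
        using seminorm_triangle[of p "f y" "f x" x0] U(3) y p fx assms(1)[OF calculation]
        by fastforce
      ultimately show "y \<in> f -` S \<inter> topspace X"
        using p assms(1) by auto
    qed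
    then show ?thesis
      using U by blast
  qed
  then show "openin X (f -` S \<inter> topspace X)"
    by (subst openin_subopen) blast
next
  have "\<Union> {{y \<in> V. p (y - x) < e} | p x e. p \<in> P \<and> x \<in> V \<and> 0 < e} = V"
    using topspace_Top by (simp add: seminorm_topology_def)
  then show "f ` topspace X \<subseteq> \<Union> {{y \<in> V. p (y - x) < e} | p x e. p \<in> P \<and> x \<in> V \<and> 0 < e}"
    using assms(1) by auto
qed

lemma continuous_map_scale:
  assumes "x \<in> V"
  shows "continuous_map euclideanreal Top (\<lambda>c. c *\<^sub>R x)"
proof (rule continuous_map_TopI)
  fix p and c e :: real assume p: "p \<in> P" and e: "0 < e"
  have "open {d. \<bar>d - c\<bar> * p x < e}"
    by (intro open_Collect_less continuous_intros)
  moreover have "p (d *\<^sub>R x - c *\<^sub>R x) = \<bar>d - c\<bar> * p x" for d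
    using seminorm_scale[OF p assms, of "d - c"] by (simp add: scaleR_diff_left)
  ultimately show "\<exists>U. openin euclideanreal U \<and> c \<in> U \<and> (\<forall>d\<in>U. p (d *\<^sub>R x - c *\<^sub>R x) < e)"
    using e by (intro exI[of _ "{d. \<bar>d - c\<bar> * p x < e}"]) auto
qed (use subspace_scale[OF subspace assms] in auto)

lemma continuous_map_sum:
  assumes "finite I" "\<And>i. i \<in> I \<Longrightarrow> continuous_map X Top (f i)"
  shows "continuous_map X Top (\<lambda>x. \<Sum>i\<in>I. f i x)"
  using assms
proof (induction I rule: finite_induct)
  case empty
  then show ?case
    using subspace_0[OF subspace] by (simp only: sum.empty continuous_map_const topspace_Top) simp
next
  case (insert i I)
  have f: "continuous_map X Top (f i)" and g: "continuous_map X Top (\<lambda>x. \<Sum>i\<in>I. f i x)"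
    using insert by auto
  have fV: "f i x \<in> V" and gV: "(\<Sum>i\<in>I. f i x) \<in> V" if "x \<in> topspace X" for x
    using f g that by (auto simp: continuous_map_def topspace_Top)
  have "continuous_map X Top (\<lambda>x. f i x + (\<Sum>i\<in>I. f i x))"
  proof (rule continuous_map_TopI)
    fix p x and e :: real assume p: "p \<in> P" and x: "x \<in> topspace X" and e: "0 < e"
    define U where "U = {y \<in> topspace X. f i y \<in> {v \<in> V. p (v - f i x) < e / 2}}
      \<inter> {y \<in> topspace X. (\<Sum>i\<in>I. f i y) \<in> {v \<in> V. p (v - (\<Sum>i\<in>I. f i x)) < e / 2}}"
    have "openin X U"
      unfolding U_def using e
      by (intro openin_Int openin_continuous_map_preimage[OF f] openin_continuous_map_preimage[OF g]
          openin_ball p fV gV x) auto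
    moreover have "x \<in> U"
      using x fV gV e seminorm_zero[OF p] by (simp add: U_def)
    moreover have "p ((f i y + (\<Sum>i\<in>I. f i y)) - (f i x + (\<Sum>i\<in>I. f i x))) < e" if "y \<in> U" for y
    proof -
      have y: "y \<in> topspace X" "p (f i y - f i x) < e / 2" "p ((\<Sum>i\<in>I. f i y) - (\<Sum>i\<in>I. f i x)) < e / 2"
        using that by (auto simp: U_def)
      have "p ((f i y - f i x) + ((\<Sum>i\<in>I. f i y) - (\<Sum>i\<in>I. f i x))) < e"
        using seminorm_add[OF p subspace_diff[OF subspace fV[OF y(1)] fV[OF x]]
            subspace_diff[OF subspace gV[OF y(1)] gV[OF x]]] y by linarith
      then show ?thesis
        by (simp add: algebra_simps)
    qed
    ultimately show "\<exists>U. openin X U \<and> x \<in> U \<and>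
        (\<forall>y\<in>U. p ((f i y + (\<Sum>i\<in>I. f i y)) - (f i x + (\<Sum>i\<in>I. f i x))) < e)"
      by blast
  qed (use fV gV subspace_add[OF subspace] in blast)
  then show ?case
    using insert.hyps by (simp only: sum.insert not_False_eq_True)
qed

text \<open>By continuity at 0 the functional is below 1 in modulus on some ball of some
  \<open>p\<close>, and homogeneity turns this into a global bound.\<close>

lemma continuous_functional_bound:
  assumes "continuous_map Top euclideanreal L"
    and "\<And>c x. x \<in> V \<Longrightarrow> L (c *\<^sub>R x) = c * L x"
  shows "\<exists>p\<in>P. \<exists>C>0. \<forall>x\<in>V. \<bar>L x\<bar> \<le> C * p x"
proof -
  have L0: "L 0 = 0"
    using assms(2)[of 0 0] subspace_0[OF subspace] by simp
  have "openin Top {x \<in> topspace Top. L x \<in> {-1<..<1}}"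
    by (rule openin_continuous_map_preimage[OF assms(1)]) simp
  moreover have "0 \<in> {x \<in> topspace Top. L x \<in> {-1<..<1}}"
    using L0 subspace_0[OF subspace] topspace_Top by simp
  ultimately obtain p e where p: "p \<in> P" "e > 0"
      "{y \<in> V. p (y - 0) < e} \<subseteq> {x \<in> topspace Top. L x \<in> {-1<..<1}}"
    using openin_contains_ball by meson
  have *: "\<bar>L x\<bar> < 1" if "x \<in> V" "p x < e" for x
    using p(3) that by fastforce
  have "\<bar>L x\<bar> \<le> 2 / e * p x" if x: "x \<in> V" for x
  proof (cases "p x = 0")
    case True
    \<comment> \<open>The whole line through \<open>x\<close> lies in the ball, so \<open>L\<close>
      is bounded by 1 on it and must vanish there.\<close>
    have "\<bar>c * L x\<bar> < 1" for c
      using *[of "c *\<^sub>R x"] x p True assms(2)[OF x] subspace_scale[OF subspace x]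
      by (simp add: seminorm_scale)
    from this[of "1 / L x"] have "L x = 0"
      by (cases "L x = 0") auto
    then show ?thesis
      by (simp add: True)
  next
    case False
    then have px: "p x > 0"
      using seminorm_nonneg[OF p(1) x] by simp
    \<comment> \<open>The factor brings \<open>x\<close> to seminorm \<open>e / 2\<close>, strictly
      inside the ball; hence the constant \<open>2 / e\<close>.\<close>
    have "\<bar>e / (2 * p x) * L x\<bar> < 1"
      using *[of "(e / (2 * p x)) *\<^sub>R x"] x p px assms(2)[OF x] subspace_scale[OF subspace x]
      by (simp add: seminorm_scale)
    then show ?thesis
      using px p(2) by (simp add: abs_mult field_simps)
  qed
  then show ?thesis
    using p by (intro bexI[of _ p] exI[of _ "2 / e"]) auto
qed

lemma bounded_functional_continuous:
  assumes "p \<in> P" "\<And>x. x \<in> V \<Longrightarrow> \<bar>L x\<bar> \<le> C * p x"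
    and "\<And>x y. x \<in> V \<Longrightarrow> y \<in> V \<Longrightarrow> L (x - y) = L x - L y"
  shows "continuous_map Top euclideanreal L"
  unfolding continuous_map_atin limitin_canonical_iff
proof (intro ballI)
  fix x assume "x \<in> topspace Top"
  then have x: "x \<in> V"
    by (simp add: topspace_Top)
  show "(L \<longlongrightarrow> L x) (atin Top x)"
  proof (rule tendstoI)
    fix e :: real assume e: "e > 0"
    \<comment> \<open>\<open>C\<close> may be zero or negative; \<open>D\<close> is a larger
      constant by which one can divide.\<close>
    define D where "D = \<bar>C\<bar> + 1"
    have D: "D > 0" "C \<le> D"
      by (auto simp: D_def)
    have "dist (L y) (L x) < e" if y: "y \<in> V" "p (y - x) < e / D" for y
    proof -
      have v: "y - x \<in> V"
        using x y subspace_diff[OF subspace] by blast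
      have "\<bar>L y - L x\<bar> \<le> C * p (y - x)"
        using assms(2)[OF v] assms(3) x y by simp
      also have "\<dots> \<le> D * p (y - x)"
        using D seminorm_nonneg[OF assms(1) v] by (intro mult_right_mono) auto
      also have "\<dots> < e"
        using y D by (simp add: field_simps)
      finally show ?thesis by (simp add: dist_real_def)
    qed
    then show "\<forall>\<^sub>F y in atin Top x. dist (L y) (L x) < e"
      unfolding eventually_atin
      using openin_ball[OF assms(1) x, of "e / D"] x e D seminorm_zero[OF assms(1)]
      by (intro disjI2 exI[of _ "{y \<in> V. p (y - x) < e / D}"]) auto
  qed
qed

lemma Hausdorff_Top:
  assumes "\<And>x. x \<in> V \<Longrightarrow> x \<noteq> 0 \<Longrightarrow> \<exists>p\<in>P. p x > 0"
  shows "Hausdorff_space Top"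
  unfolding Hausdorff_space_def topspace_Top
proof (intro allI impI)
  fix x y assume xy: "x \<in> V \<and> y \<in> V \<and> x \<noteq> y"
  then obtain p where p: "p \<in> P" "p (x - y) > 0"
    using assms[of "x - y"] subspace_diff[OF subspace] by auto
  define e where "e = p (x - y) / 2"
  have e: "e > 0"
    using p by (simp add: e_def)
  have "p (x - y) < p (x - y)" if "z \<in> V" "p (z - x) < e" "p (z - y) < e" for z
    using seminorm_triangle[OF p(1), of x z y] seminorm_minus[OF p(1), of "z - x"]
      subspace_diff[OF subspace] xy that by (auto simp: e_def)
  then have "disjnt {z \<in> V. p (z - x) < e} {z \<in> V. p (z - y) < e}"
    by (auto simp: disjnt_def)
  moreover have "x \<in> {z \<in> V. p (z - x) < e}" "y \<in> {z \<in> V. p (z - y) < e}"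
    using xy p seminorm_zero[OF p(1)] by (auto simp: e_def)
  moreover have "openin Top {z \<in> V. p (z - x) < e}" "openin Top {z \<in> V. p (z - y) < e}"
    using openin_ball[OF p(1) _ e] xy by blast+
  ultimately show "\<exists>U W. openin Top U \<and> openin Top W \<and> x \<in> U \<and> y \<in> W \<and> disjnt U W"
    by blast
qed

end


section \<open>Strong duals\<close>

text \<open>Boundedness of points puts the evaluations at points among the seminorms of the strong
  dual, and this makes the strong dual Hausdorff and its limits unique.\<close>

definition tvs :: "'a::real_vector topology \<Rightarrow> bool" where
  "tvs X \<longleftrightarrow> subspace (topspace X) \<and> (\<forall>x\<in>topspace X. tvs_bounded X {x})"

lemma tvsD: "tvs X \<Longrightarrow> subspace (topspace X)" "tvs X \<Longrightarrow> x \<in> topspace X \<Longrightarrow> tvs_bounded X {x}"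
  by (auto simp: tvs_def)

text \<open>Continuity of \<open>c \<mapsto> c *\<^sub>R x\<close> at 0 puts
  \<open>(1 / t) *\<^sub>R x\<close> into a given neighbourhood of 0 for all large \<open>t\<close>,
  which is what it means that the neighbourhood absorbs \<open>x\<close>.\<close>

lemma tvsI:
  assumes "subspace (topspace X)"
    and "\<And>x. x \<in> topspace X \<Longrightarrow> continuous_map euclideanreal X (\<lambda>c. c *\<^sub>R x)"
  shows "tvs X"
  unfolding tvs_def tvs_bounded_def
proof (intro conjI ballI allI impI)
  fix x U assume x: "x \<in> topspace X" and U: "openin X U \<and> 0 \<in> U"
  have "open {c. c *\<^sub>R x \<in> U}"
    using openin_continuous_map_preimage[OF assms(2)[OF x], of U] U by simp
  moreover have "0 \<in> {c. c *\<^sub>R x \<in> U}"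
    using U by simp
  ultimately obtain e where e: "e > 0" "ball 0 e \<subseteq> {c. c *\<^sub>R x \<in> U}"
    by (meson openE)
  have "x \<in> (\<lambda>x. t *\<^sub>R x) ` U" if t: "t \<ge> 2 / e" for t
  proof (rule image_eqI)
    have "2 / e > 0"
      using e by simp
    then have tp: "t > 0"
      using t by linarith
    have "1 / t \<le> e / 2"
      using t tp e by (simp add: field_simps)
    then have "1 / t \<in> ball 0 e"
      using tp e by simp
    then show "(1 / t) *\<^sub>R x \<in> U"
      using e(2) by blast
    show "x = t *\<^sub>R (1 / t) *\<^sub>R x"
      using tp by simp
  qed
  then show "\<exists>s>0. \<forall>t\<ge>s. {x} \<subseteq> (\<lambda>x. t *\<^sub>R x) ` U"
    using e by (intro exI[of _ "2 / e"]) auto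
qed (use assms in auto)

lemma (in seminormed_space) tvs_Top: "tvs Top"
  by (rule tvsI) (simp_all add: topspace_Top subspace continuous_map_scale)

lemma tvs_bounded_absorbed:
  assumes "tvs_bounded X B" "openin X U" "0 \<in> U"
  obtains s where "s > 0" "\<And>t. t \<ge> s \<Longrightarrow> B \<subseteq> (\<lambda>x. t *\<^sub>R x) ` U"
  using assms unfolding tvs_bounded_def by metis

lemma tvs_bounded_Un:
  assumes "tvs_bounded X A" "tvs_bounded X B"
  shows "tvs_bounded X (A \<union> B)"
  unfolding tvs_bounded_def
proof (intro conjI allI impI)
  fix U assume U: "openin X U \<and> 0 \<in> U"
  obtain s where s: "s > 0" "\<forall>t\<ge>s. A \<subseteq> (\<lambda>x. t *\<^sub>R x) ` U"
    using assms(1) U by (auto simp: tvs_bounded_def)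
  obtain r where r: "r > 0" "\<forall>t\<ge>r. B \<subseteq> (\<lambda>x. t *\<^sub>R x) ` U"
    using assms(2) U by (auto simp: tvs_bounded_def)
  show "\<exists>s>0. \<forall>t\<ge>s. A \<union> B \<subseteq> (\<lambda>x. t *\<^sub>R x) ` U"
    using s r by (intro exI[of _ "max s r"]) auto
qed (use assms in \<open>auto simp: tvs_bounded_def\<close>)

lemma dual_add: "\<gamma> \<in> dual_space X \<Longrightarrow> x \<in> topspace X \<Longrightarrow> y \<in> topspace X \<Longrightarrow> \<gamma> (x + y) = \<gamma> x + \<gamma> y"
  and dual_scale: "\<gamma> \<in> dual_space X \<Longrightarrow> x \<in> topspace X \<Longrightarrow> \<gamma> (c *\<^sub>R x) = c * \<gamma> x"
  and dual_continuous: "\<gamma> \<in> dual_space X \<Longrightarrow> continuous_map X euclideanreal \<gamma>"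
  and dual_outside: "\<gamma> \<in> dual_space X \<Longrightarrow> x \<notin> topspace X \<Longrightarrow> \<gamma> x = 0"
  by (auto simp: dual_space_def)

lemma dual_diff:
  assumes "tvs X" "\<gamma> \<in> dual_space X" "x \<in> topspace X" "y \<in> topspace X"
  shows "\<gamma> (x - y) = \<gamma> x - \<gamma> y"
  using dual_add[OF assms(2), of "x - y" y] assms(3,4) subspace_diff[OF tvsD(1)[OF assms(1)]]
  by simp

lemma dual_zero: "tvs X \<Longrightarrow> \<gamma> \<in> dual_space X \<Longrightarrow> \<gamma> 0 = 0"
  using dual_scale[of \<gamma> X 0 0] subspace_0[OF tvsD(1)[of X]] by simp

lemma dual_sum:
  assumes "tvs X" "\<gamma> \<in> dual_space X" "\<And>i. i \<in> I \<Longrightarrow> f i \<in> topspace X"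
  shows "\<gamma> (\<Sum>i\<in>I. f i) = (\<Sum>i\<in>I. \<gamma> (f i))"
  using assms(3)
proof (induction I rule: infinite_finite_induct)
  case (insert i I)
  then show ?case
    using dual_add[OF assms(2)] subspace_sum[OF tvsD(1)[OF assms(1)], of I f] by simp
qed (use dual_zero[OF assms(1,2)] in auto)

lemma subspace_dual: "subspace (dual_space X)"
proof (rule subspaceI)
  show "0 \<in> dual_space X"
    by (auto simp: dual_space_def zero_fun_def)
  fix \<gamma> \<delta> assume "\<gamma> \<in> dual_space X" "\<delta> \<in> dual_space X"
  then show "\<gamma> + \<delta> \<in> dual_space X"
    by (auto simp: dual_space_def plus_fun_def algebra_simps intro: continuous_map_add)
next
  fix c :: real and \<gamma> assume "\<gamma> \<in> dual_space X"
  then show "c *\<^sub>R \<gamma> \<in> dual_space X"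
    by (auto simp: dual_space_def scaleR_fun_def algebra_simps intro: continuous_map_real_mult_left)
qed

lemmas dual_space_add = subspace_add[OF subspace_dual]
  and dual_space_diff = subspace_diff[OF subspace_dual]
  and dual_space_scale = subspace_scale[OF subspace_dual]

lemma dual_bounded:
  assumes "tvs X" "\<gamma> \<in> dual_space X" "tvs_bounded X B"
  shows "bdd_above ((\<lambda>f. \<bar>\<gamma> f\<bar>) ` B)"
proof -
  define U where "U = {x \<in> topspace X. \<gamma> x \<in> {-1<..<1}}"
  have "openin X U"
    unfolding U_def by (rule openin_continuous_map_preimage[OF dual_continuous[OF assms(2)]]) simp
  moreover have "0 \<in> U"
    using dual_zero[OF assms(1,2)] subspace_0[OF tvsD(1)[OF assms(1)]] by (simp add: U_def)
  ultimately obtain s where s: "s > 0" "B \<subseteq> (\<lambda>x. s *\<^sub>R x) ` U"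
    using tvs_bounded_absorbed[OF assms(3)] by (metis order_refl)
  have "\<bar>\<gamma> f\<bar> \<le> s" if f: "f \<in> B" for f
  proof -
    obtain x where x: "x \<in> U" "f = s *\<^sub>R x"
      using f s by blast
    then show ?thesis
      using dual_scale[OF assms(2), of x s] s(1) by (auto simp: U_def abs_mult)
  qed
  then show ?thesis
    by (rule bdd_aboveI2)
qed

text \<open>For nonempty bounded \<open>B\<close> this is the Minkowski gauge of the polar of
  \<open>B\<close> in the dual.\<close>

definition polar_norm :: "'a set \<Rightarrow> ('a \<Rightarrow> real) \<Rightarrow> real" where
  "polar_norm B \<gamma> = (SUP f\<in>B. \<bar>\<gamma> f\<bar>)"

lemma polar_norm_upper:
  "tvs X \<Longrightarrow> \<gamma> \<in> dual_space X \<Longrightarrow> tvs_bounded X B \<Longrightarrow> f \<in> B \<Longrightarrow> \<bar>\<gamma> f\<bar> \<le> polar_norm B \<gamma>"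
  unfolding polar_norm_def by (intro cSUP_upper dual_bounded)

lemma polar_norm_least: "B \<noteq> {} \<Longrightarrow> (\<And>f. f \<in> B \<Longrightarrow> \<bar>\<gamma> f\<bar> \<le> C) \<Longrightarrow> polar_norm B \<gamma> \<le> C"
  unfolding polar_norm_def by (intro cSUP_least) auto

lemma strong_dual_eq:
  "strong_dual X = seminorm_topology (dual_space X) {polar_norm B | B. B \<noteq> {} \<and> tvs_bounded X B}"
  unfolding strong_dual_def polar_norm_def[abs_def] ..

text \<open>In the homogeneity only \<open>\<le>\<close> is a direct estimate. Applied to the scalar
  \<open>1 / c\<close> and the functional \<open>c *\<^sub>R \<gamma>\<close>, it yields the reverse
  inequality.\<close>

lemma seminorm_on_polar_norm:
  assumes "B \<noteq> {}" "tvs_bounded X B" "tvs X"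
  shows "seminorm_on (dual_space X) (polar_norm B)"
  unfolding seminorm_on_def
proof (intro conjI ballI allI)
  fix \<gamma> \<delta> assume *: "\<gamma> \<in> dual_space X" "\<delta> \<in> dual_space X"
  show "polar_norm B (\<gamma> + \<delta>) \<le> polar_norm B \<gamma> + polar_norm B \<delta>"
  proof (rule polar_norm_least[OF assms(1)])
    fix f assume "f \<in> B"
    then show "\<bar>(\<gamma> + \<delta>) f\<bar> \<le> polar_norm B \<gamma> + polar_norm B \<delta>"
      using polar_norm_upper[OF assms(3) *(1) assms(2)] polar_norm_upper[OF assms(3) *(2) assms(2)]
      by (fastforce intro: order_trans[OF abs_triangle_ineq] add_mono)
  qed
next
  fix c and \<gamma> assume *: "\<gamma> \<in> dual_space X"
  have le: "polar_norm B (c *\<^sub>R \<gamma>) \<le> \<bar>c\<bar> * polar_norm B \<gamma>" if "\<gamma> \<in> dual_space X" for c \<gamma>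
    using polar_norm_upper[OF assms(3) that assms(2)]
    by (intro polar_norm_least[OF assms(1)]) (auto simp: abs_mult intro: mult_left_mono)
  show "polar_norm B (c *\<^sub>R \<gamma>) = \<bar>c\<bar> * polar_norm B \<gamma>"
  proof (cases "c = 0")
    case True
    then show ?thesis
      using assms(1) by (simp add: polar_norm_def)
  next
    case False
    have "polar_norm B ((1 / c) *\<^sub>R c *\<^sub>R \<gamma>) \<le> \<bar>1 / c\<bar> * polar_norm B (c *\<^sub>R \<gamma>)"
      by (intro le subspace_scale[OF subspace_dual] *)
    then have "\<bar>c\<bar> * polar_norm B \<gamma> \<le> polar_norm B (c *\<^sub>R \<gamma>)"
      using False by (simp add: field_simps)
    then show ?thesis
      using le[OF *, of c] by simp
  qed
qed

text \<open>The family is directed because the union of two bounded sets is bounded.\<close>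

lemma seminormed_space_dual:
  assumes "tvs X"
  shows "seminormed_space (dual_space X) {polar_norm B | B. B \<noteq> {} \<and> tvs_bounded X B}"
proof
  show "subspace (dual_space X)"
    by (rule subspace_dual)
  have "tvs_bounded X {0}"
    using assms subspace_0[OF tvsD(1)] by (intro tvsD(2)) auto
  then show "{polar_norm B | B. B \<noteq> {} \<and> tvs_bounded X B} \<noteq> {}"
    by blast
  fix p assume "p \<in> {polar_norm B | B. B \<noteq> {} \<and> tvs_bounded X B}"
  then obtain A where p: "p = polar_norm A" "A \<noteq> {}" "tvs_bounded X A"
    by blast
  then show "seminorm_on (dual_space X) p"
    using assms by (simp add: seminorm_on_polar_norm)
  fix q assume "q \<in> {polar_norm B | B. B \<noteq> {} \<and> tvs_bounded X B}"
  then obtain B where q: "q = polar_norm B" "B \<noteq> {}" "tvs_bounded X B"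
    by blast
  have "p \<gamma> \<le> polar_norm (A \<union> B) \<gamma> \<and> q \<gamma> \<le> polar_norm (A \<union> B) \<gamma>" if "\<gamma> \<in> dual_space X" for \<gamma>
    using polar_norm_upper[OF assms that tvs_bounded_Un[OF p(3) q(3)]] p q
    by (auto intro!: polar_norm_least)
  then show "\<exists>r\<in>{polar_norm B | B. B \<noteq> {} \<and> tvs_bounded X B}. \<forall>x\<in>dual_space X. p x \<le> r x \<and> q x \<le> r x"
    using tvs_bounded_Un[OF p(3) q(3)] p(2) by (intro bexI[of _ "polar_norm (A \<union> B)"]) blast+
qed

lemma Hausdorff_strong_dual:
  assumes "tvs X"
  shows "Hausdorff_space (strong_dual X)"
  unfolding strong_dual_eq
proof (rule seminormed_space.Hausdorff_Top[OF seminormed_space_dual[OF assms]])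
  fix \<gamma> :: "'a \<Rightarrow> real" assume \<gamma>: "\<gamma> \<in> dual_space X" "\<gamma> \<noteq> 0"
  then obtain x where x: "\<gamma> x \<noteq> 0"
    by (auto simp: fun_eq_iff)
  then have "x \<in> topspace X"
    using \<gamma>(1) dual_outside by blast
  moreover have "polar_norm {x} \<gamma> > 0"
    using x by (simp add: polar_norm_def)
  ultimately show "\<exists>p\<in>{polar_norm B | B. B \<noteq> {} \<and> tvs_bounded X B}. p \<gamma> > 0"
    using assms tvsD(2) by blast
qed

lemma topspace_strong_dual_tvs: "tvs X \<Longrightarrow> topspace (strong_dual X) = dual_space X"
  by (rule topspace_strong_dual[OF subspace_0[OF tvsD(1)]])

section \<open>Transposes of continuous linear maps between strong duals\<close>

definition transpose_map ::
    "'a::real_vector topology \<Rightarrow> ('a \<Rightarrow> 'b) \<Rightarrow> ('b \<Rightarrow> real) \<Rightarrow> ('a \<Rightarrow> real)" where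
  "transpose_map X A \<gamma> = (\<lambda>x. if x \<in> topspace X then \<gamma> (A x) else 0)"

lemma transpose_map_add: "transpose_map X A (\<gamma> + \<delta>) = transpose_map X A \<gamma> + transpose_map X A \<delta>"
  and transpose_map_scale: "transpose_map X A (c *\<^sub>R \<gamma>) = c *\<^sub>R transpose_map X A \<gamma>"
  by (auto simp: transpose_map_def fun_eq_iff)

context
  fixes X :: "'a::real_vector topology" and Y :: "'b::real_vector topology" and A :: "'a \<Rightarrow> 'b"
  assumes X: "tvs X" and Y: "tvs Y"
    and cont: "continuous_map X Y A"
    and add: "\<And>x y. x \<in> topspace X \<Longrightarrow> y \<in> topspace X \<Longrightarrow> A (x + y) = A x + A y"
    and scale: "\<And>c x. x \<in> topspace X \<Longrightarrow> A (c *\<^sub>R x) = c *\<^sub>R A x"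
begin

lemma image_in_topspace: "x \<in> topspace X \<Longrightarrow> A x \<in> topspace Y"
  using cont by (auto simp: continuous_map_def)

lemma transpose_map_dual:
  assumes "\<gamma> \<in> dual_space Y"
  shows "transpose_map X A \<gamma> \<in> dual_space X"
proof -
  have "continuous_map X euclideanreal (\<gamma> \<circ> A)"
    using cont dual_continuous[OF assms] by (rule continuous_map_compose)
  then have "continuous_map X euclideanreal (transpose_map X A \<gamma>)"
    by (rule continuous_map_eq) (simp add: transpose_map_def)
  then show ?thesis
    unfolding dual_space_def
    using subspace_add[OF tvsD(1)[OF X]] subspace_scale[OF tvsD(1)[OF X]] image_in_topspace
      dual_add[OF assms] dual_scale[OF assms]
    by (auto simp: transpose_map_def add scale)
qed

lemma tvs_bounded_image:
  assumes "tvs_bounded X B"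
  shows "tvs_bounded Y (A ` B)"
  unfolding tvs_bounded_def
proof (intro conjI allI impI)
  have B: "B \<subseteq> topspace X"
    using assms by (auto simp: tvs_bounded_def)
  then show "A ` B \<subseteq> topspace Y"
    using image_in_topspace by auto
  fix U assume U: "openin Y U \<and> 0 \<in> U"
  have "openin X {x \<in> topspace X. A x \<in> U}"
    using openin_continuous_map_preimage[OF cont] U by blast
  moreover have "0 \<in> {x \<in> topspace X. A x \<in> U}"
    using U scale[of 0 0] subspace_0[OF tvsD(1)[OF X]] by simp
  ultimately obtain s where s: "s > 0"
      "\<And>t. t \<ge> s \<Longrightarrow> B \<subseteq> (\<lambda>x. t *\<^sub>R x) ` {x \<in> topspace X. A x \<in> U}"
    using tvs_bounded_absorbed[OF assms] by metis
  have "A ` B \<subseteq> (\<lambda>x. t *\<^sub>R x) ` U" if t: "t \<ge> s" for t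
  proof (rule image_subsetI)
    fix b assume "b \<in> B"
    then obtain x where "x \<in> topspace X" "A x \<in> U" "b = t *\<^sub>R x"
      using s(2)[OF t] by blast
    then show "A b \<in> (\<lambda>x. t *\<^sub>R x) ` U"
      using scale by (intro image_eqI[of _ _ "A x"]) auto
  qed
  then show "\<exists>s>0. \<forall>t\<ge>s. A ` B \<subseteq> (\<lambda>x. t *\<^sub>R x) ` U"
    using s(1) by blast
qed

text \<open>The seminorm of \<open>B\<close> at a transposed functional is the seminorm of the image
  of \<open>B\<close> under \<open>A\<close> at the functional itself, and this image is again
  bounded.\<close>

lemma continuous_transpose_map:
  "continuous_map (strong_dual Y) (strong_dual X) (transpose_map X A)"
proof -
  interpret DX: seminormed_space "dual_space X" "{polar_norm B | B. B \<noteq> {} \<and> tvs_bounded X B}"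
    by (rule seminormed_space_dual[OF X])
  interpret DY: seminormed_space "dual_space Y" "{polar_norm B | B. B \<noteq> {} \<and> tvs_bounded Y B}"
    by (rule seminormed_space_dual[OF Y])
  show ?thesis
    unfolding strong_dual_eq
  proof (rule DX.continuous_map_TopI)
    fix \<gamma> assume "\<gamma> \<in> topspace DY.Top"
    then show "transpose_map X A \<gamma> \<in> dual_space X"
      using transpose_map_dual DY.topspace_Top by simp
  next
    fix p \<gamma> and e :: real
    assume p: "p \<in> {polar_norm B | B. B \<noteq> {} \<and> tvs_bounded X B}"
      and "\<gamma> \<in> topspace DY.Top" and e: "0 < e"
    then have \<gamma>: "\<gamma> \<in> dual_space Y"
      using DY.topspace_Top by simp
    obtain B where B: "p = polar_norm B" "B \<noteq> {}" "tvs_bounded X B"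
      using p by blast
    then have BX: "B \<subseteq> topspace X"
      by (auto simp: tvs_bounded_def)
    have AB: "polar_norm (A ` B) \<in> {polar_norm B | B. B \<noteq> {} \<and> tvs_bounded Y B}"
      using tvs_bounded_image B by blast
    have "polar_norm B (transpose_map X A \<delta> - transpose_map X A \<gamma>) = polar_norm (A ` B) (\<delta> - \<gamma>)" for \<delta>
      unfolding polar_norm_def image_image
      using BX by (intro SUP_cong) (auto simp: transpose_map_def)
    then show "\<exists>U. openin DY.Top U \<and> \<gamma> \<in> U \<and>
        (\<forall>\<delta>\<in>U. p (transpose_map X A \<delta> - transpose_map X A \<gamma>) < e)"
      using DY.openin_ball[OF AB \<gamma> e] \<gamma> e B(1) DY.seminorm_zero[OF AB]
      by (intro exI[of _ "{\<delta> \<in> dual_space Y. polar_norm (A ` B) (\<delta> - \<gamma>) < e}"]) auto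
  qed
qed

end

lemma sum_fun_apply: "(\<Sum>i\<in>I. f i) x = (\<Sum>i\<in>I. f i x)"
  by (induction I rule: infinite_finite_induct) auto


section \<open>Gateaux derivatives of smooth functionals\<close>

lemma dir_deriv_eqI:
  fixes F :: "'a::real_vector \<Rightarrow> 'b::real_vector"
  assumes "Hausdorff_space Y" "limitin Y (\<lambda>t::real. (F (x + t *\<^sub>R v) - F x) /\<^sub>R t) L (at 0)"
  shows "dir_deriv Y F x v = L"
  unfolding dir_deriv_def
proof (rule the_equality)
  fix L' assume "limitin Y (\<lambda>t::real. (F (x + t *\<^sub>R v) - F x) /\<^sub>R t) L' (at 0)"
  then show "L' = L"
    using limitin_Hausdorff_unique[OF _ assms(2) _ assms(1)] by simp
qed (fact assms(2))

lemma limitin_affine: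
  fixes F :: "'a::real_vector \<Rightarrow> 'b::real_vector"
  assumes "L \<in> topspace Y" "\<And>t. F (x + t *\<^sub>R v) = F x + t *\<^sub>R L"
  shows "limitin Y (\<lambda>t::real. (F (x + t *\<^sub>R v) - F x) /\<^sub>R t) L (at 0)"
proof -
  have "(F (x + t *\<^sub>R v) - F x) /\<^sub>R t = L" if "t \<noteq> 0" for t
    using that by (simp add: assms(2))
  then have "\<forall>\<^sub>F t in at 0. (F (x + t *\<^sub>R v) - F x) /\<^sub>R t = L"
    by (auto simp: eventually_at_filter)
  then show ?thesis
    using assms(1) by (auto simp: limitin_def elim: eventually_mono)
qed

context
  fixes X :: "'a::real_vector topology" and F :: "('a \<Rightarrow> real) \<Rightarrow> real"
  assumes X: "tvs X" and F: "gateaux_smooth (strong_dual X) euclideanreal F"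
begin

interpretation DX: seminormed_space "dual_space X" "{polar_norm B | B. B \<noteq> {} \<and> tvs_bounded X B}"
  by (rule seminormed_space_dual[OF X])

private abbreviation "DF \<equiv> dir_deriv euclideanreal F"

lemma dir_deriv_tendsto:
  assumes "\<Gamma> \<in> dual_space X" "\<Delta> \<in> dual_space X"
  shows "((\<lambda>t. (F (\<Gamma> + t *\<^sub>R \<Delta>) - F \<Gamma>) / t) \<longlongrightarrow> DF \<Gamma> \<Delta>) (at 0)"
proof -
  define w where "w = (\<lambda>i::nat. if i = 0 then \<Gamma> else \<Delta>)"
  have "\<forall>i\<le>Suc 0. w i \<in> topspace (strong_dual X)"
    using assms by (simp add: w_def topspace_strong_dual_tvs[OF X])
  then have "has_dir_deriv euclideanreal (\<lambda>x. iter_deriv euclideanreal F 0 (w(0 := x))) (w 0) (w (Suc 0))"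
    using F unfolding gateaux_smooth_def by blast
  then obtain L where L: "limitin euclideanreal (\<lambda>t. (F (\<Gamma> + t *\<^sub>R \<Delta>) - F \<Gamma>) /\<^sub>R t) L (at 0)"
    by (auto simp: has_dir_deriv_def w_def)
  then have "DF \<Gamma> \<Delta> = L"
    by (intro dir_deriv_eqI) auto
  with L show ?thesis
    by (simp add: divide_real_def mult.commute)
qed

lemma dir_deriv_unique:
  assumes "\<Gamma> \<in> dual_space X" "\<Delta> \<in> dual_space X"
    and "((\<lambda>t. (F (\<Gamma> + t *\<^sub>R \<Delta>) - F \<Gamma>) / t) \<longlongrightarrow> L) (at 0)"
  shows "DF \<Gamma> \<Delta> = L"
  using tendsto_unique[OF _ dir_deriv_tendsto[OF assms(1,2)] assms(3)] by simp

text \<open>The case \<open>m = 1\<close> of smoothness, freed from its encoding: the derivative is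
  jointly continuous in base point and direction. Points of the product over
  \<open>{..Suc 0}\<close> are extensional functions, whence the restricted abstraction in the
  proof.\<close>

lemma continuous_map_dir_deriv:
  assumes "continuous_map T (strong_dual X) f" "continuous_map T (strong_dual X) g"
  shows "continuous_map T euclideanreal (\<lambda>x. DF (f x) (g x))"
proof -
  have "continuous_map (product_topology (\<lambda>_. strong_dual X) {..Suc 0}) euclideanreal
          (iter_deriv euclideanreal F (Suc 0))"
    using F unfolding gateaux_smooth_def by blast
  moreover have "continuous_map T (product_topology (\<lambda>_. strong_dual X) {..Suc 0})
          (\<lambda>x. \<lambda>i\<in>{..Suc 0}. if i = 0 then f x else g x)"
    unfolding continuous_map_componentwise using assms by auto
  ultimately have "continuous_map T euclideanreal
      (iter_deriv euclideanreal F (Suc 0) \<circ> (\<lambda>x. \<lambda>i\<in>{..Suc 0}. if i = 0 then f x else g x))"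
    using continuous_map_compose by blast
  then show ?thesis
    by (rule continuous_map_eq) simp
qed

lemma dir_deriv_scale:
  assumes "\<Gamma> \<in> dual_space X" "\<Delta> \<in> dual_space X"
  shows "DF \<Gamma> (c *\<^sub>R \<Delta>) = c * DF \<Gamma> \<Delta>"
proof (rule dir_deriv_unique)
  show "((\<lambda>t. (F (\<Gamma> + t *\<^sub>R c *\<^sub>R \<Delta>) - F \<Gamma>) / t) \<longlongrightarrow> c * DF \<Gamma> \<Delta>) (at 0)"
  proof (cases "c = 0")
    case False
    \<comment> \<open>The increment is rescaled to \<open>t * c\<close>, which tends to 0 while
      avoiding it since \<open>c\<close> is nonzero.\<close>
    have "filterlim (\<lambda>t. t * c) (at 0) (at 0)"
      using False by (auto simp: filterlim_at eventually_at_filter intro!: tendsto_eq_intros)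
    from filterlim_compose[OF dir_deriv_tendsto[OF assms] this]
    have "((\<lambda>t. c * ((F (\<Gamma> + (t * c) *\<^sub>R \<Delta>) - F \<Gamma>) / (t * c))) \<longlongrightarrow> c * DF \<Gamma> \<Delta>) (at 0)"
      by (intro tendsto_mult tendsto_const)
    then show ?thesis
      using False by (simp add: divide_simps mult.commute)
  qed simp
qed (use assms dual_space_scale in auto)

lemma continuous_map_affine:
  assumes "\<Gamma> \<in> dual_space X" "\<Delta> \<in> dual_space X" "E \<in> dual_space X"
  shows "continuous_map euclidean (strong_dual X) (\<lambda>(s::real, r::real). \<Gamma> + s *\<^sub>R \<Delta> + r *\<^sub>R E)"
  unfolding strong_dual_eq
proof (rule DX.continuous_map_TopI)
  fix z :: "real \<times> real"
  show "(case z of (s, r) \<Rightarrow> \<Gamma> + s *\<^sub>R \<Delta> + r *\<^sub>R E) \<in> dual_space X"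
    using assms by (auto intro!: dual_space_add dual_space_scale split: prod.split)
next
  fix p :: "('a \<Rightarrow> real) \<Rightarrow> real" and z :: "real \<times> real" and e :: real
  assume p: "p \<in> {polar_norm B | B. B \<noteq> {} \<and> tvs_bounded X B}" and e: "0 < e"
  define U where "U = {y. \<bar>fst y - fst z\<bar> * p \<Delta> + \<bar>snd y - snd z\<bar> * p E < e}"
  have "open U"
    unfolding U_def by (intro open_Collect_less continuous_intros)
  moreover have "z \<in> U"
    using e by (simp add: U_def)
  moreover have "p ((case y of (s, r) \<Rightarrow> \<Gamma> + s *\<^sub>R \<Delta> + r *\<^sub>R E) -
      (case z of (s, r) \<Rightarrow> \<Gamma> + s *\<^sub>R \<Delta> + r *\<^sub>R E)) < e" if "y \<in> U" for y
  proof -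
    have "(case y of (s, r) \<Rightarrow> \<Gamma> + s *\<^sub>R \<Delta> + r *\<^sub>R E) - (case z of (s, r) \<Rightarrow> \<Gamma> + s *\<^sub>R \<Delta> + r *\<^sub>R E)
        = (fst y - fst z) *\<^sub>R \<Delta> + (snd y - snd z) *\<^sub>R E"
      by (simp add: case_prod_beta scaleR_diff_left)
    moreover have "p ((fst y - fst z) *\<^sub>R \<Delta> + (snd y - snd z) *\<^sub>R E)
        \<le> \<bar>fst y - fst z\<bar> * p \<Delta> + \<bar>snd y - snd z\<bar> * p E"
      using DX.seminorm_add[OF p dual_space_scale[OF assms(2)] dual_space_scale[OF assms(3)]]
        DX.seminorm_scale[OF p] assms by simp
    ultimately show ?thesis
      using that by (simp add: U_def)
  qed
  ultimately show "\<exists>U. openin euclidean U \<and> z \<in> U \<and> (\<forall>y\<in>U.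
      p ((case y of (s, r) \<Rightarrow> \<Gamma> + s *\<^sub>R \<Delta> + r *\<^sub>R E) - (case z of (s, r) \<Rightarrow> \<Gamma> + s *\<^sub>R \<Delta> + r *\<^sub>R E)) < e)"
    by auto
qed

lemma DERIV_dir_deriv:
  assumes "\<Gamma> \<in> dual_space X" "\<Delta> \<in> dual_space X"
  shows "((\<lambda>s. F (\<Gamma> + s *\<^sub>R \<Delta>)) has_real_derivative DF (\<Gamma> + s *\<^sub>R \<Delta>) \<Delta>) (at s)"
proof -
  have "\<Gamma> + s *\<^sub>R \<Delta> \<in> dual_space X"
    using assms by (intro dual_space_add dual_space_scale)
  from dir_deriv_tendsto[OF this assms(2)] show ?thesis
    by (simp add: DERIV_def scaleR_add_left add.assoc)
qed

text \<open>The increment along \<open>\<Delta> + E\<close> is split at the intermediate point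
  \<open>\<Gamma> + t *\<^sub>R \<Delta>\<close>. The first part gives the derivative along
  \<open>\<Delta>\<close>. By the mean value theorem the second part is \<open>t\<close> times a
  derivative along \<open>E\<close> at a nearby point of the plane through \<open>\<Gamma>\<close>
  spanned by the two directions, and continuity in the base point takes this to the derivative at
  \<open>\<Gamma>\<close>.\<close>

lemma dir_deriv_add:
  assumes \<Gamma>: "\<Gamma> \<in> dual_space X" and \<Delta>: "\<Delta> \<in> dual_space X" and E: "E \<in> dual_space X"
  shows "DF \<Gamma> (\<Delta> + E) = DF \<Gamma> \<Delta> + DF \<Gamma> E"
proof (rule dir_deriv_unique)
  define g where "g = (\<lambda>z::real \<times> real. DF (case z of (s, r) \<Rightarrow> \<Gamma> + s *\<^sub>R \<Delta> + r *\<^sub>R E) E)"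
  have "continuous_map euclidean euclideanreal g"
    unfolding g_def using E topspace_strong_dual_tvs[OF X]
    by (intro continuous_map_dir_deriv continuous_map_affine assms) simp
  then have g: "isCont g (0, 0)"
    by (simp add: continuous_on_eq_continuous_at)
  have "((\<lambda>t. (F (\<Gamma> + t *\<^sub>R \<Delta> + t *\<^sub>R E) - F (\<Gamma> + t *\<^sub>R \<Delta>)) / t) \<longlongrightarrow> DF \<Gamma> E) (at 0)"
  proof (rule tendstoI)
    fix e :: real assume "e > 0"
    then obtain d where d: "d > 0" "\<And>z. dist z (0, 0) < d \<Longrightarrow> dist (g z) (g (0, 0)) < e"
      using g unfolding continuous_at_eps_delta by blast
    have "dist ((F (\<Gamma> + t *\<^sub>R \<Delta> + t *\<^sub>R E) - F (\<Gamma> + t *\<^sub>R \<Delta>)) / t) (DF \<Gamma> E) < e"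
      if t: "t \<noteq> 0" "\<bar>t\<bar> < d / 2" for t
    proof -
      have "((\<lambda>\<theta>. F (\<Gamma> + t *\<^sub>R \<Delta> + (\<theta> * t) *\<^sub>R E)) has_real_derivative g (t, \<theta> * t) * t) (at \<theta>)" for \<theta>
      proof -
        have "((\<lambda>s. F (\<Gamma> + t *\<^sub>R \<Delta> + s *\<^sub>R E)) has_real_derivative g (t, \<theta> * t)) (at (\<theta> * t))"
          unfolding g_def prod.case
          using assms by (intro DERIV_dir_deriv dual_space_add dual_space_scale)
        then show ?thesis
          by (rule DERIV_chain2) (auto intro!: derivative_eq_intros)
      qed
      from MVT2[of 0 1, OF _ this] obtain \<theta> where \<theta>: "0 < \<theta>" "\<theta> < 1"
          "F (\<Gamma> + t *\<^sub>R \<Delta> + t *\<^sub>R E) - F (\<Gamma> + t *\<^sub>R \<Delta>) = g (t, \<theta> * t) * t"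
        by auto
      \<comment> \<open>The norm of the pair is estimated by the sum of its two entries, each at
        most \<open>\<bar>t\<bar>\<close>; this is why \<open>t\<close> is kept below
        \<open>d / 2\<close>.\<close>
      have "\<bar>\<theta> * t\<bar> \<le> \<bar>t\<bar>"
        using \<theta> by (simp add: abs_mult mult_left_le_one_le)
      then have "norm (t, \<theta> * t) < d"
        using t norm_Pair_le[of t "\<theta> * t"] by simp
      then have "dist (g (t, \<theta> * t)) (g (0, 0)) < e"
        using d(2) by (simp add: dist_norm)
      then show ?thesis
        using \<theta>(3) t by (simp add: g_def)
    qed
    then show "\<forall>\<^sub>F t in at 0. dist ((F (\<Gamma> + t *\<^sub>R \<Delta> + t *\<^sub>R E) - F (\<Gamma> + t *\<^sub>R \<Delta>)) / t) (DF \<Gamma> E) < e"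
      unfolding eventually_at using d(1) by (intro exI[of _ "d / 2"]) (simp add: dist_real_def)
  qed
  note tendsto_add[OF dir_deriv_tendsto[OF \<Gamma> \<Delta>] this]
  then
  show "((\<lambda>t. (F (\<Gamma> + t *\<^sub>R (\<Delta> + E)) - F \<Gamma>) / t) \<longlongrightarrow> DF \<Gamma> \<Delta> + DF \<Gamma> E) (at 0)"
    by (simp add: scaleR_add_right add.assoc add_divide_distrib[symmetric])
qed (use assms dual_space_add in auto)

text \<open>With the base point frozen, joint continuity leaves continuity in the direction for the
  strong topology. The value 0 off the dual is the convention of \<open>dual_space\<close>.\<close>

lemma dir_deriv_bidual:
  assumes \<Gamma>: "\<Gamma> \<in> dual_space X"
  obtains L where "L \<in> dual_space (strong_dual X)" "\<And>\<Delta>. \<Delta> \<in> dual_space X \<Longrightarrow> L \<Delta> = DF \<Gamma> \<Delta>"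
proof
  let ?L = "\<lambda>\<Delta>. if \<Delta> \<in> dual_space X then DF \<Gamma> \<Delta> else 0"
  have "continuous_map (strong_dual X) euclideanreal (DF \<Gamma>)"
    using continuous_map_dir_deriv[of "strong_dual X" "\<lambda>_. \<Gamma>" "\<lambda>\<Delta>. \<Delta>"] \<Gamma>
    by (simp add: topspace_strong_dual_tvs[OF X])
  then have "continuous_map (strong_dual X) euclideanreal ?L"
    by (rule continuous_map_eq) (simp add: topspace_strong_dual_tvs[OF X])
  then show "?L \<in> dual_space (strong_dual X)"
    using \<Gamma> by (auto simp: dual_space_def[of "strong_dual X"] topspace_strong_dual_tvs[OF X]
        dir_deriv_add dir_deriv_scale dual_space_add dual_space_scale)
qed simp

end

lemma tvs_strong_dual:
  assumes "tvs X"
  shows "tvs (strong_dual X)"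
  unfolding strong_dual_eq by (rule seminormed_space.tvs_Top[OF seminormed_space_dual[OF assms]])


section \<open>Finite approximation of bidual elements\<close>

text \<open>Continuity for the strong topology means domination by one of its seminorms. The bounded
  set obtained here is the one on which all later estimates for \<open>L\<close> take place.\<close>

lemma bidual_bound:
  assumes X: "tvs X" and L: "L \<in> dual_space (strong_dual X)"
  obtains B C where "B \<noteq> {}" "tvs_bounded X B" "C > 0"
    "\<And>\<gamma>. \<gamma> \<in> dual_space X \<Longrightarrow> \<bar>L \<gamma>\<bar> \<le> C * polar_norm B \<gamma>"
proof -
  interpret DX: seminormed_space "dual_space X" "{polar_norm B | B. B \<noteq> {} \<and> tvs_bounded X B}"
    by (rule seminormed_space_dual[OF X])
  have "\<exists>p\<in>{polar_norm B | B. B \<noteq> {} \<and> tvs_bounded X B}. \<exists>C>0. \<forall>\<gamma>\<in>dual_space X. \<bar>L \<gamma>\<bar> \<le> C * p \<gamma>"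
    using dual_continuous[OF L] dual_scale[OF L] topspace_strong_dual_tvs[OF X]
    by (intro DX.continuous_functional_bound) (auto simp: strong_dual_eq[symmetric])
  then show ?thesis
    using that by auto
qed

text \<open>
  A form of Goldstine's theorem. Over the bipolar \<open>H\<close> of \<open>B\<close>, scaled by \<open>C\<close>, the sum of squares of the
  errors has infimum \<open>0\<close>: otherwise, a near-minimiser can be improved by moving it towards a point of
  \<open>H\<close> at which the functional \<open>\<Sum>\<delta>\<in>D. c \<delta> * \<delta>\<close>, with \<open>c \<delta>\<close> the error at \<open>\<delta>\<close>, is almost maximal.
\<close>

lemma bidual_approx:
  assumes X: "tvs X" and L: "L \<in> dual_space (strong_dual X)"
    and B: "B \<noteq> {}" "tvs_bounded X B" and C: "C > 0"
    and bound: "\<And>\<gamma>. \<gamma> \<in> dual_space X \<Longrightarrow> \<bar>L \<gamma>\<bar> \<le> C * polar_norm B \<gamma>"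
    and D: "finite D" "D \<subseteq> dual_space X" and e: "e > 0"
  shows "\<exists>h\<in>topspace X. (\<forall>\<gamma>\<in>dual_space X. \<bar>\<gamma> h\<bar> \<le> C * polar_norm B \<gamma>) \<and> (\<forall>\<delta>\<in>D. \<bar>\<delta> h - L \<delta>\<bar> < e)"
proof -
  define H where "H = {h \<in> topspace X. \<forall>\<gamma>\<in>dual_space X. \<bar>\<gamma> h\<bar> \<le> C * polar_norm B \<gamma>}"
  define S where "S = (\<lambda>h. \<Sum>\<delta>\<in>D. (\<delta> h - L \<delta>)\<^sup>2)"
  define s where "s = (INF h\<in>H. S h)"
  note sub = tvsD(1)[OF X]
  have TD: "topspace (strong_dual X) = dual_space X"
    by (rule topspace_strong_dual_tvs[OF X])
  have polar_nonneg: "0 \<le> polar_norm B \<gamma>" if \<gamma>: "\<gamma> \<in> dual_space X" for \<gamma>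
  proof -
    obtain b where "b \<in> B" using B by blast
    then show ?thesis
      using polar_norm_upper[OF X \<gamma> B(2), of b] abs_ge_zero[of "\<gamma> b"] by linarith
  qed
  have "0 \<in> H"
    using subspace_0[OF sub] C polar_nonneg by (simp add: H_def dual_zero[OF X])
  then have Hne: "H \<noteq> {}"
    by blast
  have Spos: "0 \<le> S h" for h
    by (simp add: S_def sum_nonneg)
  then have bdd: "bdd_below (S ` H)"
    by (rule bdd_belowI2)
  have s_le: "s \<le> S h" if "h \<in> H" for h
    unfolding s_def using bdd that by (rule cINF_lower)
  have "s < e\<^sup>2"
  proof (rule ccontr)
    assume "\<not> s < e\<^sup>2"
    moreover have "e\<^sup>2 > 0"
      using e by simp
    ultimately have s: "s > 0"
      by linarith
    \<comment> \<open>\<open>M\<close> dominates the sum of the squares of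
      \<open>\<delta> h - \<delta> h0\<close> for any two points of \<open>H\<close>; the added 1
      keeps it positive when \<open>D\<close> contributes nothing.\<close>
    define M where "M = (\<Sum>\<delta>\<in>D. (2 * C * polar_norm B \<delta>)\<^sup>2) + 1"
    have M: "M > 0"
      unfolding M_def by (intro add_nonneg_pos sum_nonneg) auto
    \<comment> \<open>The step length. The first-order gain below is \<open>t * s\<close>, and this
      choice keeps the second-order loss \<open>t\<^sup>2 * M\<close> at no more than half of
      it.\<close>
    define t where "t = min 1 (s / (2 * M))"
    have t: "0 < t" "t \<le> 1" "t * M \<le> s / 2"
      using s M by (auto simp: t_def min_def field_simps)
    \<comment> \<open>The slack \<open>t * s / 2\<close> equals the net gain of the step, so a step
      from \<open>h0\<close> ends strictly below the infimum.\<close>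
    have "\<exists>h0\<in>H. S h0 < s + t * s / 2"
      using cINF_less_iff[OF Hne bdd, of "s + t * s / 2"] s t by (auto simp: s_def[symmetric])
    then obtain h0 where h0: "h0 \<in> H" "S h0 < s + t * s / 2"
      by blast
    then have h0X: "h0 \<in> topspace X"
      by (simp add: H_def)
    \<comment> \<open>Minus half the differential of \<open>S\<close> at \<open>h0\<close>: to first
      order \<open>S\<close> decreases towards points at which \<open>\<Delta>\<close> is larger
      than at \<open>h0\<close>.\<close>
    define \<Delta> where "\<Delta> = (\<Sum>\<delta>\<in>D. (L \<delta> - \<delta> h0) *\<^sub>R \<delta>)"
    have \<Delta>: "\<Delta> \<in> dual_space X"
      unfolding \<Delta>_def using D(2) by (intro subspace_sum subspace_dual subspace_scale) auto
    have \<Delta>_apply: "\<Delta> h = (\<Sum>\<delta>\<in>D. (L \<delta> - \<delta> h0) * \<delta> h)" for h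
      by (simp add: \<Delta>_def sum_fun_apply)
    have L_sum: "L (\<Sum>\<delta>\<in>D'. c \<delta> *\<^sub>R \<delta>) = (\<Sum>\<delta>\<in>D'. c \<delta> * L \<delta>)"
      if "finite D'" "D' \<subseteq> dual_space X" for c D'
      using that
    proof (induction D' rule: finite_induct)
      case empty
      have "L (0 *\<^sub>R 0) = 0 * L 0"
        by (rule dual_scale[OF L]) (simp add: TD subspace_0[OF subspace_dual])
      then show ?case
        by (simp only: scaleR_zero_left sum.empty mult_zero_left)
    next
      case (insert \<delta> D')
      then have \<delta>: "\<delta> \<in> dual_space X" and D': "D' \<subseteq> dual_space X"
        by auto
      have "(\<Sum>\<delta>\<in>D'. c \<delta> *\<^sub>R \<delta>) \<in> dual_space X"
        using D' by (intro subspace_sum subspace_dual dual_space_scale) auto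
      then have "L (c \<delta> *\<^sub>R \<delta> + (\<Sum>\<delta>\<in>D'. c \<delta> *\<^sub>R \<delta>)) = c \<delta> * L \<delta> + (\<Sum>\<delta>\<in>D'. c \<delta> * L \<delta>)"
        using dual_add[OF L] dual_scale[OF L] dual_space_scale[OF \<delta>] \<delta> insert.IH[OF D']
        by (simp only: TD)
      then show ?case
        unfolding sum.insert[OF insert.hyps] .
    qed
    have "L \<Delta> = (\<Sum>\<delta>\<in>D. (L \<delta> - \<delta> h0) * L \<delta>)"
      unfolding \<Delta>_def by (rule L_sum[OF D])
    \<comment> \<open>Termwise, \<open>L \<Delta> - \<Delta> h0\<close> is the sum of the squared
      errors.\<close>
    then have L\<Delta>: "L \<Delta> = \<Delta> h0 + S h0"
      unfolding \<Delta>_apply[of h0] S_def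
      by (simp add: sum.distrib[symmetric] power2_eq_square algebra_simps)
    \<comment> \<open>Otherwise \<open>C * polar_norm B \<Delta>\<close> would be at most
      \<open>L \<Delta> - s / 2\<close>, against the bound on \<open>L\<close>.\<close>
    have "\<exists>f\<in>B. L \<Delta> - s / 2 < C * \<bar>\<Delta> f\<bar>"
    proof (rule ccontr)
      assume "\<not> ?thesis"
      then have "polar_norm B \<Delta> \<le> (L \<Delta> - s / 2) / C"
        using C by (intro polar_norm_least[OF B(1)]) (force simp: field_simps)
      then have "C * polar_norm B \<Delta> \<le> L \<Delta> - s / 2"
        using C by (simp add: field_simps)
      then show False
        using bound[OF \<Delta>] s by linarith
    qed
    then obtain f where f: "f \<in> B" "L \<Delta> - s / 2 < C * \<bar>\<Delta> f\<bar>"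
      by blast
    have fX: "f \<in> topspace X"
      using f(1) B(2) by (auto simp: tvs_bounded_def)
    \<comment> \<open>The sign turns \<open>\<Delta> h\<close> into
      \<open>C * \<bar>\<Delta> f\<bar>\<close>, and multiples of points of \<open>B\<close> by
      factors up to \<open>C\<close> in modulus stay in \<open>H\<close>.\<close>
    define h where "h = (C * sgn (\<Delta> f)) *\<^sub>R f"
    have hX: "h \<in> topspace X"
      unfolding h_def using fX subspace_scale[OF sub] by blast
    have \<gamma>h: "\<gamma> h = C * sgn (\<Delta> f) * \<gamma> f" if "\<gamma> \<in> dual_space X" for \<gamma>
      unfolding h_def using dual_scale[OF that fX] .
    have "\<bar>\<gamma> h\<bar> \<le> C * polar_norm B \<gamma>" if \<gamma>: "\<gamma> \<in> dual_space X" for \<gamma>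
    proof -
      have "\<bar>\<gamma> h\<bar> \<le> C * \<bar>\<gamma> f\<bar>"
        using C \<gamma>h[OF \<gamma>] by (auto simp: abs_mult sgn_real_def)
      also have "\<dots> \<le> C * polar_norm B \<gamma>"
        using polar_norm_upper[OF X \<gamma> B(2) f(1)] C by simp
      finally show ?thesis .
    qed
    then have h: "h \<in> H"
      using hX by (simp add: H_def)
    \<comment> \<open>\<open>\<Delta> h\<close> exceeds \<open>L \<Delta> - s / 2\<close>, while
      \<open>L \<Delta> - \<Delta> h0\<close> is \<open>S h0\<close>, which is at least
      \<open>s\<close>.\<close>
    have \<Delta>h: "\<Delta> h - \<Delta> h0 \<ge> s / 2"
    proof -
      have "\<Delta> h = C * \<bar>\<Delta> f\<bar>"
        unfolding \<gamma>h[OF \<Delta>] by (simp add: sgn_real_def)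
      then show ?thesis
        using f(2) L\<Delta> s_le[OF h0(1)] by linarith
    qed
    define k where "k = h0 + t *\<^sub>R (h - h0)"
    have kX: "k \<in> topspace X"
      unfolding k_def using h0X hX by (intro subspace_add[OF sub] subspace_scale[OF sub] subspace_diff[OF sub])
    have \<gamma>k: "\<gamma> k = \<gamma> h0 + t * (\<gamma> h - \<gamma> h0)" if "\<gamma> \<in> dual_space X" for \<gamma>
      unfolding k_def
      using that h0X hX subspace_diff[OF sub] subspace_scale[OF sub]
      by (simp add: dual_add dual_scale dual_diff[OF X])
    have "\<bar>\<gamma> k\<bar> \<le> C * polar_norm B \<gamma>" if \<gamma>: "\<gamma> \<in> dual_space X" for \<gamma>
    proof -
      have "\<gamma> k = (1 - t) * \<gamma> h0 + t * \<gamma> h"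
        using \<gamma>k[OF \<gamma>] by (simp add: algebra_simps)
      also have "\<bar>\<dots>\<bar> \<le> (1 - t) * \<bar>\<gamma> h0\<bar> + t * \<bar>\<gamma> h\<bar>"
        using t by (intro order_trans[OF abs_triangle_ineq]) (simp add: abs_mult)
      also have "\<dots> \<le> (1 - t) * (C * polar_norm B \<gamma>) + t * (C * polar_norm B \<gamma>)"
        using h h0(1) \<gamma> t by (intro add_mono mult_left_mono) (auto simp: H_def)
      finally show ?thesis
        by (simp add: algebra_simps)
    qed
    then have k: "k \<in> H"
      using kX by (simp add: H_def)
    have "S k = (\<Sum>\<delta>\<in>D. (\<delta> h0 - L \<delta>)\<^sup>2 - 2 * t * ((L \<delta> - \<delta> h0) * (\<delta> h - \<delta> h0)) + t\<^sup>2 * (\<delta> h - \<delta> h0)\<^sup>2)"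
      unfolding S_def using D(2)
      by (intro sum.cong) (auto simp: \<gamma>k power2_eq_square algebra_simps)
    also have "\<dots> = S h0 - 2 * t * (\<Delta> h - \<Delta> h0) + t\<^sup>2 * (\<Sum>\<delta>\<in>D. (\<delta> h - \<delta> h0)\<^sup>2)"
      by (simp add: S_def \<Delta>_apply sum.distrib sum_subtractf sum_distrib_left right_diff_distrib)
    also have "\<dots> \<le> S h0 - 2 * t * (s / 2) + t\<^sup>2 * M"
    proof -
      have "(\<delta> h - \<delta> h0)\<^sup>2 \<le> (2 * C * polar_norm B \<delta>)\<^sup>2" if "\<delta> \<in> D" for \<delta>
      proof -
        have "\<bar>\<delta> h\<bar> \<le> C * polar_norm B \<delta>" "\<bar>\<delta> h0\<bar> \<le> C * polar_norm B \<delta>"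
          using that D(2) h h0(1) by (auto simp: H_def)
        then have "\<bar>\<delta> h - \<delta> h0\<bar> \<le> 2 * C * polar_norm B \<delta>"
          by linarith
        then show ?thesis
          by (metis abs_le_square_iff abs_ge_self order_trans)
      qed
      then have "(\<Sum>\<delta>\<in>D. (\<delta> h - \<delta> h0)\<^sup>2) \<le> (\<Sum>\<delta>\<in>D. (2 * C * polar_norm B \<delta>)\<^sup>2)"
        by (rule sum_mono)
      then have "(\<Sum>\<delta>\<in>D. (\<delta> h - \<delta> h0)\<^sup>2) \<le> M"
        unfolding M_def by linarith
      then show ?thesis
        using mult_left_mono[OF \<Delta>h, of "2 * t"] t(1) by (intro add_mono diff_mono mult_left_mono) auto
    qed
    also have "\<dots> \<le> S h0 - t * s / 2"
      using mult_left_mono[OF t(3), of t] t(1) by (simp add: power2_eq_square algebra_simps)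
    also have "\<dots> < s"
      using h0(2) by simp
    finally show False
      using s_le[OF k] by simp
  qed
  then obtain h where h: "h \<in> H" "S h < e\<^sup>2"
    using cINF_less_iff[OF Hne bdd, of "e\<^sup>2"] by (auto simp: s_def)
  have "\<bar>\<delta> h - L \<delta>\<bar> < e" if "\<delta> \<in> D" for \<delta>
  proof -
    have "(\<delta> h - L \<delta>)\<^sup>2 \<le> S h"
      unfolding S_def using D(1) that
      by (intro member_le_sum) auto
    then have "\<bar>\<delta> h - L \<delta>\<bar>\<^sup>2 < e\<^sup>2"
      using h(2) by simp
    then show ?thesis
      by (rule power2_less_imp_less) (use e in simp)
  qed
  then show ?thesis
    using h(1) by (auto simp: H_def)
qed

section \<open>Calculus of smooth observables\<close>

lemma iter_partial_Nil [simp]: "iter_partial [] f = f"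
  and iter_partial_Cons [simp]: "iter_partial ((i, b) # l) f = partial i b (iter_partial l f)"
  and iter_partial_append: "iter_partial (l @ l') f = iter_partial l (iter_partial l' f)"
  by (simp_all add: iter_partial_def)

lemma partial_zero: "partial i b 0 = 0"
  by (simp add: partial_def fun_eq_iff)

lemma finite_coord_dirs [simp]: "finite (coord_dirs k)"
  by (simp add: coord_dirs_def)

lemma smooth_obs_continuous: "smooth_obs k f \<Longrightarrow> continuous_on UNIV f"
  unfolding smooth_obs_def by (drule bspec[of _ _ "[]"]) auto

lemma smooth_obs_differentiable:
  "smooth_obs k f \<Longrightarrow> (i, b) \<in> coord_dirs k \<Longrightarrow>
    (\<lambda>t::real. f (z(i := z i + t *\<^sub>R b))) differentiable (at 0)"
  unfolding smooth_obs_def by (drule bspec[of _ _ "[]"]) auto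

lemma smooth_obs_iter_partial:
  assumes "smooth_obs k f" "l \<in> lists (coord_dirs k)"
  shows "smooth_obs k (iter_partial l f)"
  unfolding smooth_obs_def
proof (intro ballI conjI)
  fix l' :: "(nat \<times> 'a phase) list" assume l': "l' \<in> lists (coord_dirs k)"
  then have l: "l' @ l \<in> lists (coord_dirs k)"
    using assms(2) by auto
  then show "continuous_on UNIV (iter_partial l' (iter_partial l f))"
    using assms(1) unfolding smooth_obs_def iter_partial_append[symmetric] by blast
  fix x :: "nat \<times> 'a phase" assume "x \<in> coord_dirs k"
  then show "case x of (i, b) \<Rightarrow> \<forall>z. (\<lambda>t::real. iter_partial l' (iter_partial l f) (z(i := z i + t *\<^sub>R b))) differentiable (at 0)"
    using assms(1) l unfolding smooth_obs_def iter_partial_append[symmetric] by blast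
qed

lemma smooth_obs_partial:
  "smooth_obs k f \<Longrightarrow> (i, b) \<in> coord_dirs k \<Longrightarrow> smooth_obs k (partial i b f)"
  using smooth_obs_iter_partial[of k f "[(i, b)]"] by simp

text \<open>Smoothness follows from membership in any set of continuous, partially differentiable
  functions that is closed under partial derivatives. This replaces explicit formulas for iterated
  partial derivatives.\<close>

lemma smooth_obs_coinduct:
  assumes "f \<in> A"
    and "\<And>g. g \<in> A \<Longrightarrow> continuous_on UNIV g"
    and "\<And>g i b. g \<in> A \<Longrightarrow> (i, b) \<in> coord_dirs k \<Longrightarrow>
      (\<forall>z. (\<lambda>t::real. g (z(i := z i + t *\<^sub>R b))) differentiable (at 0)) \<and> partial i b g \<in> A"
  shows "smooth_obs k f"
proof -
  have "iter_partial l f \<in> A" if "l \<in> lists (coord_dirs k)" for l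
    using that
  proof (induction l)
    case (Cons x l)
    then show ?case
      using assms(3)[of "iter_partial l f" "fst x" "snd x"] by (cases x) auto
  qed (use assms(1) in simp)
  then show ?thesis
    unfolding smooth_obs_def using assms(2,3) by fast
qed

lemma partial_DERIV_0:
  assumes "(\<lambda>t::real. f (z(i := z i + t *\<^sub>R b))) differentiable (at 0)"
  shows "((\<lambda>t. f (z(i := z i + t *\<^sub>R b))) has_real_derivative partial i b f z) (at 0)"
  unfolding partial_def using assms by (simp add: DERIV_deriv_iff_real_differentiable)

text \<open>\<open>smooth_obs\<close> speaks of differentiability at parameter 0 only, but at every
  base point; moving the base point along the line reaches every other parameter.\<close>

lemma partial_DERIV:
  assumes "smooth_obs k f" "(i, b) \<in> coord_dirs k"
  shows "((\<lambda>t. f (z(i := z i + t *\<^sub>R b))) has_real_derivative partial i b f (z(i := z i + t *\<^sub>R b))) (at t)"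
proof -
  define w where "w = z(i := z i + t *\<^sub>R b)"
  have "((\<lambda>h. f (w(i := w i + h *\<^sub>R b))) has_real_derivative partial i b f w) (at 0)"
    by (rule partial_DERIV_0[OF smooth_obs_differentiable[OF assms]])
  moreover have "w(i := w i + h *\<^sub>R b) = z(i := z i + (t + h) *\<^sub>R b)" for h
    by (simp add: w_def scaleR_add_left add.assoc)
  ultimately show ?thesis
    by (simp add: DERIV_def w_def)
qed

text \<open>The invariant set for sums and products: by the Leibniz rule it is closed under partial
  derivatives, whereas the set of products of two smooth observables would not visibly be.\<close>

inductive_set obs_algebra :: "nat \<Rightarrow> ('d::finite) obs set" for k where
  base: "smooth_obs k f \<Longrightarrow> f \<in> obs_algebra k"
| const: "(\<lambda>_. c) \<in> obs_algebra k"
| add: "f \<in> obs_algebra k \<Longrightarrow> g \<in> obs_algebra k \<Longrightarrow> (\<lambda>z. f z + g z) \<in> obs_algebra k"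
| mult: "f \<in> obs_algebra k \<Longrightarrow> g \<in> obs_algebra k \<Longrightarrow> (\<lambda>z. f z * g z) \<in> obs_algebra k"

lemma partial_add:
  assumes "(\<lambda>t::real. f (z(i := z i + t *\<^sub>R b))) differentiable (at 0)"
    and "(\<lambda>t::real. g (z(i := z i + t *\<^sub>R b))) differentiable (at 0)"
  shows "partial i b (\<lambda>z. f z + g z) z = partial i b f z + partial i b g z"
  unfolding partial_def[of i b "\<lambda>z. f z + g z"]
  using DERIV_add[OF partial_DERIV_0[OF assms(1)] partial_DERIV_0[OF assms(2)]]
  by (rule DERIV_imp_deriv)

lemma partial_mult:
  assumes "(\<lambda>t::real. f (z(i := z i + t *\<^sub>R b))) differentiable (at 0)"
    and "(\<lambda>t::real. g (z(i := z i + t *\<^sub>R b))) differentiable (at 0)"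
  shows "partial i b (\<lambda>z. f z * g z) z = partial i b f z * g z + f z * partial i b g z"
proof -
  have "((\<lambda>t. f (z(i := z i + t *\<^sub>R b)) * g (z(i := z i + t *\<^sub>R b))) has_real_derivative
      partial i b f z * g z + f z * partial i b g z) (at 0)"
    by (rule DERIV_cong[OF DERIV_mult[OF partial_DERIV_0[OF assms(1)] partial_DERIV_0[OF assms(2)]]]) simp
  then show ?thesis
    unfolding partial_def[of i b "\<lambda>z. f z * g z"] by (rule DERIV_imp_deriv)
qed

lemma obs_algebra_smooth:
  assumes "f \<in> obs_algebra k"
  shows "smooth_obs k f"
proof (rule smooth_obs_coinduct[OF assms])
  fix g :: "'a obs" assume "g \<in> obs_algebra k"
  then show "continuous_on UNIV g"
    by induction (auto intro: continuous_on_add continuous_on_mult smooth_obs_continuous)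
next
  fix g :: "'a obs" and i and b :: "'a phase" assume "g \<in> obs_algebra k" and ib: "(i, b) \<in> coord_dirs k"
  then show "(\<forall>z. (\<lambda>t::real. g (z(i := z i + t *\<^sub>R b))) differentiable (at 0)) \<and> partial i b g \<in> obs_algebra k"
  proof induction
    case (base f)
    then show ?case
      using smooth_obs_differentiable smooth_obs_partial obs_algebra.base ib by blast
  next
    case (const c)
    have "partial i b (\<lambda>_. c) = (\<lambda>_. 0)"
      by (simp add: partial_def)
    then show ?case
      using obs_algebra.const by simp
  next
    case (add f g)
    then have "partial i b (\<lambda>z. f z + g z) = (\<lambda>z. partial i b f z + partial i b g z)"
      by (intro ext partial_add) blast+
    with add show ?case
      by (auto intro: obs_algebra.add)
  next
    case (mult f g)
    then have "partial i b (\<lambda>z. f z * g z) = (\<lambda>z. partial i b f z * g z + f z * partial i b g z)"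
      by (intro ext partial_mult) blast+
    with mult show ?case
      by (auto intro: obs_algebra.add obs_algebra.mult)
  qed
qed

lemma smooth_obs_const: "smooth_obs k (\<lambda>_. c)"
  by (rule obs_algebra_smooth[OF obs_algebra.const])

lemma smooth_obs_add: "smooth_obs k f \<Longrightarrow> smooth_obs k g \<Longrightarrow> smooth_obs k (\<lambda>z. f z + g z)"
  by (rule obs_algebra_smooth[OF obs_algebra.add[OF obs_algebra.base obs_algebra.base]])

lemma smooth_obs_mult: "smooth_obs k f \<Longrightarrow> smooth_obs k g \<Longrightarrow> smooth_obs k (\<lambda>z. f z * g z)"
  by (rule obs_algebra_smooth[OF obs_algebra.mult[OF obs_algebra.base obs_algebra.base]])

lemma smooth_obs_cmult: "smooth_obs k f \<Longrightarrow> smooth_obs k (\<lambda>z. c * f z)"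
  by (intro smooth_obs_mult smooth_obs_const)

lemma smooth_obs_diff:
  assumes "smooth_obs k f" "smooth_obs k g"
  shows "smooth_obs k (\<lambda>z. f z - g z)"
  using smooth_obs_add[OF assms(1) smooth_obs_cmult[OF assms(2), of "-1"]] by simp

lemma smooth_obs_sum:
  assumes "\<And>i. i \<in> I \<Longrightarrow> smooth_obs k (f i)"
  shows "smooth_obs k (\<lambda>z. \<Sum>i\<in>I. f i z)"
  using assms
  by (induction I rule: infinite_finite_induct) (auto intro: smooth_obs_add smooth_obs_const)

lemma iter_partial_linear:
  assumes "smooth_obs k f" "smooth_obs k g" "l \<in> lists (coord_dirs k)"
  shows "iter_partial l (\<lambda>z. c * f z + g z) = (\<lambda>z. c * iter_partial l f z + iter_partial l g z)"
  using assms(3)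
proof (induction l)
  case (Cons x l)
  obtain i b where x: "x = (i, b)"
    by (cases x)
  have l: "l \<in> lists (coord_dirs k)" and ib: "(i, b) \<in> coord_dirs k"
    using Cons x by auto
  have f: "smooth_obs k (iter_partial l f)" and g: "smooth_obs k (iter_partial l g)"
    using assms l smooth_obs_iter_partial by blast+
  have "partial i b (\<lambda>z. c * iter_partial l f z + iter_partial l g z) z
      = c * partial i b (iter_partial l f) z + partial i b (iter_partial l g) z" for z
  proof -
    have "partial i b (\<lambda>z. c * iter_partial l f z) z = c * partial i b (iter_partial l f) z"
      using partial_mult[of "\<lambda>_. c" z i b "iter_partial l f"]
        smooth_obs_differentiable[OF f ib] by (simp add: partial_def[of i b "\<lambda>_. c"])
    then show ?thesis
      using partial_add[of "\<lambda>z. c * iter_partial l f z" z i b "iter_partial l g"]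
        smooth_obs_differentiable[OF smooth_obs_cmult[OF f, of c] ib]
        smooth_obs_differentiable[OF g ib] by simp
  qed
  with Cons l show ?case
    by (simp add: x)
qed simp

lemma iter_partial_add:
  "smooth_obs k f \<Longrightarrow> smooth_obs k g \<Longrightarrow> l \<in> lists (coord_dirs k) \<Longrightarrow>
    iter_partial l (f + g) = iter_partial l f + iter_partial l g"
  using iter_partial_linear[of k f g l 1] by (simp add: plus_fun_def)

lemma iter_partial_scale:
  "smooth_obs k f \<Longrightarrow> l \<in> lists (coord_dirs k) \<Longrightarrow> iter_partial l (c *\<^sub>R f) = c *\<^sub>R iter_partial l f"
  using iter_partial_linear[of k f "\<lambda>_. 0" l c] iter_partial_zero[of l] smooth_obs_const[of k 0]
  by (simp add: scaleR_fun_def zero_fun_def)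

text \<open>For \<open>{1..k}\<close> this is the first clause of \<open>g_space\<close>. Other sets
  arise as the variables of permuted observables.\<close>

definition depends_on :: "nat set \<Rightarrow> ('d::finite) obs \<Rightarrow> bool" where
  "depends_on S f \<longleftrightarrow> (\<forall>z z'. (\<forall>i\<in>S. z i = z' i) \<longrightarrow> f z = f z')"

lemma depends_onD: "depends_on S f \<Longrightarrow> (\<And>i. i \<in> S \<Longrightarrow> z i = z' i) \<Longrightarrow> f z = f z'"
  unfolding depends_on_def by blast

lemma depends_on_partial:
  assumes "depends_on S f"
  shows "depends_on S (partial i b f)"
  unfolding depends_on_def
proof (intro allI impI)
  fix z z' :: "nat \<Rightarrow> 'a phase" assume z: "\<forall>i\<in>S. z i = z' i"
  have "f (z(i := z i + t *\<^sub>R b)) = f (z'(i := z' i + t *\<^sub>R b))" for t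
    using z by (intro depends_onD[OF assms]) auto
  then show "partial i b f z = partial i b f z'"
    by (simp add: partial_def)
qed

lemma depends_on_iter_partial: "depends_on S f \<Longrightarrow> depends_on S (iter_partial l f)"
  by (induction l) (auto simp: depends_on_partial)

lemma line_depends_on:
  assumes "depends_on S f" "i \<notin> S"
  shows "f (z(i := y)) = f z"
  by (rule depends_onD[OF assms(1)]) (use assms(2) in auto)

lemma partial_outside:
  assumes "depends_on S f" "i \<notin> S"
  shows "partial i b f = 0"
  using line_depends_on[OF assms] by (auto simp: partial_def)

lemma iter_partial_outside:
  assumes "depends_on S f" "\<not> fst ` set l \<subseteq> S"
  shows "iter_partial l f = 0"
  using assms(2)
proof (induction l)
  case (Cons x l)
  obtain i b where x: "x = (i, b)"
    by (cases x)
  show ?case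
  proof (cases "i \<in> S")
    case True
    then have "iter_partial l f = 0"
      using Cons x by auto
    then show ?thesis
      by (simp add: x partial_zero)
  next
    case False
    then show ?thesis
      using partial_outside[OF depends_on_iter_partial[OF assms(1)]] by (simp add: x)
  qed
qed simp

text \<open>Derivatives in directions outside \<open>{1..k}\<close> vanish, so the set of such
  functions is closed under all partial derivatives. It serves both to regard an observable as one
  of more variables and to return to fewer.\<close>

lemma smooth_obs_change:
  assumes "smooth_obs k f" "depends_on {1..k} f"
  shows "smooth_obs n f"
proof (rule smooth_obs_coinduct[of f "{f. smooth_obs k f \<and> depends_on {1..k} f}"])
  fix g :: "'a obs" and i and b :: "'a phase"
  assume g: "g \<in> {f. smooth_obs k f \<and> depends_on {1..k} f}" and "(i, b) \<in> coord_dirs n"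
  then have b: "b \<in> Basis"
    by (simp add: coord_dirs_def)
  show "(\<forall>z. (\<lambda>t::real. g (z(i := z i + t *\<^sub>R b))) differentiable (at 0)) \<and>
      partial i b g \<in> {f. smooth_obs k f \<and> depends_on {1..k} f}"
  proof (cases "i \<in> {1..k}")
    case True
    then have "(i, b) \<in> coord_dirs k"
      using b by (simp add: coord_dirs_def)
    then show ?thesis
      using g smooth_obs_differentiable smooth_obs_partial depends_on_partial by blast
  next
    case False
    then show ?thesis
      using g line_depends_on[of "{1..k}" g i] partial_outside[of "{1..k}" g i b]
        smooth_obs_const[of k 0] by (auto simp: zero_fun_def depends_on_def)
  qed
qed (use assms smooth_obs_continuous in auto)

lemma fun_upd_comp_bij: "bij \<pi> \<Longrightarrow> z(i := y) \<circ> \<pi> = (z \<circ> \<pi>)(inv \<pi> i := y)"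
  by (auto simp: fun_eq_iff bij_is_inj bij_is_surj surj_f_inv_f inv_f_f)

text \<open>Moving entry \<open>i\<close> of \<open>z\<close> moves entry \<open>inv \<pi> i\<close>
  of \<open>z \<circ> \<pi>\<close> and no other.\<close>

lemma partial_comp:
  assumes "bij \<pi>"
  shows "partial i b (\<lambda>z. f (z \<circ> \<pi>)) = (\<lambda>z. partial (inv \<pi> i) b f (z \<circ> \<pi>))"
proof
  fix z :: "nat \<Rightarrow> 'a phase"
  show "partial i b (\<lambda>z. f (z \<circ> \<pi>)) z = partial (inv \<pi> i) b f (z \<circ> \<pi>)"
    using assms unfolding partial_def
    by (simp add: fun_upd_comp_bij bij_is_surj surj_f_inv_f)
qed

lemma iter_partial_comp:
  assumes "bij \<pi>"
  shows "iter_partial l (\<lambda>z. f (z \<circ> \<pi>)) = (\<lambda>z. iter_partial (map (\<lambda>(i, b). (inv \<pi> i, b)) l) f (z \<circ> \<pi>))"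
proof (induction l)
  case (Cons x l)
  obtain i b where x: "x = (i, b)"
    by (cases x)
  show ?case
    unfolding x list.map prod.case iter_partial_Cons Cons.IH by (rule partial_comp[OF assms])
qed simp

lemma continuous_comp_index: "continuous_on UNIV (\<lambda>z::nat \<Rightarrow> 'a::topological_space. z \<circ> \<pi>)"
  by (intro continuous_on_coordinatewise_then_product)
    (auto intro: continuous_on_product_then_coordinatewise[OF continuous_on_id])

text \<open>The permuted smooth observables are closed under partial derivatives; since
  \<open>\<pi>\<close> preserves \<open>{1..k}\<close>, relabelled directions remain in
  \<open>coord_dirs k\<close>.\<close>

lemma smooth_obs_comp:
  assumes "smooth_obs k f" "\<pi> permutes {1..k}"
  shows "smooth_obs k (\<lambda>z. f (z \<circ> \<pi>))"
proof (rule smooth_obs_coinduct[of _ "(\<lambda>f z. f (z \<circ> \<pi>)) ` {f. smooth_obs k f}"])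
  fix g assume "g \<in> (\<lambda>f z. f (z \<circ> \<pi>)) ` {f::'a obs. smooth_obs k f}"
  then obtain f where f: "smooth_obs k f" "g = (\<lambda>z. f (z \<circ> \<pi>))"
    by blast
  then show "continuous_on UNIV g"
    using continuous_on_compose[OF continuous_comp_index[of \<pi>], of f] smooth_obs_continuous[OF f(1)]
    by (simp add: o_def continuous_on_subset)
next
  fix g :: "'a obs" and i and b :: "'a phase"
  assume "g \<in> (\<lambda>f z. f (z \<circ> \<pi>)) ` {f. smooth_obs k f}" and ib: "(i, b) \<in> coord_dirs k"
  then obtain f where f: "smooth_obs k f" "g = (\<lambda>z. f (z \<circ> \<pi>))"
    by blast
  note bij = permutes_bij[OF assms(2)]
  have ib': "(inv \<pi> i, b) \<in> coord_dirs k"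
    using ib permutes_in_image[OF permutes_inv[OF assms(2)], of i] by (simp add: coord_dirs_def)
  have "(\<lambda>t. g (z(i := z i + t *\<^sub>R b))) = (\<lambda>t. f ((z \<circ> \<pi>)(inv \<pi> i := (z \<circ> \<pi>) (inv \<pi> i) + t *\<^sub>R b)))" for z
    unfolding f(2) fun_upd_comp_bij[OF bij] using bij by (simp add: bij_is_surj surj_f_inv_f)
  then have "(\<lambda>t. g (z(i := z i + t *\<^sub>R b))) differentiable (at 0)" for z
    using smooth_obs_differentiable[OF f(1) ib', of "z \<circ> \<pi>"] by (simp only:)
  moreover have "partial i b g \<in> (\<lambda>f z. f (z \<circ> \<pi>)) ` {f. smooth_obs k f}"
    using smooth_obs_partial[OF f(1) ib'] unfolding f(2) partial_comp[OF bij] by blast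
  ultimately show "(\<forall>z. (\<lambda>t::real. g (z(i := z i + t *\<^sub>R b))) differentiable (at 0)) \<and>
      partial i b g \<in> (\<lambda>f z. f (z \<circ> \<pi>)) ` {f. smooth_obs k f}"
    by blast
qed (use assms(1) in blast)


section \<open>The spaces of observables\<close>

lemma g_space_iff:
  "f \<in> g_space k \<longleftrightarrow> depends_on {1..k} f \<and> smooth_obs k f \<and> (\<forall>\<pi> z. \<pi> permutes {1..k} \<longrightarrow> f (z \<circ> \<pi>) = f z)"
  by (simp add: g_space_def depends_on_def)

lemma g_space_smooth: "f \<in> g_space k \<Longrightarrow> smooth_obs k f"
  and g_space_depends: "f \<in> g_space k \<Longrightarrow> depends_on {1..k} f"
  and g_space_sym: "f \<in> g_space k \<Longrightarrow> \<pi> permutes {1..k} \<Longrightarrow> f (z \<circ> \<pi>) = f z"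
  by (auto simp: g_space_iff)

lemma subspace_g_space: "subspace (g_space k)"
proof (rule subspaceI)
  fix f g :: "'a obs" assume fg: "f \<in> g_space k" "g \<in> g_space k"
  then have "smooth_obs k (f + g)"
    using smooth_obs_add[of k f g] by (simp add: g_space_smooth plus_fun_def)
  with fg show "f + g \<in> g_space k"
    unfolding g_space_iff by (auto simp: depends_on_def) metis+
next
  fix c :: real and f :: "'a obs" assume f: "f \<in> g_space k"
  then have "smooth_obs k (c *\<^sub>R f)"
    using smooth_obs_cmult[of k f c] by (simp add: g_space_smooth scaleR_fun_def)
  with f show "c *\<^sub>R f \<in> g_space k"
    unfolding g_space_iff by (auto simp: depends_on_def)
qed simp

text \<open>A real \<open>Sup\<close> needs a bounded set. Only finitely many lists of length at
  most \<open>n\<close> exist over the finite set of directions, and each derivative is continuous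
  on the compact set.\<close>

lemma g_seminorm_bdd:
  assumes "smooth_obs k f" "compact K"
  shows "bdd_above {\<bar>iter_partial l f z\<bar> | l z. l \<in> lists (coord_dirs k) \<and> length l \<le> n \<and> z \<in> K}"
proof -
  have "{\<bar>iter_partial l f z\<bar> | l z. l \<in> lists (coord_dirs k) \<and> length l \<le> n \<and> z \<in> K}
      = (\<Union>l\<in>{l. set l \<subseteq> coord_dirs k \<and> length l \<le> n}. (\<lambda>z. \<bar>iter_partial l f z\<bar>) ` K)"
    by (auto simp: in_lists_conv_set)
  moreover have "bdd_above ((\<lambda>z. \<bar>iter_partial l f z\<bar>) ` K)" if "set l \<subseteq> coord_dirs k" for l
  proof -
    have "continuous_on UNIV (iter_partial l f)"
      using that smooth_obs_continuous[OF smooth_obs_iter_partial[OF assms(1)]] by (auto simp: in_lists_conv_set)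
    then have "continuous_on K (\<lambda>z. \<bar>iter_partial l f z\<bar>)"
      by (intro continuous_on_rabs) (rule continuous_on_subset, auto)
    then show ?thesis
      using assms(2) by (intro bounded_imp_bdd_above compact_imp_bounded compact_continuous_image)
  qed
  ultimately show ?thesis
    by (simp add: finite_lists_length_le)
qed

lemma g_seminorm_upper:
  "smooth_obs k f \<Longrightarrow> compact K \<Longrightarrow> l \<in> lists (coord_dirs k) \<Longrightarrow> length l \<le> n \<Longrightarrow> z \<in> K \<Longrightarrow>
    \<bar>iter_partial l f z\<bar> \<le> g_seminorm k K n f"
  unfolding g_seminorm_def by (rule cSup_upper[OF _ g_seminorm_bdd]) auto

lemma g_seminorm_least:
  assumes "K \<noteq> {}"
    and "\<And>l z. l \<in> lists (coord_dirs k) \<Longrightarrow> length l \<le> n \<Longrightarrow> z \<in> K \<Longrightarrow> \<bar>iter_partial l f z\<bar> \<le> C"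
  shows "g_seminorm k K n f \<le> C"
  unfolding g_seminorm_def
proof (rule cSup_least)
  have "[] \<in> lists (coord_dirs k) \<and> length [] \<le> n"
    by simp
  then show "{\<bar>iter_partial l f z\<bar> | l z. l \<in> lists (coord_dirs k) \<and> length l \<le> n \<and> z \<in> K} \<noteq> {}"
    using assms(1) by blast
qed (use assms(2) in blast)

lemma seminorm_on_g_seminorm:
  assumes K: "compact K" "K \<noteq> {}"
  shows "seminorm_on (g_space k) (g_seminorm k K n)"
  unfolding seminorm_on_def
proof (intro conjI ballI allI)
  fix f g :: "'a obs" assume "f \<in> g_space k" "g \<in> g_space k"
  then have s: "smooth_obs k f" "smooth_obs k g"
    by (auto simp: g_space_smooth)
  show "g_seminorm k K n (f + g) \<le> g_seminorm k K n f + g_seminorm k K n g"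
  proof (rule g_seminorm_least[OF K(2)])
    fix l :: "(nat \<times> 'a phase) list" and z assume l: "l \<in> lists (coord_dirs k)" "length l \<le> n" "z \<in> K"
    show "\<bar>iter_partial l (f + g) z\<bar> \<le> g_seminorm k K n f + g_seminorm k K n g"
      using g_seminorm_upper[OF s(1) K(1) l] g_seminorm_upper[OF s(2) K(1) l]
      by (simp add: iter_partial_add[OF s l(1)])
  qed
next
  have le: "g_seminorm k K n (c *\<^sub>R f) \<le> \<bar>c\<bar> * g_seminorm k K n f" if "f \<in> g_space k" for c and f :: "'a obs"
  proof (rule g_seminorm_least[OF K(2)])
    have s: "smooth_obs k f"
      using that by (rule g_space_smooth)
    fix l :: "(nat \<times> 'a phase) list" and z assume l: "l \<in> lists (coord_dirs k)" "length l \<le> n" "z \<in> K"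
    show "\<bar>iter_partial l (c *\<^sub>R f) z\<bar> \<le> \<bar>c\<bar> * g_seminorm k K n f"
      using g_seminorm_upper[OF s K(1) l]
      by (simp add: iter_partial_scale[OF s l(1)] abs_mult mult_left_mono)
  qed
  fix c :: real and f :: "'a obs" assume f: "f \<in> g_space k"
  show "g_seminorm k K n (c *\<^sub>R f) = \<bar>c\<bar> * g_seminorm k K n f"
  proof (cases "c = 0")
    case True
    obtain z where z: "z \<in> K"
      using K by blast
    have "0 \<le> g_seminorm k K n (0::'a obs)"
      using g_seminorm_upper[of k "0::'a obs" K "[]" n z] K z smooth_obs_const[of k 0]
      by (simp add: zero_fun_def)
    moreover have "g_seminorm k K n (0 *\<^sub>R f) \<le> 0"
      using le[OF f, of 0] by simp
    ultimately show ?thesis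
      using True by simp
  next
    case False
    have "g_seminorm k K n ((1 / c) *\<^sub>R c *\<^sub>R f) \<le> \<bar>1 / c\<bar> * g_seminorm k K n (c *\<^sub>R f)"
      using f by (intro le subspace_scale[OF subspace_g_space])
    then have "\<bar>c\<bar> * g_seminorm k K n f \<le> g_seminorm k K n (c *\<^sub>R f)"
      using False by (simp add: field_simps)
    then show ?thesis
      using le[OF f, of c] by simp
  qed
qed

text \<open>Two seminorms are dominated by the one for the union of the compact sets and the larger
  of the orders.\<close>

interpretation g: seminormed_space "g_space k :: ('d::finite) obs set"
  "{g_seminorm k K n | K n. compact K \<and> K \<noteq> {}}" for k
proof
  show "subspace (g_space k :: 'd obs set)"
    by (rule subspace_g_space)
  have "compact {\<lambda>_::nat. 0::'d phase}"
    by simp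
  then show "{g_seminorm k K n | K n. compact K \<and> K \<noteq> {}} \<noteq> ({} :: ('d obs \<Rightarrow> real) set)"
    by blast
  fix p :: "'d obs \<Rightarrow> real" assume "p \<in> {g_seminorm k K n | K n. compact K \<and> K \<noteq> {}}"
  then obtain K1 n1 where p: "p = g_seminorm k K1 n1" "compact K1" "K1 \<noteq> {}"
    by blast
  then show "seminorm_on (g_space k) p"
    by (simp add: seminorm_on_g_seminorm)
  fix q :: "'d obs \<Rightarrow> real" assume "q \<in> {g_seminorm k K n | K n. compact K \<and> K \<noteq> {}}"
  then obtain K2 n2 where q: "q = g_seminorm k K2 n2" "compact K2" "K2 \<noteq> {}"
    by blast
  have "p f \<le> g_seminorm k (K1 \<union> K2) (max n1 n2) f \<and> q f \<le> g_seminorm k (K1 \<union> K2) (max n1 n2) f"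
    if "f \<in> g_space k" for f
    unfolding p(1) q(1) using p q g_space_smooth[OF that]
    by (auto intro!: g_seminorm_least g_seminorm_upper compact_Un)
  then show "\<exists>r\<in>{g_seminorm k K n | K n. compact K \<and> K \<noteq> {}}. \<forall>f\<in>g_space k. p f \<le> r f \<and> q f \<le> r f"
    using p q by (intro bexI[of _ "g_seminorm k (K1 \<union> K2) (max n1 n2)"]) (auto intro: compact_Un)
qed

lemma tvs_g_top: "tvs (g_top k)"
  unfolding g_top_def by (rule g.tvs_Top)

lemma continuous_map_g_topI:
  fixes f :: "'x \<Rightarrow> ('d::finite) obs"
  assumes "\<And>x. x \<in> topspace X \<Longrightarrow> f x \<in> g_space k"
    and "\<And>K n x e. compact K \<Longrightarrow> K \<noteq> {} \<Longrightarrow> x \<in> topspace X \<Longrightarrow> 0 < e \<Longrightarrow>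
      \<exists>U. openin X U \<and> x \<in> U \<and> (\<forall>y\<in>U. g_seminorm k K n (f y - f x) < e)"
  shows "continuous_map X (g_top k) f"
  unfolding g_top_def
proof (rule g.continuous_map_TopI)
  fix p :: "'d obs \<Rightarrow> real" and x and e :: real
  assume "p \<in> {g_seminorm k K n | K n. compact K \<and> K \<noteq> {}}" and *: "x \<in> topspace X" "0 < e"
  then obtain K n where "p = g_seminorm k K n" "compact K" "K \<noteq> {}"
    by blast
  then show "\<exists>U. openin X U \<and> x \<in> U \<and> (\<forall>y\<in>U. p (f y - f x) < e)"
    using assms(2) * by simp
qed (fact assms(1))

lemma tvs_G_top: "tvs (G_top N)"
proof (rule tvsI)
  show "subspace (topspace (G_top N))"
    unfolding topspace_G_top subspace_def
    by (auto intro: subspace_add[OF subspace_g_space] subspace_scale[OF subspace_g_space])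
  fix F :: "'a hier" assume F: "F \<in> topspace (G_top N)"
  have "continuous_map euclideanreal (if k \<in> {1..N} then g_top k else discrete_topology {0}) (\<lambda>c. (c *\<^sub>R F) k)" for k
  proof (cases "k \<in> {1..N}")
    case True
    then have "F k \<in> g_space k"
      using F by (auto simp: topspace_G_top dest: spec[of _ k])
    then show ?thesis
      using True by (simp only: if_True g_top_def scaleR_fun_apply g.continuous_map_scale)
  next
    case False
    then have "F k = 0"
      using F by (auto simp: topspace_G_top dest: spec[of _ k])
    then show ?thesis
      using False by simp
  qed
  then show "continuous_map euclideanreal (G_top N) (\<lambda>c. c *\<^sub>R F)"
    unfolding G_top_def continuous_map_componentwise_UNIV by blast
qed

section \<open>Reflexivity\<close>

lemma iter_partial_diff:
  assumes "smooth_obs k f" "smooth_obs k g" "l \<in> lists (coord_dirs k)"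
  shows "iter_partial l (f - g) = iter_partial l f - iter_partial l g"
proof -
  have "f - g = (\<lambda>z. -1 * g z + f z)"
    by (simp add: fun_eq_iff)
  then show ?thesis
    by (simp only: iter_partial_linear[OF assms(2,1,3)]) (simp add: fun_eq_iff)
qed

text \<open>The derivative of the Dirac functional at \<open>z\<close>, without the alternating sign
  of distribution theory.\<close>

definition eval_deriv ::
    "nat \<Rightarrow> (nat \<times> ('d::finite) phase) list \<Rightarrow> (nat \<Rightarrow> 'd phase) \<Rightarrow> 'd obs \<Rightarrow> real" where
  "eval_deriv k l z = (\<lambda>h. if h \<in> g_space k then iter_partial l h z else 0)"

lemma eval_deriv_dual:
  fixes l :: "(nat \<times> ('d::finite) phase) list"
  assumes l: "l \<in> lists (coord_dirs k)"
  shows "eval_deriv k l z \<in> dual_space (g_top k)"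
proof -
  have "continuous_map (g_top k) euclideanreal (eval_deriv k l z)"
    unfolding g_top_def
  proof (rule g.bounded_functional_continuous)
    show "g_seminorm k {z} (length l) \<in> {g_seminorm k K n | K n. compact K \<and> K \<noteq> {}}"
      using compact_sing[of z] by blast
    fix f g :: "'d obs" assume "f \<in> g_space k" "g \<in> g_space k"
    then show "eval_deriv k l z (f - g) = eval_deriv k l z f - eval_deriv k l z g"
      using iter_partial_diff[OF g_space_smooth g_space_smooth l, of f g]
      by (simp add: eval_deriv_def subspace_diff[OF subspace_g_space])
  next
    fix f :: "'d obs" assume f: "f \<in> g_space k"
    then show "\<bar>eval_deriv k l z f\<bar> \<le> 1 * g_seminorm k {z} (length l) f"
      using g_seminorm_upper[OF g_space_smooth[OF f], of "{z}" l "length l" z] l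
      by (simp add: eval_deriv_def)
  qed
  then show ?thesis
    by (auto simp: dual_space_def eval_deriv_def iter_partial_add[OF g_space_smooth g_space_smooth l]
        iter_partial_scale[OF g_space_smooth l] subspace_add[OF subspace_g_space]
        subspace_scale[OF subspace_g_space])
qed

text \<open>A bounded set is absorbed by the open unit ball of each seminorm, and the absorbing
  factor is a bound.\<close>

lemma tvs_bounded_g_seminorm:
  fixes B :: "('d::finite) obs set"
  assumes "tvs_bounded (g_top k) B" "compact K" "K \<noteq> {}"
  obtains M where "M > 0" "\<And>h. h \<in> B \<Longrightarrow> g_seminorm k K n h \<le> M"
proof -
  have p: "g_seminorm k K n \<in> {g_seminorm k K n :: 'd obs \<Rightarrow> real | K n. compact K \<and> K \<noteq> {}}"
    using assms by blast
  have "openin (g_top k) {h \<in> g_space k. g_seminorm k K n (h - 0) < 1}"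
    unfolding g_top_def by (rule g.openin_ball[OF p]) auto
  moreover have "0 \<in> {h \<in> g_space k. g_seminorm k K n (h - 0) < 1}"
    using g.seminorm_zero[OF p] by simp
  ultimately obtain s where s: "s > 0"
      "\<And>t. t \<ge> s \<Longrightarrow> B \<subseteq> (\<lambda>x. t *\<^sub>R x) ` {h \<in> g_space k. g_seminorm k K n (h - 0) < 1}"
    by (rule tvs_bounded_absorbed[OF assms(1)]) blast
  have "g_seminorm k K n h \<le> s" if h: "h \<in> B" for h
  proof -
    obtain x where x: "x \<in> g_space k" "g_seminorm k K n x < 1" "h = s *\<^sub>R x"
      using s(2)[of s] h by auto
    then show ?thesis
      using g.seminorm_scale[OF p x(1), of s] s(1) by simp
  qed
  then show ?thesis
    using that s(1) by blast
qed

text \<open>Points are infinite sequences here, so compactness of a box is Tychonoff's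
  theorem.\<close>

lemma compact_box_sequences:
  fixes a b :: "nat \<Rightarrow> 'a::euclidean_space"
  shows "compact {z. \<forall>i. z i \<in> cbox (a i) (b i)}"
proof -
  have "compactin (product_topology (\<lambda>i. euclidean) UNIV) (PiE UNIV (\<lambda>i. cbox (a i) (b i)))"
    by (simp add: compactin_PiE)
  moreover have "PiE UNIV (\<lambda>i. cbox (a i) (b i)) = {z. \<forall>i. z i \<in> cbox (a i) (b i)}"
    by auto
  ultimately show ?thesis
    by (simp add: euclidean_product_topology)
qed

text \<open>
  The derivatives of order \<open>length l + 1\<close> are bounded on a box, uniformly in \<open>B\<close>; the point \<open>z0\<close> is
  moved to \<open>z\<close> one coordinate direction at a time.
\<close>

lemma tvs_bounded_equicontinuous:
  fixes B :: "('d::finite) obs set"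
  assumes B: "tvs_bounded (g_top k) B" and l: "l \<in> lists (coord_dirs k)" and e: "e > 0"
  obtains U where "open U" "z0 \<in> U"
    "\<And>z h. z \<in> U \<Longrightarrow> h \<in> B \<Longrightarrow> \<bar>iter_partial l h z - iter_partial l h z0\<bar> \<le> e"
proof -
  define r where "r = (\<lambda>i. if i \<in> {1..k} then One else (0::'d phase))"
  define K where "K = {z. \<forall>i. z i \<in> cbox (z0 i - r i) (z0 i + r i)}"
  have K: "compact K" "z0 \<in> K"
    unfolding K_def by (fact compact_box_sequences) (auto simp: mem_box r_def inner_simps)
  obtain M where M: "M > 0" "\<And>h. h \<in> B \<Longrightarrow> g_seminorm k K (Suc (length l)) h \<le> M"
    using tvs_bounded_g_seminorm[OF B K(1)] K(2) by (metis empty_iff)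
  define \<phi> where "\<phi> = (\<lambda>z. \<Sum>(i, b)\<in>coord_dirs k. \<bar>(z i - z0 i) \<bullet> b\<bar>)"
  \<comment> \<open>\<open>\<phi>\<close> is the sum of the moduli of all coordinate increments. The
    bound 1 keeps the path from \<open>z0\<close> inside the box \<open>K\<close>; the bound
    \<open>e / M\<close> limits the total change along it.\<close>
  define U where "U = {z. \<phi> z < min 1 (e / M)}"
  have "continuous_on UNIV (\<lambda>z::nat \<Rightarrow> 'd phase. z i)" for i
    by (rule continuous_on_product_then_coordinatewise[OF continuous_on_id])
  then have "open U"
    unfolding U_def \<phi>_def case_prod_beta by (intro open_Collect_less continuous_intros)
  moreover have "z0 \<in> U"
    using e M by (simp add: U_def \<phi>_def case_prod_beta)
  moreover have "\<bar>iter_partial l h z - iter_partial l h z0\<bar> \<le> e" if z: "z \<in> U" and h: "h \<in> B" for z h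
  proof -
    have hg: "h \<in> g_space k"
      using B h by (auto simp: tvs_bounded_def)
    define u where "u = iter_partial l h"
    have u: "smooth_obs k u" "depends_on {1..k} u"
      unfolding u_def using smooth_obs_iter_partial[OF g_space_smooth[OF hg] l]
        depends_on_iter_partial[OF g_space_depends[OF hg]] by auto
    have du: "\<bar>partial i b u y\<bar> \<le> M" if "(i, b) \<in> coord_dirs k" "y \<in> K" for i b y
      using g_seminorm_upper[OF g_space_smooth[OF hg] K(1), of "(i, b) # l" "Suc (length l)" y] that l M(2)[OF h]
      by (simp add: u_def)
    define c where "c = (\<lambda>(i, b). (z i - z0 i) \<bullet> b)"
    have c: "\<bar>c x\<bar> \<le> 1" if "x \<in> coord_dirs k" for x
    proof -
      have "\<bar>c x\<bar> \<le> (\<Sum>x\<in>coord_dirs k. \<bar>c x\<bar>)"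
        using that by (intro member_le_sum) auto
      also have "\<dots> = \<phi> z"
        by (simp add: \<phi>_def c_def case_prod_beta)
      finally show ?thesis
        using z by (simp add: U_def)
    qed
    \<comment> \<open>The weight \<open>w x\<close> is the fraction of the increment in direction
      \<open>x\<close> already travelled; the indicator of \<open>D\<close> means that exactly the
      directions in \<open>D\<close> have been completed.\<close>
    define pt where "pt = (\<lambda>w i. if i \<in> {1..k} then z0 i + (\<Sum>b\<in>Basis. (w (i, b) * c (i, b)) *\<^sub>R b) else z0 i)"
    have pt_K: "pt w \<in> K" if w: "\<And>x. 0 \<le> w x \<and> w x \<le> 1" for w
    proof -
      have "\<bar>w (i, b) * c (i, b)\<bar> \<le> 1" if "i \<in> {1..k}" "b \<in> Basis" for i b
      proof -
        have "\<bar>w (i, b)\<bar> * \<bar>c (i, b)\<bar> \<le> 1 * 1"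
          using w[of "(i, b)"] c[of "(i, b)"] that by (intro mult_mono) (auto simp: coord_dirs_def)
        then show ?thesis
          by (simp add: abs_mult)
      qed
      then have "- 1 \<le> w (i, b) * c (i, b) \<and> w (i, b) * c (i, b) \<le> 1" if "i \<in> {1..k}" "b \<in> Basis" for i b
        using that by (simp add: abs_le_iff)
      then show ?thesis
        unfolding K_def pt_def r_def mem_Collect_eq mem_box
        by (auto simp: inner_add_left inner_diff_left inner_sum_left_Basis)
    qed
    have pt_upd: "pt (w((i, b) := \<theta>)) = (pt w)(i := pt w i + (\<theta> * c (i, b)) *\<^sub>R b)"
      if "(i, b) \<in> coord_dirs k" "w (i, b) = 0" for w i b \<theta>
    proof -
      have ib: "i \<in> {1..k}" "b \<in> Basis"
        using that by (auto simp: coord_dirs_def)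
      have "(\<Sum>b'\<in>Basis. ((w((i, b) := \<theta>)) (i, b') * c (i, b')) *\<^sub>R b')
          = (\<theta> * c (i, b)) *\<^sub>R b + (\<Sum>b'\<in>Basis - {b}. (w (i, b') * c (i, b')) *\<^sub>R b')"
        by (subst sum.remove[OF finite_Basis ib(2)]) (auto intro!: sum.cong)
      also have "(\<Sum>b'\<in>Basis - {b}. (w (i, b') * c (i, b')) *\<^sub>R b') = (\<Sum>b'\<in>Basis. (w (i, b') * c (i, b')) *\<^sub>R b')"
        using that(2) by (intro sum.mono_neutral_left) auto
      finally show ?thesis
        using ib(1) by (auto simp: pt_def fun_eq_iff)
    qed
    have "\<bar>u (pt (indicator D)) - u z0\<bar> \<le> (\<Sum>x\<in>D. \<bar>c x\<bar> * M)" if "finite D" "D \<subseteq> coord_dirs k" for D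
      using that
    proof (induction D rule: finite_induct)
      case empty
      have "pt (indicator {}) = z0"
        by (auto simp: pt_def)
      then show ?case
        by (simp only: sum.empty)
    next
      case (insert x D)
      obtain i b where x: "x = (i, b)"
        by (cases x)
      define w where "w = (indicator D :: nat \<times> 'd phase \<Rightarrow> real)"
      have ib: "(i, b) \<in> coord_dirs k" and w0: "w (i, b) = 0"
        using insert x by (auto simp: w_def)
      define v where "v = (\<lambda>\<theta>. pt (w((i, b) := \<theta>)))"
      have v: "v \<theta> = (pt w)(i := pt w i + (\<theta> * c x) *\<^sub>R b)" for \<theta>
        unfolding v_def x using ib w0 by (rule pt_upd)
      have "((\<lambda>\<theta>. u (v \<theta>)) has_real_derivative partial i b u (v \<theta>) * c x) (at \<theta>)" for \<theta>
        unfolding v by (rule DERIV_chain2[OF partial_DERIV[OF u(1) ib]]) (auto intro!: derivative_eq_intros)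
      from MVT2[of 0 1, OF _ this] obtain \<theta> where \<theta>: "0 < \<theta>" "\<theta> < 1"
          "u (v 1) - u (v 0) = partial i b u (v \<theta>) * c x"
        by auto
      have "v \<theta> \<in> K"
        unfolding v_def using \<theta> by (intro pt_K) (auto simp: w_def indicator_def)
      then have "\<bar>u (v 1) - u (v 0)\<bar> \<le> \<bar>c x\<bar> * M"
        unfolding \<theta>(3) abs_mult by (subst mult.commute) (intro mult_left_mono du[OF ib] abs_ge_zero)
      moreover have "v 0 = pt (indicator D)"
        using v[of 0] by (simp add: w_def)
      moreover have "v 1 = pt (indicator (insert x D))"
        unfolding v_def w_def x by (rule arg_cong[of _ _ pt]) (auto simp: indicator_def)
      moreover have "\<bar>u (pt (indicator D)) - u z0\<bar> \<le> (\<Sum>x\<in>D. \<bar>c x\<bar> * M)"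
        using insert by auto
      ultimately show ?case
        using insert.hyps by simp
    qed
    from this[OF finite_coord_dirs order_refl]
    have "\<bar>u (pt (indicator (coord_dirs k))) - u z0\<bar> \<le> \<phi> z * M"
      by (simp add: \<phi>_def c_def case_prod_beta sum_distrib_right)
    \<comment> \<open>The endpoint of the path agrees with \<open>z\<close> on \<open>{1..k}\<close>
      and with \<open>z0\<close> elsewhere, so locality of \<open>u\<close> is used.\<close>
    also have "u (pt (indicator (coord_dirs k))) = u z"
    proof (rule depends_onD[OF u(2)])
      fix i assume i: "i \<in> {1..k}"
      then have "(\<Sum>b\<in>Basis. (indicator (coord_dirs k) (i, b) * c (i, b)) *\<^sub>R b)
          = (\<Sum>b\<in>Basis. ((z i - z0 i) \<bullet> b) *\<^sub>R b)"
        by (intro sum.cong) (auto simp: coord_dirs_def c_def)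
      then show "pt (indicator (coord_dirs k)) i = z i"
        using i by (simp add: pt_def euclidean_representation)
    qed
    also have "\<phi> z * M \<le> e"
      using z M(1) by (simp add: U_def field_simps)
    finally show ?thesis
      by (simp add: u_def)
  qed
  ultimately show ?thesis
    using that by blast
qed

text \<open>Equicontinuity of \<open>B\<close>, read in the dual: the derivatives of Dirac
  functionals vary continuously with the point in the seminorm that dominates a bidual
  element.\<close>

lemma polar_norm_equicontinuous:
  fixes B :: "('d::finite) obs set"
  assumes "B \<noteq> {}" "tvs_bounded (g_top k) B" "l \<in> lists (coord_dirs k)" "e > 0"
  shows "\<exists>U. open U \<and> z0 \<in> U \<and> (\<forall>z\<in>U. polar_norm B (eval_deriv k l z - eval_deriv k l z0) \<le> e)"
proof -
  obtain U where U: "open U" "z0 \<in> U"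
      "\<And>z h. z \<in> U \<Longrightarrow> h \<in> B \<Longrightarrow> \<bar>iter_partial l h z - iter_partial l h z0\<bar> \<le> e"
    using tvs_bounded_equicontinuous[OF assms(2-4)] by metis
  have "B \<subseteq> g_space k"
    using assms(2) by (auto simp: tvs_bounded_def)
  then have "polar_norm B (eval_deriv k l z - eval_deriv k l z0) \<le> e" if "z \<in> U" for z
    using U(3)[OF that] by (intro polar_norm_least[OF assms(1)]) (auto simp: eval_deriv_def subset_iff)
  then show ?thesis
    using U by blast
qed

lemma continuous_line: "continuous_on UNIV (\<lambda>t::real. (z::nat \<Rightarrow> 'a::real_normed_vector)(i := z i + t *\<^sub>R b))"
proof (rule continuous_on_coordinatewise_then_product)
  show "continuous_on UNIV (\<lambda>t. (z(i := z i + t *\<^sub>R b)) j)" for j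
    by (cases "j = i") (auto intro!: continuous_intros)
qed

theorem g_top_reflexive:
  fixes L :: "(('d::finite) obs \<Rightarrow> real) \<Rightarrow> real"
  assumes L: "L \<in> dual_space (strong_dual (g_top k))"
  obtains f where "f \<in> g_space k" "\<And>\<Delta>. \<Delta> \<in> dual_space (g_top k) \<Longrightarrow> L \<Delta> = \<Delta> f"
proof -
  note X = tvs_g_top[of k, where 'a = 'd]
  let ?E = "eval_deriv k"
  note TD = topspace_strong_dual_tvs[OF X]
  obtain B C where B: "B \<noteq> {}" "tvs_bounded (g_top k) B" and C: "C > 0"
    and bound: "\<And>\<gamma>. \<gamma> \<in> dual_space (g_top k) \<Longrightarrow> \<bar>L \<gamma>\<bar> \<le> C * polar_norm B \<gamma>"
    using bidual_bound[OF X L] by metis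
  have BX: "B \<subseteq> g_space k"
    using B(2) by (auto simp: tvs_bounded_def)
  have L_scale: "L (c *\<^sub>R \<gamma>) = c * L \<gamma>" if "\<gamma> \<in> dual_space (g_top k)" for c \<gamma>
    using dual_scale[OF L] that TD by simp
  have L_diff: "L (\<gamma> - \<delta>) = L \<gamma> - L \<delta>" if "\<gamma> \<in> dual_space (g_top k)" "\<delta> \<in> dual_space (g_top k)" for \<gamma> \<delta>
    using dual_diff[OF tvs_strong_dual[OF X] L] that TD by simp
  have L_equi: "\<exists>U. open U \<and> z0 \<in> U \<and> (\<forall>z\<in>U. polar_norm B (?E l z - ?E l z0) \<le> e / C)"
    if "l \<in> lists (coord_dirs k)" "e > 0" for l e and z0 :: "nat \<Rightarrow> 'd phase"
    using polar_norm_equicontinuous[OF B that(1)] that(2) C by simp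
  have L_near: "\<bar>L (?E l z) - L (?E l z0)\<bar> \<le> e"
    if "l \<in> lists (coord_dirs k)" "polar_norm B (?E l z - ?E l z0) \<le> e / C" for l e z and z0 :: "nat \<Rightarrow> 'd phase"
  proof -
    have "\<bar>L (?E l z - ?E l z0)\<bar> \<le> C * polar_norm B (?E l z - ?E l z0)"
      using that(1) by (intro bound dual_space_diff eval_deriv_dual)
    also have "\<dots> \<le> e"
      using that(2) C by (simp add: field_simps)
    finally show ?thesis
      using that(1) by (simp add: L_diff eval_deriv_dual)
  qed
  define f where "f = (\<lambda>z. L (?E [] z))"
  \<comment> \<open>The difference quotients of the functionals \<open>?E l\<close> converge to the
    derivative functional uniformly on \<open>B\<close>: for each \<open>h\<close> the mean value
    theorem moves the error to an intermediate point, and equicontinuity at the next order makes it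
    small for all \<open>h\<close> at once.\<close>
  have deriv: "((\<lambda>t. L (?E l (z(i := z i + t *\<^sub>R b)))) has_real_derivative L (?E ((i, b) # l) z)) (at 0)"
    if l: "l \<in> lists (coord_dirs k)" and ib: "(i, b) \<in> coord_dirs k" for l i b z
  proof -
    have l': "(i, b) # l \<in> lists (coord_dirs k)"
      using l ib by simp
    let ?z = "\<lambda>t. z(i := z i + t *\<^sub>R b)"
    have "((\<lambda>t. (L (?E l (?z t)) - L (?E l z)) / t) \<longlongrightarrow> L (?E ((i, b) # l) z)) (at 0)"
    proof (rule tendstoI)
      fix e :: real assume e: "e > 0"
      \<comment> \<open>Multiplication by \<open>C\<close> turns this tolerance into
        \<open>e / 2\<close>, so that the final estimate is strict.\<close>
      have "e / (2 * C) > 0"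
        using e C by simp
      then obtain U where U: "open U" "z \<in> U"
          "\<And>y h. y \<in> U \<Longrightarrow> h \<in> B \<Longrightarrow> \<bar>iter_partial ((i, b) # l) h y - iter_partial ((i, b) # l) h z\<bar> \<le> e / (2 * C)"
        using tvs_bounded_equicontinuous[OF B(2) l'] by metis
      have "open (?z -` U)"
        using U(1) continuous_line by (rule open_vimage)
      moreover have "0 \<in> ?z -` U"
        using U(2) by simp
      ultimately obtain d where d: "d > 0" "ball 0 d \<subseteq> ?z -` U"
        by (meson openE)
      have "dist ((L (?E l (?z t)) - L (?E l z)) / t) (L (?E ((i, b) # l) z)) < e"
        if t: "t \<noteq> 0" "\<bar>t\<bar> < d" for t
      proof -
        define \<gamma> where "\<gamma> = (1 / t) *\<^sub>R (?E l (?z t) - ?E l z) - ?E ((i, b) # l) z"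
        have \<gamma>: "\<gamma> \<in> dual_space (g_top k)"
          unfolding \<gamma>_def by (intro dual_space_diff dual_space_scale eval_deriv_dual l l')
        have "polar_norm B \<gamma> \<le> e / (2 * C)"
        proof (rule polar_norm_least[OF B(1)])
          fix h assume h: "h \<in> B"
          then have hg: "h \<in> g_space k"
            using BX by blast
          let ?u = "iter_partial l h"
          have "smooth_obs k ?u"
            using smooth_obs_iter_partial[OF g_space_smooth[OF hg] l] .
          then have "((\<lambda>\<theta>. ?u (?z (\<theta> * t))) has_real_derivative partial i b ?u (?z (\<theta> * t)) * t) (at \<theta>)" for \<theta>
            by (intro DERIV_chain2[OF partial_DERIV[OF _ ib]]) (auto intro!: derivative_eq_intros)
          from MVT2[of 0 1, OF _ this] obtain \<theta> where \<theta>: "0 < \<theta>" "\<theta> < 1"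
              "?u (?z t) - ?u z = partial i b ?u (?z (\<theta> * t)) * t"
            by auto
          have "\<bar>\<theta> * t\<bar> \<le> \<bar>t\<bar>"
            using \<theta> by (simp add: abs_mult mult_left_le_one_le)
          then have "\<theta> * t \<in> ball 0 d"
            using t by simp
          then have "?z (\<theta> * t) \<in> U"
            using d(2) by blast
          moreover have "\<gamma> h = partial i b ?u (?z (\<theta> * t)) - partial i b ?u z"
            using hg \<theta>(3) t by (simp add: \<gamma>_def eval_deriv_def)
          ultimately show "\<bar>\<gamma> h\<bar> \<le> e / (2 * C)"
            using U(3)[OF _ h] by simp
        qed
        then have "C * polar_norm B \<gamma> \<le> e / 2"
          using C by (simp add: field_simps)
        then have "\<bar>L \<gamma>\<bar> < e"
          using bound[OF \<gamma>] e by linarith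
        moreover have "L \<gamma> = (L (?E l (?z t)) - L (?E l z)) / t - L (?E ((i, b) # l) z)"
        proof -
          have "L \<gamma> = (1 / t) * (L (?E l (?z t)) - L (?E l z)) - L (?E ((i, b) # l) z)"
            unfolding \<gamma>_def
            by (subst L_diff L_scale, (intro dual_space_diff dual_space_scale eval_deriv_dual l l')+)+ simp
          then show ?thesis
            by simp
        qed
        ultimately show ?thesis
          by (simp add: dist_real_def)
      qed
      then show "\<forall>\<^sub>F t in at 0. dist ((L (?E l (?z t)) - L (?E l z)) / t) (L (?E ((i, b) # l) z)) < e"
        unfolding eventually_at using d(1) by (intro exI[of _ d]) (simp add: dist_real_def)
    qed
    then show ?thesis
      by (simp add: DERIV_def)
  qed
  have iter: "iter_partial l f = (\<lambda>z. L (?E l z))" if "l \<in> lists (coord_dirs k)" for l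
    using that
  proof (induction l)
    case (Cons x l)
    obtain i b where x: "x = (i, b)"
      by (cases x)
    have l: "l \<in> lists (coord_dirs k)" "(i, b) \<in> coord_dirs k"
      using Cons x by auto
    show ?case
      unfolding x iter_partial_Cons Cons.IH partial_def
      by (intro ext DERIV_imp_deriv deriv l)
  qed (simp add: f_def)
  have "continuous_on UNIV (\<lambda>z. L (?E l z))" if l: "l \<in> lists (coord_dirs k)" for l
    unfolding continuous_on_eq_continuous_at[OF open_UNIV] isCont_def
  proof (intro ballI tendstoI)
    fix z0 :: "nat \<Rightarrow> 'd phase" and e :: real assume "e > 0"
    then obtain U where U: "open U" "z0 \<in> U" "\<forall>z\<in>U. polar_norm B (?E l z - ?E l z0) \<le> e / 2 / C"
      using L_equi[OF l, of "e / 2" z0] by auto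
    have "dist (L (?E l z)) (L (?E l z0)) < e" if "z \<in> U" for z
      using L_near[OF l U(3)[rule_format, OF that]] \<open>e > 0\<close> by (simp add: dist_real_def)
    then show "\<forall>\<^sub>F z in at z0. dist (L (?E l z)) (L (?E l z0)) < e"
      unfolding eventually_at_topological using U by blast
  qed
  then have "smooth_obs k f"
    unfolding smooth_obs_def using iter deriv by (auto simp: real_differentiable_def) blast
  \<comment> \<open>Locality and symmetry pass to \<open>f\<close> because the Dirac functionals at
    the two points coincide on \<open>g_space k\<close>.\<close>
  moreover have "?E [] z = ?E [] z'" if "\<And>i. i \<in> {1..k} \<Longrightarrow> z i = z' i" for z z' :: "nat \<Rightarrow> 'd phase"
    using depends_onD[OF g_space_depends that] by (fastforce simp: eval_deriv_def)
  moreover have "?E [] (z \<circ> \<pi>) = ?E [] z" if "\<pi> permutes {1..k}" for \<pi> and z :: "nat \<Rightarrow> 'd phase"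
    using g_space_sym[OF _ that, where z = z] unfolding eval_deriv_def iter_partial_Nil by metis
  ultimately have f: "f \<in> g_space k"
    unfolding g_space_iff depends_on_def f_def by metis
  have "L \<Delta> = \<Delta> f" if \<Delta>: "\<Delta> \<in> dual_space (g_top k)" for \<Delta>
  proof (rule ccontr)
    assume neq: "L \<Delta> \<noteq> \<Delta> f"
    have "\<exists>p\<in>{g_seminorm k K n | K n. compact K \<and> K \<noteq> {}}. \<exists>C>0. \<forall>u\<in>g_space k. \<bar>\<Delta> u\<bar> \<le> C * p u"
      by (rule g.continuous_functional_bound[OF dual_continuous[OF \<Delta>, unfolded g_top_def]])
        (simp add: dual_scale[OF \<Delta>])
    then obtain K n C' where K: "compact K" "K \<noteq> {}" and C': "C' > 0"
      and \<Delta>_bound: "\<And>u. u \<in> g_space k \<Longrightarrow> \<bar>\<Delta> u\<bar> \<le> C' * g_seminorm k K n u"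
      by auto
    \<comment> \<open>Chosen so that \<open>(1 + 3 * C') * e\<close> is half of the supposed
      discrepancy: \<open>e\<close> for the error of \<open>h\<close> at \<open>\<Delta>\<close>,
      and \<open>3 * C' * e\<close> for replacing \<open>f\<close> by \<open>h\<close>.\<close>
    define e where "e = \<bar>L \<Delta> - \<Delta> f\<bar> / (2 * (1 + 3 * C'))"
    have e: "e > 0"
      using neq C' by (simp add: e_def)
    define Ls where "Ls = {l :: (nat \<times> 'd phase) list. set l \<subseteq> coord_dirs k \<and> length l \<le> n}"
    have Ls: "finite Ls" "\<And>l. l \<in> Ls \<Longrightarrow> l \<in> lists (coord_dirs k)"
      unfolding Ls_def using finite_lists_length_le[OF finite_coord_dirs] by auto
    have "\<forall>l\<in>Ls. \<forall>z0. \<exists>U. open U \<and> z0 \<in> U \<and> (\<forall>z\<in>U. polar_norm B (?E l z - ?E l z0) \<le> e / C)"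
      using L_equi Ls(2) e by blast
    then obtain W where W: "\<And>l z0. l \<in> Ls \<Longrightarrow> open (W l z0)" "\<And>l z0. l \<in> Ls \<Longrightarrow> z0 \<in> W l z0"
        "\<And>l z0 z. l \<in> Ls \<Longrightarrow> z \<in> W l z0 \<Longrightarrow> polar_norm B (?E l z - ?E l z0) \<le> e / C"
      by metis
    \<comment> \<open>Compactness reduces the uniform condition on \<open>K\<close> to finitely many
      points, hence to finitely many functionals, as the approximation result requires.\<close>
    obtain Z where Z: "Z \<subseteq> K" "finite Z" "K \<subseteq> (\<Union>z0\<in>Z. \<Inter>l\<in>Ls. W l z0)"
    proof (rule compactE_image[OF K(1), of K "\<lambda>z0. \<Inter>l\<in>Ls. W l z0"])
      show "open (\<Inter>l\<in>Ls. W l z0)" for z0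
        using Ls(1) W(1) by blast
      show "K \<subseteq> (\<Union>z0\<in>K. \<Inter>l\<in>Ls. W l z0)"
        using W(2) by blast
    qed
    define D where "D = insert \<Delta> ((\<lambda>(l, z). ?E l z) ` (Ls \<times> Z))"
    have D: "finite D" "D \<subseteq> dual_space (g_top k)"
      unfolding D_def using Ls Z(2) \<Delta> by (auto intro!: eval_deriv_dual)
    obtain h where h: "h \<in> g_space k" "\<And>\<gamma>. \<gamma> \<in> dual_space (g_top k) \<Longrightarrow> \<bar>\<gamma> h\<bar> \<le> C * polar_norm B \<gamma>"
        "\<And>\<delta>. \<delta> \<in> D \<Longrightarrow> \<bar>\<delta> h - L \<delta>\<bar> < e"
      using bidual_approx[OF X L B C bound D e] by auto
    \<comment> \<open>Three errors of size \<open>e\<close>: moving from \<open>z\<close> to the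
      nearby \<open>z0\<close> under \<open>L\<close>, exchanging \<open>L\<close> for evaluation at
      \<open>h\<close> in \<open>z0\<close>, and moving back to \<open>z\<close> under evaluation at
      \<open>h\<close>. The last is uniform because \<open>h\<close> obeys the same bound as
      \<open>L\<close>.\<close>
    have "g_seminorm k K n (f - h) \<le> 3 * e"
    proof (rule g_seminorm_least[OF K(2)])
      fix l :: "(nat \<times> 'd phase) list" and z
      assume l: "l \<in> lists (coord_dirs k)" "length l \<le> n" and z: "z \<in> K"
      then have lL: "l \<in> Ls"
        by (auto simp: Ls_def)
      obtain z0 where z0: "z0 \<in> Z" "z \<in> W l z0"
        using Z(3) z lL by blast
      note near = W(3)[OF lL z0(2)]
      have "\<bar>(?E l z - ?E l z0) h\<bar> \<le> C * polar_norm B (?E l z - ?E l z0)"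
        by (intro h(2) dual_space_diff eval_deriv_dual l)
      also have "\<dots> \<le> e"
        using near C by (simp add: field_simps)
      finally have "\<bar>?E l z h - ?E l z0 h\<bar> \<le> e"
        by simp
      moreover have "\<bar>?E l z0 h - L (?E l z0)\<bar> < e"
        using z0(1) lL by (intro h(3)) (auto simp: D_def)
      moreover have "iter_partial l (f - h) z = L (?E l z) - ?E l z h"
        using iter_partial_diff[OF g_space_smooth[OF f] g_space_smooth[OF h(1)] l(1)] iter[OF l(1)] h(1)
        by (simp add: eval_deriv_def)
      ultimately show "\<bar>iter_partial l (f - h) z\<bar> \<le> 3 * e"
        using L_near[OF l(1) near] by linarith
    qed
    then have "C' * g_seminorm k K n (f - h) \<le> C' * (3 * e)"
      using C' by simp
    then have "\<bar>\<Delta> (f - h)\<bar> \<le> 3 * C' * e"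
      using \<Delta>_bound[OF subspace_diff[OF subspace_g_space f h(1)]] by linarith
    moreover have "\<Delta> (f - h) = \<Delta> f - \<Delta> h"
      using dual_diff[OF X \<Delta>] f h(1) by simp
    moreover have "\<bar>\<Delta> h - L \<Delta>\<bar> < e"
      by (intro h(3)) (simp add: D_def)
    ultimately have "\<bar>L \<Delta> - \<Delta> f\<bar> < (1 + 3 * C') * e"
      by (simp add: algebra_simps)
    also have "\<dots> = \<bar>L \<Delta> - \<Delta> f\<bar> / 2"
      using C' by (simp add: e_def field_simps)
    finally show False
      by simp
  qed
  then show ?thesis
    using that f by blast
qed

section \<open>Hierarchies as a finite direct sum, and their reflexivity\<close>

lemma topspace_G_topD:
  assumes "F \<in> topspace (G_top N)"
  shows "k \<in> {1..N} \<Longrightarrow> F k \<in> g_space k" and "k \<notin> {1..N} \<Longrightarrow> F k = 0"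
  using assms by (auto simp: topspace_G_top dest: spec[of _ k])

lemma continuous_map_G_proj: "k \<in> {1..N} \<Longrightarrow> continuous_map (G_top N) (g_top k) (\<lambda>F. F k)"
  using continuous_map_product_projection[of k UNIV
      "\<lambda>k. if k \<in> {1..N} then g_top k else discrete_topology {0}"]
  by (simp add: G_top_def)

definition hier_single :: "nat \<Rightarrow> ('d::finite) obs \<Rightarrow> 'd hier" where
  "hier_single k f = (\<lambda>j. if j = k then f else 0)"

lemma hier_single_add: "hier_single k (f + g) = hier_single k f + hier_single k g"
  and hier_single_scale: "hier_single k (c *\<^sub>R f) = c *\<^sub>R hier_single k f"
  by (auto simp: hier_single_def fun_eq_iff)

lemma continuous_map_hier_single:
  assumes "k \<in> {1..N}"
  shows "continuous_map (g_top k) (G_top N) (hier_single k)"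
  unfolding G_top_def continuous_map_componentwise_UNIV
proof
  fix j
  show "continuous_map (g_top k) (if j \<in> {1..N} then g_top j else discrete_topology {0}) (\<lambda>f. hier_single k f j)"
    using assms by (cases "j = k") (auto simp: hier_single_def)
qed

lemma hier_single_in: "k \<in> {1..N} \<Longrightarrow> f \<in> g_space k \<Longrightarrow> hier_single k f \<in> topspace (G_top N)"
  using continuous_map_hier_single[of k N] by (auto simp: continuous_map_def)

lemma hier_decompose:
  assumes "F \<in> topspace (G_top N)"
  shows "F = (\<Sum>k=1..N. hier_single k (F k))"
proof
  fix j
  show "F j = (\<Sum>k=1..N. hier_single k (F k)) j"
    using topspace_G_topD(2)[OF assms, of j]
    by (cases "j \<in> {1..N}") (auto simp: sum_fun_apply hier_single_def)
qed

text \<open>\<open>?J k\<close> extends a functional of the \<open>k\<close>-th component to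
  hierarchies and \<open>?R k\<close> restricts to that component. Since a functional is the finite
  sum of its \<open>?J k (?R k \<Delta>)\<close>, it suffices to represent each
  \<open>L \<circ> ?J k\<close>, which is a bidual element of \<open>g_top k\<close>.\<close>

theorem G_top_reflexive:
  fixes L :: "(('d::finite) hier \<Rightarrow> real) \<Rightarrow> real"
  assumes L: "L \<in> dual_space (strong_dual (G_top N))"
  obtains F where "F \<in> topspace (G_top N)" "\<And>\<Delta>. \<Delta> \<in> dual_space (G_top N) \<Longrightarrow> L \<Delta> = \<Delta> F"
proof -
  note XG = tvs_G_top[of N, where 'a = 'd]
  let ?J = "\<lambda>k. transpose_map (G_top N) (\<lambda>F::'d hier. F k)"
  let ?R = "\<lambda>k. transpose_map (g_top k) (hier_single k)"
  have J: "?J k \<Delta> \<in> dual_space (G_top N)"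
    if "k \<in> {1..N}" "\<Delta> \<in> dual_space (g_top k)" for k and \<Delta> :: "'d obs \<Rightarrow> real"
    by (rule transpose_map_dual[OF XG tvs_g_top continuous_map_G_proj[OF that(1)] _ _ that(2)]) simp_all
  have R: "?R k \<Delta> \<in> dual_space (g_top k)"
    if "k \<in> {1..N}" "\<Delta> \<in> dual_space (G_top N)" for k and \<Delta> :: "'d hier \<Rightarrow> real"
    by (rule transpose_map_dual[OF tvs_g_top XG continuous_map_hier_single[OF that(1)] _ _ that(2)])
      (simp_all add: hier_single_add hier_single_scale)
  have "\<exists>f\<in>g_space k. \<forall>\<Delta>\<in>dual_space (g_top k). L (?J k \<Delta>) = \<Delta> f" if k: "k \<in> {1..N}" for k
  proof -
    note X = tvs_g_top[of k, where 'a = 'd]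
    have "continuous_map (strong_dual (g_top k)) (strong_dual (G_top N)) (?J k)"
      by (rule continuous_transpose_map[OF XG X continuous_map_G_proj[OF k]]) simp_all
    then have "transpose_map (strong_dual (g_top k)) (?J k) L \<in> dual_space (strong_dual (g_top k))"
      by (rule transpose_map_dual[OF tvs_strong_dual[OF X] tvs_strong_dual[OF XG] _ _ _ L])
        (simp_all add: transpose_map_add transpose_map_scale)
    then obtain f where "f \<in> g_space k"
        "\<And>\<Delta>. \<Delta> \<in> dual_space (g_top k) \<Longrightarrow> transpose_map (strong_dual (g_top k)) (?J k) L \<Delta> = \<Delta> f"
      by (rule g_top_reflexive) blast
    then show ?thesis
      by (intro bexI[of _ f]) (auto simp: transpose_map_def topspace_strong_dual_tvs[OF X])
  qed
  then obtain f where f: "\<And>k. k \<in> {1..N} \<Longrightarrow> f k \<in> g_space k"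
      "\<And>k \<Delta>. k \<in> {1..N} \<Longrightarrow> \<Delta> \<in> dual_space (g_top k) \<Longrightarrow> L (?J k \<Delta>) = \<Delta> (f k)"
    by metis
  define F where "F = (\<Sum>k=1..N. hier_single k (f k))"
  have F: "F \<in> topspace (G_top N)"
    unfolding F_def using f(1) by (intro subspace_sum tvsD(1)[OF XG] hier_single_in) auto
  have "L \<Delta> = \<Delta> F" if \<Delta>: "\<Delta> \<in> dual_space (G_top N)" for \<Delta>
  proof -
    have "\<Delta> = (\<Sum>k=1..N. ?J k (?R k \<Delta>))"
    proof
      fix G
      show "\<Delta> G = (\<Sum>k=1..N. ?J k (?R k \<Delta>)) G"
      proof (cases "G \<in> topspace (G_top N)")
        case True
        have "(\<Sum>k=1..N. ?J k (?R k \<Delta>)) G = (\<Sum>k=1..N. \<Delta> (hier_single k (G k)))"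
          unfolding sum_fun_apply using True topspace_G_topD(1)[OF True]
          by (intro sum.cong) (auto simp: transpose_map_def)
        also have "\<dots> = \<Delta> (\<Sum>k=1..N. hier_single k (G k))"
          using topspace_G_topD(1)[OF True] by (intro dual_sum[symmetric, OF XG \<Delta>] hier_single_in) auto
        finally show ?thesis
          using hier_decompose[OF True] by simp
      next
        case False
        then show ?thesis
          using dual_outside[OF \<Delta>] by (simp add: sum_fun_apply transpose_map_def)
      qed
    qed
    then have "L \<Delta> = L (\<Sum>k=1..N. ?J k (?R k \<Delta>))"
      by simp
    also have "\<dots> = (\<Sum>k=1..N. L (?J k (?R k \<Delta>)))"
      using J R \<Delta> by (intro dual_sum[OF tvs_strong_dual[OF XG] L]) (simp add: topspace_strong_dual_tvs[OF XG])
    also have "\<dots> = (\<Sum>k=1..N. \<Delta> (hier_single k (f k)))"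
    proof (rule sum.cong)
      fix k assume k: "k \<in> {1..N}"
      show "L (?J k (?R k \<Delta>)) = \<Delta> (hier_single k (f k))"
        unfolding f(2)[OF k R[OF k \<Delta>]] using f(1)[OF k] by (simp add: transpose_map_def)
    qed simp
    also have "\<dots> = \<Delta> F"
      unfolding F_def using f(1) by (intro dual_sum[symmetric, OF XG \<Delta>] hier_single_in) auto
    finally show ?thesis .
  qed
  then show ?thesis
    using that F by blast
qed

section \<open>Separation of points and representation of derivatives\<close>

lemma g_top_separated:
  assumes "f \<in> g_space k" "g \<in> g_space k" "\<And>\<Delta>. \<Delta> \<in> dual_space (g_top k) \<Longrightarrow> \<Delta> f = \<Delta> g"
  shows "f = g"
proof
  fix z
  show "f z = g z"
    using assms(3)[OF eval_deriv_dual[of "[]" k z]] assms(1,2) by (simp add: eval_deriv_def)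
qed

lemma G_top_separated:
  assumes F: "F \<in> topspace (G_top N)" and G: "G \<in> topspace (G_top N)"
    and eq: "\<And>\<Delta>. \<Delta> \<in> dual_space (G_top N) \<Longrightarrow> \<Delta> F = \<Delta> G"
  shows "F = G"
proof
  fix k
  show "F k = G k"
  proof (cases "k \<in> {1..N}")
    case True
    show ?thesis
    proof (rule g_top_separated)
      fix \<Delta> :: "'a obs \<Rightarrow> real" assume "\<Delta> \<in> dual_space (g_top k)"
      then have "transpose_map (G_top N) (\<lambda>F. F k) \<Delta> \<in> dual_space (G_top N)"
        by (rule transpose_map_dual[OF tvs_G_top tvs_g_top continuous_map_G_proj[OF True], rotated 2]) simp_all
      from eq[OF this] show "\<Delta> (F k) = \<Delta> (G k)"
        using F G by (simp add: transpose_map_def)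
    qed (use F G True topspace_G_topD in blast)+
  next
    case False
    then show ?thesis
      using topspace_G_topD(2)[OF F] topspace_G_topD(2)[OF G] by simp
  qed
qed

text \<open>Separation of points by the dual supplies the uniqueness demanded by the definite
  description.\<close>

lemma diff_elem_eqI:
  assumes "\<And>f g. f \<in> topspace X \<Longrightarrow> g \<in> topspace X \<Longrightarrow> (\<And>\<Delta>. \<Delta> \<in> dual_space X \<Longrightarrow> \<Delta> f = \<Delta> g) \<Longrightarrow> f = g"
    and "f \<in> topspace X" "\<And>\<Delta>. \<Delta> \<in> dual_space X \<Longrightarrow> dir_deriv euclideanreal F \<Gamma> \<Delta> = \<Delta> f"
  shows "diff_elem X F \<Gamma> = f"
  unfolding diff_elem_def
proof (rule the_equality)
  fix g assume g: "g \<in> topspace X \<and> (\<forall>\<Delta>\<in>dual_space X. dir_deriv euclideanreal F \<Gamma> \<Delta> = \<Delta> g)"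
  then show "g = f"
    using assms(2,3) by (intro assms(1)) auto
qed (use assms(2,3) in blast)

lemma diff_elem_G_top:
  fixes F :: "(('d::finite) hier \<Rightarrow> real) \<Rightarrow> real"
  assumes "gateaux_smooth (strong_dual (G_top N)) euclideanreal F" "\<Gamma> \<in> dual_space (G_top N)"
  shows "diff_elem (G_top N) F \<Gamma> \<in> topspace (G_top N)"
    and "\<Delta> \<in> dual_space (G_top N) \<Longrightarrow> dir_deriv euclideanreal F \<Gamma> \<Delta> = \<Delta> (diff_elem (G_top N) F \<Gamma>)"
proof -
  obtain L where L: "L \<in> dual_space (strong_dual (G_top N))"
      "\<And>\<Delta>. \<Delta> \<in> dual_space (G_top N) \<Longrightarrow> L \<Delta> = dir_deriv euclideanreal F \<Gamma> \<Delta>"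
    using dir_deriv_bidual[OF tvs_G_top assms] by blast
  obtain f where f: "f \<in> topspace (G_top N)" "\<And>\<Delta>. \<Delta> \<in> dual_space (G_top N) \<Longrightarrow> L \<Delta> = \<Delta> f"
    using G_top_reflexive[OF L(1)] by blast
  then have "diff_elem (G_top N) F \<Gamma> = f"
    using L(2) by (intro diff_elem_eqI) (auto intro: G_top_separated)
  then show "diff_elem (G_top N) F \<Gamma> \<in> topspace (G_top N)"
    and "\<Delta> \<in> dual_space (G_top N) \<Longrightarrow> dir_deriv euclideanreal F \<Gamma> \<Delta> = \<Delta> (diff_elem (G_top N) F \<Gamma>)"
    using f L(2) by auto
qed


section \<open>Symmetrisation and the marginal map\<close>

lemma depends_on_mono: "depends_on S f \<Longrightarrow> S \<subseteq> T \<Longrightarrow> depends_on T f"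
  by (auto simp: depends_on_def)

lemma depends_on_comp: "depends_on S f \<Longrightarrow> depends_on (\<pi> ` S) (\<lambda>z. f (z \<circ> \<pi>))"
  by (auto simp: depends_on_def)

text \<open>Composition with \<open>\<rho>\<close> only permutes the group over which the average is
  taken.\<close>

lemma Sym_comp:
  assumes "\<rho> permutes {1..N}"
  shows "Sym N (\<lambda>z. h (z \<circ> \<rho>)) = Sym N h"
proof
  fix z
  have "(\<Sum>\<pi> | \<pi> permutes {1..N}. h (z \<circ> \<pi>)) = (\<Sum>\<pi> | \<pi> permutes {1..N}. h (z \<circ> (\<pi> \<circ> \<rho>)))"
    by (rule sum_permutations_compose_right[OF assms])
  then show "Sym N (\<lambda>z. h (z \<circ> \<rho>)) z = Sym N h z"
    by (simp add: Sym_def comp_assoc)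
qed

lemma Sym_linear: "Sym N (\<lambda>z. c * (\<Sum>a\<in>I. f a z)) = (\<lambda>z. c * (\<Sum>a\<in>I. Sym N (f a) z))"
proof
  fix z
  have "(\<Sum>\<pi> | \<pi> permutes {1..N}. \<Sum>a\<in>I. f a (z \<circ> \<pi>)) = (\<Sum>a\<in>I. \<Sum>\<pi> | \<pi> permutes {1..N}. f a (z \<circ> \<pi>))"
    by (rule sum.swap)
  then show "Sym N (\<lambda>z. c * (\<Sum>a\<in>I. f a z)) z = c * (\<Sum>a\<in>I. Sym N (f a) z)"
    by (simp add: Sym_def sum_distrib_left[symmetric] sum_divide_distrib[symmetric])
qed

lemma Sym_add: "Sym N (f + g) = Sym N f + Sym N g"
  by (simp add: Sym_def fun_eq_iff sum.distrib add_divide_distrib)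

lemma Sym_scale: "Sym N (c *\<^sub>R f) = c *\<^sub>R Sym N f"
  by (simp add: Sym_def fun_eq_iff sum_distrib_left[symmetric])

lemma Sym_zero: "Sym N 0 = 0"
  by (simp add: Sym_def fun_eq_iff)

lemma Sym_sum: "Sym N (\<Sum>a\<in>I. f a) = (\<Sum>a\<in>I. Sym N (f a))"
  by (induction I rule: infinite_finite_induct)
    (simp_all only: sum.infinite sum.empty sum.insert Sym_zero Sym_add not_False_eq_True)

lemma Sym_sym:
  assumes "f \<in> g_space N"
  shows "Sym N f = f"
proof
  fix z
  have "(\<Sum>\<pi> | \<pi> permutes {1..N}. f (z \<circ> \<pi>)) = (\<Sum>\<pi> | \<pi> permutes {1..N}. f z)"
    using g_space_sym[OF assms] by (intro sum.cong) auto
  then show "Sym N f z = f z"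
    by (simp add: Sym_def card_permutations)
qed

lemma Sym_in_g_space:
  assumes "smooth_obs N h" "depends_on {1..N} h"
  shows "Sym N h \<in> g_space N"
  unfolding g_space_iff
proof (intro conjI allI impI)
  show "smooth_obs N (Sym N h)"
    unfolding Sym_def using assms(1)
    by (intro smooth_obs_cmult smooth_obs_sum smooth_obs_comp) auto
  show "depends_on {1..N} (Sym N h)"
    unfolding depends_on_def
  proof (intro allI impI)
    fix z z' :: "nat \<Rightarrow> 'a phase" assume z: "\<forall>i\<in>{1..N}. z i = z' i"
    have "h (z \<circ> \<pi>) = h (z' \<circ> \<pi>)" if "\<pi> permutes {1..N}" for \<pi>
      using z permutes_in_image[OF that] by (intro depends_onD[OF assms(2)]) auto
    then show "Sym N h z = Sym N h z'"
      by (simp add: Sym_def)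
  qed
  fix \<pi> and z :: "nat \<Rightarrow> 'a phase" assume "\<pi> permutes {1..N}"
  from setum_permutations_compose_left[OF this, of "\<lambda>\<sigma>. h (z \<circ> \<sigma>)"]
  show "Sym N h (z \<circ> \<pi>) = Sym N h z"
    by (simp add: Sym_def comp_assoc)
qed

lemma Sym_g_space:
  assumes "k \<le> N" "f \<in> g_space k"
  shows "Sym N f \<in> g_space N"
  using assms depends_on_mono[OF g_space_depends[OF assms(2)], of "{1..N}"]
    smooth_obs_change[OF g_space_smooth[OF assms(2)] g_space_depends[OF assms(2)]]
  by (intro Sym_in_g_space) auto

lemma iter_partial_sum:
  assumes "\<And>a. a \<in> I \<Longrightarrow> smooth_obs k (f a)" "l \<in> lists (coord_dirs k)"
  shows "iter_partial l (\<lambda>z. c * (\<Sum>a\<in>I. f a z)) = (\<lambda>z. c * (\<Sum>a\<in>I. iter_partial l (f a) z))"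
  using assms(1)
proof (induction I rule: infinite_finite_induct)
  case (insert a I)
  have "smooth_obs k (\<lambda>z. c * (\<Sum>a\<in>I. f a z))"
    using insert by (intro smooth_obs_cmult smooth_obs_sum) auto
  from iter_partial_linear[OF _ this assms(2), of "f a" c]
  have "iter_partial l (\<lambda>z. c * f a z + c * (\<Sum>a\<in>I. f a z))
      = (\<lambda>z. c * iter_partial l (f a) z + c * (\<Sum>a\<in>I. iter_partial l (f a) z))"
    using insert by simp
  then show ?case
    using insert.hyps by (simp add: distrib_left)
qed (use iter_partial_zero[of l] in \<open>simp_all add: zero_fun_def\<close>)

text \<open>Differentiating a permuted copy of \<open>f\<close> at \<open>z\<close> is
  differentiating \<open>f\<close> at \<open>z \<circ> \<pi>\<close> in relabelled directions. Hence
  \<open>K'\<close> collects all permuted copies of \<open>K\<close>, and averaging over the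
  permutations does not enlarge the bound.\<close>

lemma g_seminorm_Sym:
  assumes k: "k \<le> N" and K: "compact K" "K \<noteq> {}"
  obtains K' where "compact K'" "K' \<noteq> {}"
    "\<And>f :: ('d::finite) obs. f \<in> g_space k \<Longrightarrow> g_seminorm N K n (Sym N f) \<le> g_seminorm k K' n f"
proof -
  define K' where "K' = (\<Union>\<pi>\<in>{\<pi>. \<pi> permutes {1..N}}. (\<lambda>z. z \<circ> \<pi>) ` K)"
  have K': "compact K'" "K' \<noteq> {}"
    unfolding K'_def using K
    by (auto intro!: compact_UN compact_continuous_image finite_permutations
        continuous_on_subset[OF continuous_comp_index] intro: permutes_id)
  have "g_seminorm N K n (Sym N f) \<le> g_seminorm k K' n f" if f: "f \<in> g_space k" for f :: "'d obs"
  proof (rule g_seminorm_least[OF K(2)])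
    fix l :: "(nat \<times> 'd phase) list" and z
    assume l: "l \<in> lists (coord_dirs N)" "length l \<le> n" and z: "z \<in> K"
    have nonneg: "0 \<le> g_seminorm k K' n f"
      using K' f by (intro g.seminorm_nonneg) auto
    have smooth: "smooth_obs N (\<lambda>z. f (z \<circ> \<pi>))" if "\<pi> permutes {1..N}" for \<pi>
      using smooth_obs_change[OF g_space_smooth[OF f] g_space_depends[OF f]] that by (rule smooth_obs_comp)
    have "\<bar>iter_partial l (\<lambda>z. f (z \<circ> \<pi>)) z\<bar> \<le> g_seminorm k K' n f" if \<pi>: "\<pi> permutes {1..N}" for \<pi>
    proof -
      let ?l = "map (\<lambda>(i, b). (inv \<pi> i, b)) l"
      have eq: "iter_partial l (\<lambda>z. f (z \<circ> \<pi>)) z = iter_partial ?l f (z \<circ> \<pi>)"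
        by (simp only: iter_partial_comp[OF permutes_bij[OF \<pi>]])
      show ?thesis
      \<comment> \<open>A relabelled direction may belong to a variable beyond \<open>k\<close>,
        which the seminorm on \<open>g_space k\<close> does not see; the derivative is then
        zero.\<close>
      proof (cases "fst ` set ?l \<subseteq> {1..k}")
        case True
        have "?l \<in> lists (coord_dirs k)"
          using l(1) True by (fastforce simp: in_lists_conv_set coord_dirs_def)
        moreover have "z \<circ> \<pi> \<in> K'"
          using z \<pi> by (auto simp: K'_def)
        ultimately show ?thesis
          unfolding eq using l(2) K'(1) by (intro g_seminorm_upper g_space_smooth[OF f]) auto
      next
        case False
        then show ?thesis
          unfolding eq using iter_partial_outside[OF g_space_depends[OF f] False] nonneg by simp
      qed
    qed
    then have "(\<Sum>\<pi> | \<pi> permutes {1..N}. \<bar>iter_partial l (\<lambda>z. f (z \<circ> \<pi>)) z\<bar>) \<le> fact N * g_seminorm k K' n f"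
      using sum_bounded_above[of "{\<pi>. \<pi> permutes {1..N}}" "\<lambda>\<pi>. \<bar>iter_partial l (\<lambda>z. f (z \<circ> \<pi>)) z\<bar>"]
      by (simp add: card_permutations)
    then have "\<bar>\<Sum>\<pi> | \<pi> permutes {1..N}. iter_partial l (\<lambda>z. f (z \<circ> \<pi>)) z\<bar> \<le> fact N * g_seminorm k K' n f"
      by (rule order_trans[OF sum_abs])
    moreover have "iter_partial l (Sym N f) z
        = 1 / fact N * (\<Sum>\<pi> | \<pi> permutes {1..N}. iter_partial l (\<lambda>z. f (z \<circ> \<pi>)) z)"
      unfolding Sym_def using smooth l(1) by (subst iter_partial_sum[of _ N]) auto
    ultimately show "\<bar>iter_partial l (Sym N f) z\<bar> \<le> g_seminorm k K' n f"
      by (simp add: pos_divide_le_eq mult.commute)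
  qed
  then show ?thesis
    using that K' by blast
qed

lemma continuous_map_Sym:
  assumes "k \<le> N"
  shows "continuous_map (g_top k) (g_top N) (Sym N)"
proof (rule continuous_map_g_topI)
  fix K :: "(nat \<Rightarrow> 'a phase) set" and n and f :: "'a obs" and e :: real
  assume K: "compact K" "K \<noteq> {}" and "f \<in> topspace (g_top k)" and e: "0 < e"
  then have f: "f \<in> g_space k"
    by simp
  obtain K' where K': "compact K'" "K' \<noteq> {}"
      "\<And>f :: 'a obs. f \<in> g_space k \<Longrightarrow> g_seminorm N K n (Sym N f) \<le> g_seminorm k K' n f"
    using g_seminorm_Sym[OF assms K] by blast
  have p: "g_seminorm k K' n \<in> {g_seminorm k K n :: 'a obs \<Rightarrow> real | K n. compact K \<and> K \<noteq> {}}"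
    using K' by blast
  have "Sym N g - Sym N f = Sym N (g - f)" for g :: "'a obs"
    using Sym_add[of N "g - f" f] by simp
  then have "g_seminorm N K n (Sym N g - Sym N f) < e"
    if "g \<in> g_space k" "g_seminorm k K' n (g - f) < e" for g
    using K'(3)[OF subspace_diff[OF subspace_g_space that(1) f]] that(2) by simp
  then show "\<exists>U. openin (g_top k) U \<and> f \<in> U \<and> (\<forall>g\<in>U. g_seminorm N K n (Sym N g - Sym N f) < e)"
    using g.openin_ball[OF p f e] f e g.seminorm_zero[OF p]
    by (intro exI[of _ "{g \<in> g_space k. g_seminorm k K' n (g - f) < e}"]) (auto simp: g_top_def)
qed (use Sym_g_space[OF assms] in simp)

section \<open>The marginal map as a transpose, and its smoothness\<close>

definition Sym_total :: "nat \<Rightarrow> ('d::finite) hier \<Rightarrow> 'd obs" where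
  "Sym_total N F = (\<Sum>k=1..N. Sym N (F k))"

lemma Sym_total_add: "Sym_total N (F + G) = Sym_total N F + Sym_total N G"
  by (simp only: Sym_total_def plus_fun_apply Sym_add sum.distrib)

lemma Sym_total_scale: "Sym_total N (c *\<^sub>R F) = c *\<^sub>R Sym_total N F"
  by (simp only: Sym_total_def scaleR_fun_apply Sym_scale scaleR_sum_right)

lemma continuous_map_Sym_total: "continuous_map (G_top N) (g_top N) (Sym_total N)"
proof -
  have "continuous_map (G_top N) (g_top N) (\<lambda>F. Sym N (F k))" if "k \<in> {1..N}" for k
    using continuous_map_compose[OF continuous_map_G_proj[OF that] continuous_map_Sym, of N] that
    by (simp add: o_def)
  then show ?thesis
    unfolding Sym_total_def[abs_def] g_top_def
    by (intro g.continuous_map_sum) auto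
qed

lemma Sym_total_in_g_space: "F \<in> topspace (G_top N) \<Longrightarrow> Sym_total N F \<in> g_space N"
  using continuous_map_Sym_total[of N] by (auto simp: continuous_map_def)

lemma iota_mar_eq_transpose:
  assumes \<gamma>: "\<gamma> \<in> dual_space (g_top N)"
  shows "iota_mar N \<gamma> = transpose_map (G_top N) (Sym_total N) \<gamma>"
proof
  fix F :: "'a hier"
  show "iota_mar N \<gamma> F = transpose_map (G_top N) (Sym_total N) \<gamma> F"
  proof (cases "F \<in> topspace (G_top N)")
    case True
    note F = topspace_G_topD(1)[OF True]
    \<comment> \<open>\<open>marginal\<close> omits the symmetrisation for \<open>k = N\<close>;
      there \<open>Sym N\<close> acts as the identity.\<close>
    have "marginal N k \<gamma> (F k) = \<gamma> (Sym N (F k))" if "k \<in> {1..N}" for k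
      using F[OF that] Sym_sym[of "F k" N] by (auto simp: marginal_def)
    then have "iota_mar N \<gamma> F = (\<Sum>k=1..N. \<gamma> (Sym N (F k)))"
      using True by (simp add: iota_mar_def of_components_def)
    also have "\<dots> = \<gamma> (Sym_total N F)"
      unfolding Sym_total_def using F
      by (intro dual_sum[symmetric, OF tvs_g_top \<gamma>]) (auto intro: Sym_g_space)
    finally show ?thesis
      using True by (simp add: transpose_map_def)
  next
    case False
    then show ?thesis
      by (simp add: iota_mar_def of_components_def transpose_map_def)
  qed
qed

lemma iota_mar_dual: "\<gamma> \<in> dual_space (g_top N) \<Longrightarrow> iota_mar N \<gamma> \<in> dual_space (G_top N)"
  by (simp add: iota_mar_eq_transpose transpose_map_dual[OF tvs_G_top tvs_g_top continuous_map_Sym_total]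
      Sym_total_add Sym_total_scale)

lemma iota_mar_affine:
  assumes "\<gamma> \<in> dual_space (g_top N)" "\<delta> \<in> dual_space (g_top N)"
  shows "iota_mar N (\<gamma> + t *\<^sub>R \<delta>) = iota_mar N \<gamma> + t *\<^sub>R iota_mar N \<delta>"
  using assms dual_space_add[OF assms(1) dual_space_scale[OF assms(2)]]
  by (simp only: iota_mar_eq_transpose transpose_map_add transpose_map_scale)

lemma continuous_iota_mar: "continuous_map (strong_dual (g_top N)) (strong_dual (G_top N)) (iota_mar N)"
  by (rule continuous_map_eq[OF continuous_transpose_map[OF tvs_G_top tvs_g_top continuous_map_Sym_total]])
    (simp_all add: Sym_total_add Sym_total_scale iota_mar_eq_transpose topspace_strong_dual_tvs[OF tvs_g_top])

text \<open>The map is linear: its first derivative is the map itself, and all higher derivatives vanish.\<close>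

lemma gateaux_smooth_iota_mar:
  "gateaux_smooth (strong_dual (g_top N)) (strong_dual (G_top N))
     (iota_mar N :: (('d::finite) obs \<Rightarrow> real) \<Rightarrow> ('d hier \<Rightarrow> real))"
proof -
  let ?i = "iota_mar N :: ('d obs \<Rightarrow> real) \<Rightarrow> ('d hier \<Rightarrow> real)"
  let ?Y = "strong_dual (G_top N) :: ('d hier \<Rightarrow> real) topology"
  let ?V = "dual_space (g_top N) :: ('d obs \<Rightarrow> real) set"
  have TX: "topspace (strong_dual (g_top N)) = ?V" and TY: "topspace ?Y = dual_space (G_top N)"
    by (rule topspace_strong_dual_tvs[OF tvs_g_top], rule topspace_strong_dual_tvs[OF tvs_G_top])
  have zero: "0 \<in> topspace ?Y"
    unfolding TY by (rule subspace_0[OF subspace_dual])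
  \<comment> \<open>The order-one value depends on the direction \<open>w 1\<close> and no longer on
    the base point \<open>w 0\<close>, which is why zero follows from order two on.\<close>
  define D where "D = (\<lambda>(m::nat) (w::nat \<Rightarrow> 'd obs \<Rightarrow> real). if m = 0 then ?i (w 0) else if m = 1 then ?i (w 1) else (0 :: 'd hier \<Rightarrow> real))"
  \<comment> \<open>The formula at order \<open>m\<close> is a premise here, so that the limit
    serves both the induction for the formula and the existence of every derivative
    afterwards.\<close>
  have lim: "limitin ?Y (\<lambda>t::real. (iter_deriv ?Y ?i m (w(0 := w 0 + t *\<^sub>R w (Suc m)))
        - iter_deriv ?Y ?i m (w(0 := w 0))) /\<^sub>R t) (D (Suc m) w) (at 0)"
    if IH: "\<And>w. \<forall>i\<le>m. w i \<in> ?V \<Longrightarrow> iter_deriv ?Y ?i m w = D m w" and w: "\<forall>i\<le>Suc m. w i \<in> ?V" for m w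
  proof (rule limitin_affine[where F = "\<lambda>x. iter_deriv ?Y ?i m (w(0 := x))"])
    show "D (Suc m) w \<in> topspace ?Y"
      using w zero iota_mar_dual by (auto simp: D_def TY)
    fix t
    have w0: "w 0 \<in> ?V" "w (Suc m) \<in> ?V" "w 0 + t *\<^sub>R w (Suc m) \<in> ?V"
      using w dual_space_add dual_space_scale by blast+
    have *: "iter_deriv ?Y ?i m (w(0 := x)) = D m (w(0 := x))" if "x \<in> ?V" for x
      using w that by (intro IH) auto
    then show "iter_deriv ?Y ?i m (w(0 := w 0 + t *\<^sub>R w (Suc m)))
        = iter_deriv ?Y ?i m (w(0 := w 0)) + t *\<^sub>R D (Suc m) w"
      unfolding *[OF w0(1)] *[OF w0(3)]
      using iota_mar_affine[OF w0(1,2), of t] by (cases "m = 0") (simp_all add: D_def)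
  qed
  have iter: "iter_deriv ?Y ?i m w = D m w" if "\<forall>i\<le>m. w i \<in> ?V" for m w
    using that
  proof (induction m arbitrary: w)
    case (Suc m)
    show ?case
      unfolding iter_deriv.simps
      by (rule dir_deriv_eqI[OF Hausdorff_strong_dual[OF tvs_G_top],
            where F = "\<lambda>x. iter_deriv ?Y ?i m (w(0 := x))"], rule lim)
        (use Suc in blast)+
  qed (simp add: D_def)
  show ?thesis
    unfolding gateaux_smooth_def
  proof (intro conjI allI impI)
    fix m
    have "continuous_map (product_topology (\<lambda>_. strong_dual (g_top N)) {..m}) ?Y (D m)"
    proof -
      have proj: "continuous_map (product_topology (\<lambda>_. strong_dual (g_top N)) {..m}) ?Y (\<lambda>w. ?i (w j))"
        if "j \<le> m" for j
        using continuous_map_compose[OF continuous_map_product_projection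
            [of j "{..m}" "\<lambda>_. strong_dual (g_top N)"] continuous_iota_mar] that
        by (simp add: o_def)
      consider "m = 0" | "m = 1" | "m > 1"
        by linarith
      then show ?thesis
      proof cases
        case 1
        then show ?thesis
          using proj[of 0] by (simp add: D_def)
      next
        case 2
        then show ?thesis
          using proj[of 1] by (simp add: D_def)
      next
        case 3
        then have "D m = (\<lambda>_. 0)"
          by (simp add: D_def)
        then show ?thesis
          using zero by (simp only: continuous_map_const) simp
      qed
    qed
    then show "continuous_map (product_topology (\<lambda>_. strong_dual (g_top N)) {..m}) ?Y (iter_deriv ?Y ?i m)"
      by (rule continuous_map_eq) (auto simp: TX PiE_def Pi_def intro!: iter[symmetric])
  next
    fix m and w :: "nat \<Rightarrow> 'd obs \<Rightarrow> real"
    assume "\<forall>i\<le>Suc m. w i \<in> topspace (strong_dual (g_top N))"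
    then show "has_dir_deriv ?Y (\<lambda>x. iter_deriv ?Y ?i m (w(0 := x))) (w 0) (w (Suc m))"
      unfolding has_dir_deriv_def using lim[OF iter] TX by blast
  qed
qed

section \<open>Averages over injective tuples\<close>

text \<open>The complements of \<open>A\<close> and \<open>B\<close> in the finite set
  \<open>S\<close> have equal size, so any bijection between them completes
  \<open>g\<close>.\<close>

lemma extend_bij_betw_to_permutation:
  assumes "finite S" "A \<subseteq> S" "B \<subseteq> S" "bij_betw g A B"
  obtains \<tau> where "\<tau> permutes S" "\<And>x. x \<in> A \<Longrightarrow> \<tau> x = g x"
proof -
  have "card (S - A) = card (S - B)"
    using assms bij_betw_same_card[OF assms(4)] by (simp add: card_Diff_subset finite_subset)
  then obtain h where h: "bij_betw h (S - A) (S - B)"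
    using assms(1) finite_same_card_bij[of "S - A" "S - B"] by auto
  define \<tau> where "\<tau> = (\<lambda>x. if x \<in> A then g x else if x \<in> S then h x else x)"
  have "bij_betw \<tau> A B"
    using assms(4) by (rule bij_betw_cong[THEN iffD1, rotated]) (simp add: \<tau>_def)
  moreover have "bij_betw \<tau> (S - A) (S - B)"
    using h by (rule bij_betw_cong[THEN iffD1, rotated]) (simp add: \<tau>_def)
  ultimately have "bij_betw \<tau> (A \<union> (S - A)) (B \<union> (S - B))"
    by (rule bij_betw_combine) blast
  moreover have "A \<union> (S - A) = S" "B \<union> (S - B) = S"
    using assms(2,3) by auto
  ultimately have "\<tau> permutes S"
    using assms(2) by (intro bij_imp_permutes) (auto simp: \<tau>_def)
  then show ?thesis
    using that by (simp add: \<tau>_def)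
qed

text \<open>Restricting permutations to \<open>{1..k}\<close> gives the injective tuples, with fibres of equal size.\<close>

lemma eps_eq_Sym:
  assumes k: "k \<le> N" and f: "f \<in> g_space k"
  shows "eps k N f = Sym N f"
proof
  fix z
  define P where "P = {\<pi>. \<pi> permutes {1..N}}"
  define T where "T = distinct_tuples k N"
  define r where "r = (\<lambda>\<pi>::nat \<Rightarrow> nat. restrict \<pi> {1..k})"
  define c where "c = card {\<pi> \<in> P. \<forall>i\<in>{1..k}. \<pi> i = i}"
  have P: "finite P"
    by (simp add: P_def finite_permutations)
  have T: "finite T"
    unfolding T_def distinct_tuples_def by (rule finite_subset[of _ "{1..k} \<rightarrow>\<^sub>E {1..N}"]) (auto intro: finite_PiE)
  have rT: "r ` P \<subseteq> T"
  proof (rule image_subsetI)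
    fix \<pi> assume "\<pi> \<in> P"
    then have \<pi>: "\<pi> permutes {1..N}"
      by (simp add: P_def)
    have "\<pi> i \<in> {1..N}" if "i \<in> {1..k}" for i
      using permutes_in_image[OF \<pi>, of i] that k by auto
    then have "r \<pi> \<in> {1..k} \<rightarrow>\<^sub>E {1..N}"
      unfolding r_def by (simp only: restrict_PiE_iff) blast
    moreover have "inj_on (r \<pi>) {1..k}"
      unfolding r_def inj_on_restrict_eq by (rule permutes_inj_on[OF \<pi>])
    ultimately show "r \<pi> \<in> T"
      unfolding T_def distinct_tuples_def by blast
  qed
  have fibre: "card {\<pi> \<in> P. r \<pi> = j} = c" if "j \<in> T" for j
  proof -
    have j: "j \<in> {1..k} \<rightarrow>\<^sub>E {1..N}" "inj_on j {1..k}"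
      using that by (auto simp: T_def distinct_tuples_def)
    obtain \<tau> where \<tau>: "\<tau> permutes {1..N}" "\<And>i. i \<in> {1..k} \<Longrightarrow> \<tau> i = j i"
      by (rule extend_bij_betw_to_permutation[of "{1..N}" "{1..k}" "j ` {1..k}" j])
        (use k j in \<open>auto simp: bij_betw_def PiE_def Pi_def\<close>)
    \<comment> \<open>The fibre over \<open>j\<close> is the coset, by an extension
      \<open>\<tau>\<close> of \<open>j\<close>, of the permutations that fix \<open>{1..k}\<close>
      pointwise.\<close>
    have "bij_betw (\<lambda>\<sigma>. \<tau> \<circ> \<sigma>) {\<pi> \<in> P. \<forall>i\<in>{1..k}. \<pi> i = i} {\<pi> \<in> P. r \<pi> = j}"
    proof (rule bij_betwI[where g = "\<lambda>\<pi>. inv \<tau> \<circ> \<pi>"])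
      show "(\<lambda>\<sigma>. \<tau> \<circ> \<sigma>) \<in> {\<pi> \<in> P. \<forall>i\<in>{1..k}. \<pi> i = i} \<rightarrow> {\<pi> \<in> P. r \<pi> = j}"
        using \<tau> PiE_arb[OF j(1)] by (auto simp: P_def r_def fun_eq_iff restrict_def intro: permutes_compose)
      show "(\<lambda>\<pi>. inv \<tau> \<circ> \<pi>) \<in> {\<pi> \<in> P. r \<pi> = j} \<rightarrow> {\<pi> \<in> P. \<forall>i\<in>{1..k}. \<pi> i = i}"
      proof (rule funcsetI)
        fix \<pi> assume "\<pi> \<in> {\<pi> \<in> P. r \<pi> = j}"
        then have \<pi>: "\<pi> permutes {1..N}" "r \<pi> = j"
          by (auto simp: P_def)
        have "\<pi> i = \<tau> i" if "i \<in> {1..k}" for i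
          using \<tau>(2)[OF that] that \<pi>(2) by (auto simp: r_def)
        then show "inv \<tau> \<circ> \<pi> \<in> {\<pi> \<in> P. \<forall>i\<in>{1..k}. \<pi> i = i}"
          using \<pi>(1) permutes_inverses(2)[OF \<tau>(1)] permutes_inv[OF \<tau>(1)]
          by (auto simp: P_def intro: permutes_compose)
      qed
    qed (use permutes_inverses[OF \<tau>(1)] in \<open>auto simp: fun_eq_iff\<close>)
    then show ?thesis
      by (simp add: c_def bij_betw_same_card)
  qed
  have "(\<Sum>\<pi>\<in>P. f (z \<circ> \<pi>)) = (\<Sum>\<pi>\<in>P. f (z \<circ> r \<pi>))"
    by (intro sum.cong refl depends_onD[OF g_space_depends[OF f]]) (simp add: r_def)
  also have "\<dots> = (\<Sum>j\<in>T. \<Sum>\<pi>\<in>{\<pi> \<in> P. r \<pi> = j}. f (z \<circ> r \<pi>))"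
    by (rule sum.group[OF P T rT, symmetric])
  also have "\<dots> = (\<Sum>j\<in>T. real c * f (z \<circ> j))"
    by (intro sum.cong) (simp_all add: fibre)
  finally have sum: "(\<Sum>\<pi>\<in>P. f (z \<circ> \<pi>)) = real c * (\<Sum>j\<in>T. f (z \<circ> j))"
    by (simp add: sum_distrib_left)
  have "(\<Sum>j\<in>T. c) = (\<Sum>j\<in>T. \<Sum>\<pi>\<in>{\<pi> \<in> P. r \<pi> = j}. 1)"
    by (intro sum.cong) (simp_all add: fibre)
  also have "\<dots> = (\<Sum>\<pi>\<in>P. 1)"
    by (rule sum.group[OF P T rT])
  finally have "c * card T = fact N"
    by (simp add: card_permutations P_def mult.commute)
  then have fact_N: "fact N = real c * real (card T)"
    by (metis of_nat_fact of_nat_mult)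
  have "real c * real (card T) \<noteq> 0"
    unfolding fact_N[symmetric] by simp
  then have "1 / real (card T) = real c / fact N"
    unfolding fact_N by simp
  then show "eps k N f z = Sym N f z"
    using sum by (simp add: eps_def Sym_def P_def T_def)
qed


section \<open>The bracket of symmetrised observables\<close>

lemma coord_dirs_axis:
  assumes "i \<in> {1..k}"
  shows "(i, (axis c 1, 0)) \<in> coord_dirs k" "(i, (0, axis c 1)) \<in> coord_dirs k"
  using assms by (auto simp: coord_dirs_def Basis_prod_def axis_in_Basis_iff)

lemma g_bracket_apply:
  "g_bracket k f g = (\<lambda>z. real k * (\<Sum>i=1..k. \<Sum>c\<in>UNIV.
     partial i (axis c 1, 0) f z * partial i (0, axis c 1) g z
     - partial i (0, axis c 1) f z * partial i (axis c 1, 0) g z))"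
  by (simp add: g_bracket_def grad_x_def grad_v_def inner_vec_def sum_subtractf fun_eq_iff)

lemma smooth_obs_bracket:
  assumes "smooth_obs k f" "smooth_obs k g"
  shows "smooth_obs k (g_bracket k f g)"
  unfolding g_bracket_apply
  by (intro smooth_obs_cmult smooth_obs_sum smooth_obs_diff smooth_obs_mult smooth_obs_partial
      coord_dirs_axis assms)

lemma depends_on_bracket:
  assumes "depends_on S f" "depends_on S g"
  shows "depends_on S (g_bracket k f g)"
  unfolding depends_on_def
proof (intro allI impI)
  fix z z' :: "nat \<Rightarrow> 'a phase" assume "\<forall>i\<in>S. z i = z' i"
  then have "partial i b f z = partial i b f z'" "partial i b g z = partial i b g z'" for i b
    using depends_onD[OF depends_on_partial[OF assms(1)]] depends_onD[OF depends_on_partial[OF assms(2)]]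
    by blast+
  then show "g_bracket k f g z = g_bracket k f g z'"
    by (simp only: g_bracket_apply)
qed

text \<open>Relabelling the variables permutes the summands of the bracket, leaving the sum
  unchanged.\<close>

lemma g_bracket_comp:
  assumes "\<pi> permutes {1..k}"
  shows "g_bracket k (\<lambda>z. f (z \<circ> \<pi>)) (\<lambda>z. g (z \<circ> \<pi>)) = (\<lambda>z. g_bracket k f g (z \<circ> \<pi>))"
proof
  fix z
  let ?h = "\<lambda>i. \<Sum>c\<in>UNIV. partial i (axis c 1, 0) f (z \<circ> \<pi>) * partial i (0, axis c 1) g (z \<circ> \<pi>)
     - partial i (0, axis c 1) f (z \<circ> \<pi>) * partial i (axis c 1, 0) g (z \<circ> \<pi>)"
  have "g_bracket k (\<lambda>z. f (z \<circ> \<pi>)) (\<lambda>z. g (z \<circ> \<pi>)) z = real k * (\<Sum>i=1..k. ?h (inv \<pi> i))"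
    unfolding g_bracket_apply partial_comp[OF permutes_bij[OF assms]] ..
  also have "(\<Sum>i=1..k. ?h (inv \<pi> i)) = (\<Sum>i=1..k. ?h i)"
    using sum.permute[OF permutes_inv[OF assms], of ?h] by (simp only: o_def)
  finally show "g_bracket k (\<lambda>z. f (z \<circ> \<pi>)) (\<lambda>z. g (z \<circ> \<pi>)) z = g_bracket k f g (z \<circ> \<pi>)"
    by (simp only: g_bracket_apply)
qed

lemma g_bracket_flip: "g_bracket k f g = (\<lambda>z. (- 1) * g_bracket k g f z)"
proof
  fix z
  have "(\<Sum>i=1..k. grad_x i f z \<bullet> grad_v i g z - grad_v i f z \<bullet> grad_x i g z)
      = - (\<Sum>i=1..k. grad_x i g z \<bullet> grad_v i f z - grad_v i g z \<bullet> grad_x i f z)"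
    unfolding sum_negf[symmetric] by (intro sum.cong) (simp_all add: inner_commute)
  then show "g_bracket k f g z = (- 1) * g_bracket k g f z"
    by (simp add: g_bracket_def)
qed

lemma g_bracket_linear:
  assumes "smooth_obs k f" "smooth_obs k h"
  shows "g_bracket k (\<lambda>z. c * f z + h z) g = (\<lambda>z. c * g_bracket k f g z + g_bracket k h g z)"
proof
  fix z
  let ?t = "\<lambda>f i a. partial i (axis a 1, 0) f z * partial i (0, axis a 1) g z
     - partial i (0, axis a 1) f z * partial i (axis a 1, 0) g z"
  have p: "partial i b (\<lambda>z. c * f z + h z) z = c * partial i b f z + partial i b h z"
    if "(i, b) \<in> coord_dirs k" for i b
    using iter_partial_linear[OF assms, of "[(i, b)]" c] that by simp
  have "?t (\<lambda>z. c * f z + h z) i a = c * ?t f i a + ?t h i a" if "i \<in> {1..k}" for i a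
    unfolding p[OF coord_dirs_axis(1)[OF that]] p[OF coord_dirs_axis(2)[OF that]]
    by (simp add: algebra_simps)
  then have "(\<Sum>i=1..k. \<Sum>a\<in>UNIV. ?t (\<lambda>z. c * f z + h z) i a)
      = c * (\<Sum>i=1..k. \<Sum>a\<in>UNIV. ?t f i a) + (\<Sum>i=1..k. \<Sum>a\<in>UNIV. ?t h i a)"
    by (simp add: sum.distrib sum_distrib_left)
  then show "g_bracket k (\<lambda>z. c * f z + h z) g z = c * g_bracket k f g z + g_bracket k h g z"
    unfolding g_bracket_apply by (simp only: distrib_left mult.left_commute)
qed

lemma g_bracket_zero: "g_bracket k (\<lambda>_. 0) g = (\<lambda>_. 0)"
  by (simp add: g_bracket_apply partial_def)

text \<open>The factor \<open>c\<close> in front of the sum matches the shape of \<open>Sym\<close>,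
  to which the lemma is applied.\<close>

lemma g_bracket_sum_left:
  assumes "\<And>a. a \<in> I \<Longrightarrow> smooth_obs k (f a)"
  shows "g_bracket k (\<lambda>z. c * (\<Sum>a\<in>I. f a z)) g = (\<lambda>z. c * (\<Sum>a\<in>I. g_bracket k (f a) g z))"
  using assms
proof (induction I rule: infinite_finite_induct)
  case (insert a I)
  have "smooth_obs k (\<lambda>z. c * (\<Sum>a\<in>I. f a z))"
    using insert by (intro smooth_obs_cmult smooth_obs_sum) auto
  from g_bracket_linear[OF _ this, of "f a" c g]
  have "g_bracket k (\<lambda>z. c * f a z + c * (\<Sum>a\<in>I. f a z)) g
      = (\<lambda>z. c * g_bracket k (f a) g z + c * (\<Sum>a\<in>I. g_bracket k (f a) g z))"
    using insert by simp
  then show ?case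
    using insert.hyps by (simp add: distrib_left)
qed (simp_all add: g_bracket_zero)

lemma g_bracket_sum_right:
  assumes "\<And>a. a \<in> I \<Longrightarrow> smooth_obs k (f a)"
  shows "g_bracket k g (\<lambda>z. c * (\<Sum>a\<in>I. f a z)) = (\<lambda>z. c * (\<Sum>a\<in>I. g_bracket k g (f a) z))"
proof -
  have "g_bracket k g (\<lambda>z. c * (\<Sum>a\<in>I. f a z)) = (\<lambda>z. (- 1) * (c * (\<Sum>a\<in>I. g_bracket k (f a) g z)))"
    using g_bracket_flip[of k g "\<lambda>z. c * (\<Sum>a\<in>I. f a z)"] g_bracket_sum_left[of I k f c g] assms
    by simp
  also have "\<dots> = (\<lambda>z. c * (\<Sum>a\<in>I. (- 1) * g_bracket k (f a) g z))"
    by (simp add: sum_negf)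
  also have "\<dots> = (\<lambda>z. c * (\<Sum>a\<in>I. g_bracket k g (f a) z))"
    unfolding g_bracket_flip[of k g] ..
  finally show ?thesis .
qed

lemma g_space_smooth_depends_larger:
  assumes "l \<le> N" "f \<in> g_space l"
  shows "smooth_obs N f" "depends_on {1..N} f"
  using smooth_obs_change[OF g_space_smooth[OF assms(2)] g_space_depends[OF assms(2)]]
    depends_on_mono[OF g_space_depends[OF assms(2)]] assms(1) by auto

text \<open>
  Each term of the bracket involves \<open>f\<close> and a permuted copy of \<open>g\<close>. It vanishes unless their sets of
  variables overlap, and otherwise it depends on at most \<open>l + j - 1\<close> variables, which a permutation
  moves to the first positions.
\<close>

lemma bracket_term_Sym:
  assumes l: "l \<le> N" "f \<in> g_space l" and j: "j \<le> N" "g \<in> g_space j"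
    and \<sigma>: "\<sigma> permutes {1..N}"
  shows "\<exists>u. smooth_obs N u \<and> depends_on {1..min (l + j - 1) N} u \<and>
    Sym N u = Sym N (g_bracket N f (\<lambda>z. g (z \<circ> \<sigma>)))"
proof -
  let ?h = "g_bracket N f (\<lambda>z. g (z \<circ> \<sigma>))"
  let ?A = "{1..l}" and ?B = "\<sigma> ` {1..j}"
  have g\<sigma>: "smooth_obs N (\<lambda>z. g (z \<circ> \<sigma>))"
    by (rule smooth_obs_comp[OF g_space_smooth_depends_larger(1)[OF j] \<sigma>])
  have h: "smooth_obs N ?h"
    by (rule smooth_obs_bracket[OF g_space_smooth_depends_larger(1)[OF l] g\<sigma>])
  have df: "depends_on ?A f" and dg: "depends_on ?B (\<lambda>z. g (z \<circ> \<sigma>))"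
    using g_space_depends[OF l(2)] depends_on_comp[OF g_space_depends[OF j(2)]] by auto
  have dh: "depends_on (?A \<union> ?B) ?h"
    by (intro depends_on_bracket depends_on_mono[OF df] depends_on_mono[OF dg]) auto
  show ?thesis
  proof (cases "?A \<inter> ?B = {}")
    case True
    have *: "partial i b f z * partial i b' (\<lambda>z. g (z \<circ> \<sigma>)) z = 0" for i b b' z
    proof (cases "i \<in> ?A")
      case True
      then have "i \<notin> ?B"
        using \<open>?A \<inter> ?B = {}\<close> by blast
      from partial_outside[OF dg this] show ?thesis
        by (simp only: zero_fun_apply mult_zero_right)
    next
      case False
      from partial_outside[OF df this] show ?thesis
        by (simp only: zero_fun_apply mult_zero_left)
    qed
    have "?h = (\<lambda>_. 0)"
      by (simp only: g_bracket_apply * diff_self sum.neutral_const mult_zero_right)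
    then show ?thesis
      using h by (intro exI[of _ ?h]) (simp add: depends_on_def)
  next
    case False
    have AB: "?A \<union> ?B \<subseteq> {1..N}"
      using l(1) j(1) permutes_in_image[OF \<sigma>] by fastforce
    \<comment> \<open>The overlap has at least one element, which accounts for the subtracted 1; the
      bound by \<open>N\<close> comes from \<open>AB\<close>.\<close>
    have "card (?A \<union> ?B) + card (?A \<inter> ?B) = l + j"
      using card_Un_Int[of ?A ?B] card_image[OF permutes_inj_on[OF \<sigma>], of "{1..j}"] by simp
    moreover have "card (?A \<inter> ?B) > 0"
      using False by (simp add: card_gt_0_iff)
    moreover have "card (?A \<union> ?B) \<le> N"
      using card_mono[OF _ AB] by simp
    ultimately have card: "card (?A \<union> ?B) \<le> min (l + j - 1) N"
      by simp
    obtain \<beta> where \<beta>: "bij_betw \<beta> (?A \<union> ?B) {1..card (?A \<union> ?B)}"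
      using finite_same_card_bij[of "?A \<union> ?B" "{1..card (?A \<union> ?B)}"] by auto
    obtain \<rho> where \<rho>: "\<rho> permutes {1..N}" "\<And>i. i \<in> ?A \<union> ?B \<Longrightarrow> \<rho> i = \<beta> i"
      by (rule extend_bij_betw_to_permutation[OF _ AB _ \<beta>]) (use card in auto)
    have "\<rho> ` (?A \<union> ?B) = {1..card (?A \<union> ?B)}"
      using \<rho>(2) bij_betw_imp_surj_on[OF \<beta>] by (metis image_cong)
    \<comment> \<open>Composition with \<open>\<rho>\<close> carries the variables to an initial
      segment, while \<open>Sym N\<close> does not notice it.\<close>
    then have "depends_on {1..min (l + j - 1) N} (\<lambda>z. ?h (z \<circ> \<rho>))"
      using depends_on_mono[OF depends_on_comp[OF dh, of \<rho>]] card by simp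
    then show ?thesis
      using smooth_obs_comp[OF h \<rho>(1)] Sym_comp[OF \<rho>(1), of ?h]
      by (intro exI[of _ "\<lambda>z. ?h (z \<circ> \<rho>)"]) simp
  qed
qed

text \<open>Permutations of \<open>{1..k}\<close> are permutations of \<open>{1..N}\<close>, so the
  larger average absorbs the smaller.\<close>

lemma Sym_Sym:
  assumes "k \<le> N"
  shows "Sym N (Sym k u) = Sym N u"
proof -
  have "Sym N (\<lambda>z. u (z \<circ> \<tau>)) = Sym N u" if "\<tau> permutes {1..k}" for \<tau>
    using assms by (intro Sym_comp permutes_subset[OF that]) auto
  then have "Sym N (Sym k u) = (\<lambda>z. 1 / fact k * (\<Sum>\<tau> | \<tau> permutes {1..k}. Sym N u z))"
    unfolding Sym_def[of k] Sym_linear by simp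
  then show ?thesis
    by (simp add: card_permutations)
qed

text \<open>This is what makes \<open>G_bracket\<close> well defined: the bracket of two embedded
  observables is itself embedded from level \<open>min (l + j - 1) N\<close>.\<close>

lemma bracket_Sym:
  assumes l: "l \<le> N" "f \<in> g_space l" and j: "j \<le> N" "g \<in> g_space j"
  shows "\<exists>u\<in>g_space (min (l + j - 1) N). Sym N u = g_bracket N (Sym N f) (Sym N g)"
proof -
  let ?k = "min (l + j - 1) N"
  let ?P = "{\<pi>. \<pi> permutes {1..N}}"
  let ?h = "\<lambda>\<sigma>. g_bracket N f (\<lambda>z. g (z \<circ> \<sigma>))"
  have f: "smooth_obs N f" and g: "smooth_obs N g"
    using g_space_smooth_depends_larger l j by blast+
  have "g_bracket N (\<lambda>z. f (z \<circ> \<pi>)) (Sym N g) = (\<lambda>z. g_bracket N f (Sym N g) (z \<circ> \<pi>))"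
    if "\<pi> \<in> ?P" for \<pi>
  proof -
    have "(\<lambda>z. Sym N g (z \<circ> \<pi>)) = Sym N g"
      using g_space_sym[OF Sym_g_space[OF j]] that by blast
    then show ?thesis
      using g_bracket_comp[of \<pi> N f "Sym N g"] that by simp
  qed
  \<comment> \<open>As \<open>Sym N g\<close> is invariant, a permutation of \<open>f\<close> alone
    is a permutation of the whole bracket, and the outer average moves outside.\<close>
  then have "g_bracket N (Sym N f) (Sym N g) = Sym N (g_bracket N f (Sym N g))"
    unfolding Sym_def[of N f] Sym_def[of N "g_bracket N f (Sym N g)"]
    using smooth_obs_comp[OF f] by (subst g_bracket_sum_left) auto
  also have "g_bracket N f (Sym N g) = (\<lambda>z. 1 / fact N * (\<Sum>\<sigma>\<in>?P. ?h \<sigma> z))"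
    unfolding Sym_def using smooth_obs_comp[OF g] by (intro g_bracket_sum_right) auto
  also have "Sym N \<dots> = (\<lambda>z. 1 / fact N * (\<Sum>\<sigma>\<in>?P. Sym N (?h \<sigma>) z))"
    by (rule Sym_linear)
  finally have eq: "g_bracket N (Sym N f) (Sym N g) = (\<lambda>z. 1 / fact N * (\<Sum>\<sigma>\<in>?P. Sym N (?h \<sigma>) z))" .
  have "\<forall>\<sigma>\<in>?P. \<exists>u. smooth_obs N u \<and> depends_on {1..?k} u \<and> Sym N u = Sym N (?h \<sigma>)"
    using bracket_term_Sym[OF l j] by blast
  then obtain u where u: "\<And>\<sigma>. \<sigma> \<in> ?P \<Longrightarrow> smooth_obs N (u \<sigma>)"
      "\<And>\<sigma>. \<sigma> \<in> ?P \<Longrightarrow> depends_on {1..?k} (u \<sigma>)" "\<And>\<sigma>. \<sigma> \<in> ?P \<Longrightarrow> Sym N (u \<sigma>) = Sym N (?h \<sigma>)"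
    by metis
  define w where "w = (\<lambda>z. 1 / fact N * (\<Sum>\<sigma>\<in>?P. u \<sigma> z))"
  have "Sym N w = g_bracket N (Sym N f) (Sym N g)"
    unfolding w_def Sym_linear eq using u(3) by simp
  \<comment> \<open>\<open>w\<close> has the right variables but need not be symmetric in them;
    \<open>Sym ?k\<close> repairs this without changing the image under
    \<open>Sym N\<close>.\<close>
  moreover have "Sym N (Sym ?k w) = Sym N w"
    by (rule Sym_Sym) simp
  moreover have "Sym ?k w \<in> g_space ?k"
  proof (rule Sym_in_g_space)
    show w: "depends_on {1..?k} w"
      unfolding depends_on_def
    proof (intro allI impI)
      fix z z' :: "nat \<Rightarrow> 'a phase" assume "\<forall>i\<in>{1..?k}. z i = z' i"
      then have "u \<sigma> z = u \<sigma> z'" if "\<sigma> \<in> ?P" for \<sigma>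
        using depends_onD[OF u(2)[OF that]] by blast
      then show "w z = w z'"
        by (simp add: w_def)
    qed
    have "smooth_obs N w"
      unfolding w_def using u(1) by (intro smooth_obs_cmult smooth_obs_sum)
    moreover have "depends_on {1..N} w"
      by (rule depends_on_mono[OF w]) simp
    ultimately show "smooth_obs ?k w"
      by (rule smooth_obs_change)
  qed
  ultimately show ?thesis
    by (intro bexI[of _ "Sym ?k w"]) simp_all
qed

text \<open>Once the sum is known to lie in the image of \<open>eps k N\<close>,
  \<open>inv_into\<close> returns a genuine preimage, and \<open>eps k N\<close>, which acts as
  \<open>Sym N\<close>, recovers the sum.\<close>

lemma
  fixes F G :: "('d::finite) hier"
  assumes F: "F \<in> topspace (G_top N)" and G: "G \<in> topspace (G_top N)" and k: "k \<in> {1..N}"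
  shows G_bracket_in_g_space: "G_bracket N F G k \<in> g_space k"
    and Sym_G_bracket: "Sym N (G_bracket N F G k) =
      (\<Sum>(l, j) \<in> {(l, j). l \<in> {1..N} \<and> j \<in> {1..N} \<and> min (l + j - 1) N = k}.
         g_bracket N (Sym N (F l)) (Sym N (G j)))"
proof -
  define I where "I = {(l, j). l \<in> {1..N} \<and> j \<in> {1..N} \<and> min (l + j - 1) N = k}"
  define b where "b = (\<lambda>(l, j). g_bracket N (Sym N (F l)) (Sym N (G j)))"
  note FG = topspace_G_topD(1)[OF F] topspace_G_topD(1)[OF G]
  have "\<exists>u\<in>g_space k. Sym N u = b x" if "x \<in> I" for x
    using bracket_Sym[of "fst x" N "F (fst x)" "snd x" "G (snd x)"] that FG
    by (auto simp: I_def b_def case_prod_beta)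
  then obtain u where u: "\<And>x. x \<in> I \<Longrightarrow> u x \<in> g_space k" "\<And>x. x \<in> I \<Longrightarrow> Sym N (u x) = b x"
    by metis
  have v: "(\<Sum>x\<in>I. u x) \<in> g_space k"
    by (intro subspace_sum subspace_g_space u(1))
  have "Sym N (\<Sum>x\<in>I. u x) = (\<Sum>x\<in>I. Sym N (u x))"
    by (rule Sym_sum)
  also have "\<dots> = (\<Sum>x\<in>I. b x)"
    by (rule sum.cong[OF refl u(2)])
  finally have "(\<Sum>x\<in>I. b x) = eps k N (\<Sum>x\<in>I. u x)"
    using eps_eq_Sym[OF _ v, of N] k by simp
  then have image: "(\<Sum>x\<in>I. b x) \<in> eps k N ` g_space k"
    using v by (rule image_eqI)
  have eps: "(\<Sum>(l, j)\<in>I. g_bracket N (eps l N (F l)) (eps j N (G j))) = (\<Sum>x\<in>I. b x)"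
    by (intro sum.cong) (auto simp: eps_eq_Sym FG I_def b_def)
  have eq: "G_bracket N F G k = inv_into (g_space k) (eps k N) (\<Sum>x\<in>I. b x)"
    unfolding G_bracket_def I_def[symmetric] eps if_P[OF k] ..
  show in_g: "G_bracket N F G k \<in> g_space k"
    unfolding eq by (rule inv_into_into[OF image])
  have "Sym N (G_bracket N F G k) = eps k N (G_bracket N F G k)"
    using eps_eq_Sym[OF _ in_g, of N] k by simp
  also have "\<dots> = (\<Sum>x\<in>I. b x)"
    unfolding eq by (rule f_inv_into_f[OF image])
  finally show "Sym N (G_bracket N F G k) =
      (\<Sum>(l, j) \<in> {(l, j). l \<in> {1..N} \<and> j \<in> {1..N} \<and> min (l + j - 1) N = k}.
         g_bracket N (Sym N (F l)) (Sym N (G j)))"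
    unfolding I_def b_def .
qed

lemma G_bracket_in_topspace:
  assumes "F \<in> topspace (G_top N)" "G \<in> topspace (G_top N)"
  shows "G_bracket N F G \<in> topspace (G_top N)"
  unfolding topspace_G_top
proof (intro CollectI allI)
  fix k
  show "G_bracket N F G k \<in> (if k \<in> {1..N} then g_space k else {0})"
  proof (cases "k \<in> {1..N}")
    case True
    then show ?thesis
      using G_bracket_in_g_space[OF assms True] by (simp only: if_True)
  next
    case False
    then show ?thesis
      by (simp only: if_False G_bracket_def singleton_iff)
  qed
qed

lemma Sym_total_G_bracket:
  assumes F: "F \<in> topspace (G_top N)" and G: "G \<in> topspace (G_top N)"
  shows "Sym_total N (G_bracket N F G) = g_bracket N (Sym_total N F) (Sym_total N G)"
proof -
  let ?b = "\<lambda>(l, j). g_bracket N (Sym N (F l)) (Sym N (G j))"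
  let ?K = "\<lambda>(l, j). min (l + j - 1) N"
  have smooth: "smooth_obs N (Sym N (H k))" if "H \<in> topspace (G_top N)" "k \<in> {1..N}" for H k
    by (rule g_space_smooth[OF Sym_g_space[OF _ topspace_G_topD(1)[OF that]]]) (use that(2) in simp)
  have total: "Sym_total N H = (\<lambda>z. 1 * (\<Sum>k=1..N. Sym N (H k) z))" for H
    by (simp add: Sym_total_def sum_fun_apply fun_eq_iff)
  have "Sym_total N (G_bracket N F G) = (\<Sum>k=1..N. \<Sum>x\<in>{x \<in> {1..N} \<times> {1..N}. ?K x = k}. ?b x)"
    unfolding Sym_total_def
  proof (rule sum.cong[OF refl])
    fix k assume k: "k \<in> {1..N}"
    have set_eq: "{(l, j). l \<in> {1..N} \<and> j \<in> {1..N} \<and> min (l + j - 1) N = k}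
        = {x \<in> {1..N} \<times> {1..N}. ?K x = k}"
      by auto
    show "Sym N (G_bracket N F G k) = (\<Sum>x\<in>{x \<in> {1..N} \<times> {1..N}. ?K x = k}. ?b x)"
      using Sym_G_bracket[OF F G k] unfolding set_eq .
  qed
  \<comment> \<open>Each pair belongs to exactly one level: \<open>l\<close> and \<open>j\<close>
    are at least 1, so \<open>min (l + j - 1) N\<close> lies in \<open>{1..N}\<close>.\<close>
  also have "\<dots> = (\<Sum>x\<in>{1..N} \<times> {1..N}. ?b x)"
    by (rule sum.group) auto
  also have "\<dots> = (\<Sum>l=1..N. \<Sum>j=1..N. ?b (l, j))"
    by (simp only: sum.cartesian_product prod.case)
  also have "\<dots> = g_bracket N (Sym_total N F) (Sym_total N G)"
  proof -
    have "g_bracket N (Sym_total N F) (Sym_total N G)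
        = (\<lambda>z. 1 * (\<Sum>l=1..N. g_bracket N (Sym N (F l)) (Sym_total N G) z))"
      unfolding total[of F] using smooth[OF F] by (rule g_bracket_sum_left)
    also have "\<dots> = (\<lambda>z. 1 * (\<Sum>l=1..N. 1 * (\<Sum>j=1..N. g_bracket N (Sym N (F l)) (Sym N (G j)) z)))"
      unfolding total[of G] using smooth[OF G] by (subst g_bracket_sum_right) auto
    finally show ?thesis
      by (simp add: fun_eq_iff sum_fun_apply)
  qed
  finally show ?thesis .
qed

section \<open>The chain rule and the identity of brackets\<close>

lemma diff_elem_iota_mar:
  fixes F :: "(('d::finite) hier \<Rightarrow> real) \<Rightarrow> real"
  assumes F: "gateaux_smooth (strong_dual (G_top N)) euclideanreal F" and \<gamma>: "\<gamma> \<in> dual_space (g_top N)"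
  shows "diff_elem (g_top N) (F \<circ> iota_mar N) \<gamma> = Sym_total N (diff_elem (G_top N) F (iota_mar N \<gamma>))"
proof (rule diff_elem_eqI)
  let ?f = "diff_elem (G_top N) F (iota_mar N \<gamma>)"
  note dF = diff_elem_G_top[OF F iota_mar_dual[OF \<gamma>]]
  show "Sym_total N ?f \<in> topspace (g_top N)"
    using Sym_total_in_g_space[OF dF(1)] by simp
  fix \<delta> :: "'d obs \<Rightarrow> real" assume \<delta>: "\<delta> \<in> dual_space (g_top N)"
  \<comment> \<open>By linearity of the marginal map the two difference quotients are the same
    function of \<open>t\<close>, so their limits need no comparison.\<close>
  have "dir_deriv euclideanreal (F \<circ> iota_mar N) \<gamma> \<delta> = dir_deriv euclideanreal F (iota_mar N \<gamma>) (iota_mar N \<delta>)"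
    by (simp only: dir_deriv_def o_apply iota_mar_affine[OF \<gamma> \<delta>])
  also have "\<dots> = iota_mar N \<delta> ?f"
    by (rule dF(2)[OF iota_mar_dual[OF \<delta>]])
  also have "\<dots> = \<delta> (Sym_total N ?f)"
    using dF(1) by (simp add: iota_mar_eq_transpose[OF \<delta>] transpose_map_def)
  finally show "dir_deriv euclideanreal (F \<circ> iota_mar N) \<gamma> \<delta> = \<delta> (Sym_total N ?f)" .
next
  fix f g :: "'d obs"
  assume "f \<in> topspace (g_top N)" "g \<in> topspace (g_top N)" "\<And>\<Delta>. \<Delta> \<in> dual_space (g_top N) \<Longrightarrow> \<Delta> f = \<Delta> g"
  then show "f = g"
    by (intro g_top_separated) auto
qed

text \<open>As a transpose, \<open>iota_mar N \<gamma>\<close> evaluates the hierarchy bracket by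
  applying \<open>\<gamma>\<close> to its image under \<open>Sym_total N\<close>; the homomorphism
  property turns this image into the bracket of the images, which are the derivatives of the
  composed functionals.\<close>

lemma lie_poisson_iota_mar:
  fixes F G :: "(('d::finite) hier \<Rightarrow> real) \<Rightarrow> real"
  assumes F: "gateaux_smooth (strong_dual (G_top N)) euclideanreal F"
    and G: "gateaux_smooth (strong_dual (G_top N)) euclideanreal G"
    and \<gamma>: "\<gamma> \<in> dual_space (g_top N)"
  shows "lie_poisson (g_top N) (g_bracket N) (F \<circ> iota_mar N) (G \<circ> iota_mar N) \<gamma> =
    lie_poisson (G_top N) (G_bracket N) F G (iota_mar N \<gamma>)"
proof -
  note dF = diff_elem_G_top(1)[OF F iota_mar_dual[OF \<gamma>]]
    and dG = diff_elem_G_top(1)[OF G iota_mar_dual[OF \<gamma>]]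
  show ?thesis
    unfolding lie_poisson_def diff_elem_iota_mar[OF F \<gamma>] diff_elem_iota_mar[OF G \<gamma>]
      iota_mar_eq_transpose[OF \<gamma>, THEN fun_cong, of "G_bracket N _ _"]
      transpose_map_def if_P[OF G_bracket_in_topspace[OF dF dG]]
    using G_bracket_in_topspace[OF dF dG] Sym_total_G_bracket[OF dF dG] by simp
qed

theorem proposition4p18:
  fixes N :: nat
  assumes "N \<ge> 1"
  shows "gateaux_smooth (strong_dual (g_top N)) (strong_dual (G_top N))
           (iota_mar N :: (('d::finite) obs \<Rightarrow> real) \<Rightarrow> ('d hier \<Rightarrow> real)) \<and>
         (\<forall>(F :: ('d hier \<Rightarrow> real) \<Rightarrow> real) (G :: ('d hier \<Rightarrow> real) \<Rightarrow> real).
            gateaux_smooth (strong_dual (G_top N)) euclideanreal F \<longrightarrow>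
            gateaux_smooth (strong_dual (G_top N)) euclideanreal G \<longrightarrow>
            (\<forall>\<gamma>\<in>dual_space (g_top N).
               lie_poisson (g_top N) (g_bracket N) (F \<circ> iota_mar N) (G \<circ> iota_mar N) \<gamma> =
               lie_poisson (G_top N) (G_bracket N) F G (iota_mar N \<gamma>)))"
  using gateaux_smooth_iota_mar lie_poisson_iota_mar by blast

end
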